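(* Let $a:\mathbb{R}\to\mathbb{R}$ be continuous, fix $x_0\in\mathbb{R}$, let $\mathcal{E}(x)=\exp\big[-\int_{x_0}^xa(y)\,dy\big]$, and let $\omega\in A_p^-$ for some $1\le p<\infty$. If $u\in W^{1,p}_a(\omega)$ then, for any $0<\alpha<1$, $(\mathfrak{D}_{\mathrm{left},a})^\alpha u$ is a function in $L^p(\mathcal{E}^{-p}\omega)$ such that $$(\mathfrak{D}_{\mathrm{left},a})^\alpha u(x)=c_\alpha\,\mathcal{E}(x)\int_{-\infty}^x\frac{(\mathcal{E}^{-1}u)(x)-(\mathcal{E}^{-1}u)(t)}{(x-t)^{1+\alpha}}\,dt\qquad\text{for a.e. }x\in\mathbb{R},$$ where $c_\alpha=1/|\Gamma(-\alpha)|$, and there exists a constant $C=C(\omega)>0$ such that $$\|(\mathfrak{D}_{\mathrm{left},a})^\alpha u\|_{L^p(\mathcal{E}^{-p}\omega)}\le C\|u\|_{W^{1,p}_a(\omega)}.$$ Moreover, $$\lim_{\alpha\to1^-}(\mathfrak{D}_{\mathrm{left},a})^\alpha u=\mathfrak{D}_{\mathrm{left},a}u\quad\text{in }L^p(\mathcal{E}^{-p}\omega)\text{ and a.e. in }\mathbb{R}\tag{1}$$ and $$\lim_{\alpha\to0^+}(\mathfrak{D}_{\mathrm{left},a})^\alpha u=u\quad\text{a.e. in }\mathbb{R}.$$ Conversely, if $u\in L^p(\mathcal{E}^{-p}\omega)$ is such that $(\mathfrak{D}_{\mathrm{left},a})^\alpha u\in L^p(\mathcal{E}^{-p}\omega)$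 and $(\mathfrak{D}_{\mathrm{left},a})^\alpha u$ converges in $L^p(\mathcal{E}^{-p}\omega)$ as $\alpha\to1^-$, then $u\in W^{1,p}_a(\omega)$ and (1) holds.
   Context: Weights: a nonnegative, locally integrable (without loss of generality positive) function $\omega$ on $\mathbb{R}$ is in $A_p^-$, $1<p<\infty$, if there is $C>0$ with $\big(\frac1h\int_x^{x+h}\omega\big)^{1/p}\big(\frac1h\int_{x-h}^x\omega^{1-p'}\big)^{1/p'}\le C$ for all $x\in\mathbb{R}$, $h>0$, with $1/p+1/p'=1$; it is in $A_1^-$ if $M^+\omega\le C\omega$ a.e., where $M^+u(x)=\sup_{h>0}\frac1h\int_x^{x+h}|u(y)|\,dy$. $L^p(\mathcal{E}^{-p}\omega)$ is the $L^p$ space with respect to $\mathcal{E}^{-p}\omega\,dx$. Sobolev space: $W^{1,p}_a(\omega)=\{u\in L^p(\mathcal{E}^{-p}\omega):\mathfrak{D}_{\mathrm{left},a}u\in L^p(\mathcal{E}^{-p}\omega)\}$ with norm $\|u\|_{W^{1,p}_a(\omega)}=\big(\|u\|^p_{L^p(\mathcal{E}^{-p}\omega)}+\|\mathfrak{D}_{\mathrm{left},a}u\|^p_{L^p(\mathcal{E}^{-p}\omega)}\big)^{1/p}$, where $\mathfrak{D}_{\mathrm{left},a}u=u'+au=\mathcal{E}(\mathcal{E}^{-1}u)'$ with derivatives in the weak sense. Fractional power: $\mathcal{S}_-$ is the set of Schwartz functions $\varphi$ on $\mathbb{R}$ with $\operatorname{supp}\varphi\subset(-\infty,A]$ for some $A\in\mathbb{R}$;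 for $\varphi\in\mathcal{S}_-$, $(D_{\mathrm{right}})^\alpha\varphi(x)=c_\alpha\int_x^\infty\frac{\varphi(x)-\varphi(t)}{(t-x)^{1+\alpha}}\,dt$. For $w\in L^p(\omega)$, $(D_{\mathrm{left}})^\alpha w$ is the distribution in $(\mathcal{S}_-)'$ given by $\varphi\mapsto\int_{\mathbb{R}}w\,(D_{\mathrm{right}})^\alpha\varphi\,dx$. For $u\in L^p(\mathcal{E}^{-p}\omega)$, $(\mathfrak{D}_{\mathrm{left},a})^\alpha u=\mathcal{E}\,(D_{\mathrm{left}})^\alpha(\mathcal{E}^{-1}u)$; that it equals a function $g\in L^p(\mathcal{E}^{-p}\omega)$ means that $\int\mathcal{E}^{-1}u\,(D_{\mathrm{right}})^\alpha\varphi\,dx=\int\mathcal{E}^{-1}g\,\varphi\,dx$ for all $\varphi\in\mathcal{S}_-$. *)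

theory Defs
  imports "HOL-Analysis.Analysis"
begin

text \<open>Functions and weights are real-valued and Borel measurable; every class of functions modulo
  null sets has such representatives.\<close>

section \<open>One-sided Muckenhoupt weights\<close>

definition locally_integrable :: "(real \<Rightarrow> real) \<Rightarrow> bool" where
  "locally_integrable f \<longleftrightarrow> (\<forall>a b. set_integrable lborel {a..b} f)"

definition weight :: "(real \<Rightarrow> real) \<Rightarrow> bool" where
  "weight \<omega> \<longleftrightarrow> (\<forall>x. 0 \<le> \<omega> x) \<and> (AE x in lborel. 0 < \<omega> x) \<and> locally_integrable \<omega>"

definition maximal_right :: "(real \<Rightarrow> real) \<Rightarrow> real \<Rightarrow> ennreal" where
  "maximal_right u x =
     (SUP h\<in>{0<..}. ennreal (1 / h) * (\<integral>\<^sup>+ y\<in>{x..x + h}. ennreal \<bar>u y\<bar> \<partial>lborel))"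

definition conj_exponent :: "real \<Rightarrow> real" where
  "conj_exponent p = p / (p - 1)"

text \<open>For \<open>p > 1\<close>, finiteness of the second average is required explicitly, since the Bochner
  integral of a non-integrable function is \<open>0\<close>. As the weight is positive almost everywhere, this
  is part of what the usual condition with values in \<open>[0, \<infinity>]\<close> says.\<close>

definition Ap_minus :: "real \<Rightarrow> (real \<Rightarrow> real) set" where
  "Ap_minus p = {\<omega>. weight \<omega> \<and>
     (if p = 1 then
        (\<exists>C>0. AE x in lborel. maximal_right \<omega> x \<le> ennreal (C * \<omega> x))
      else 1 < p \<and>
        (\<exists>C>0. \<forall>x. \<forall>h>0.
           set_integrable lborel {x - h..x} (\<lambda>y. \<omega> y powr (1 - conj_exponent p)) \<and>
           (1 / h * (LBINT y:{x..x + h}. \<omega> y)) powr (1 / p) *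
           (1 / h * (LBINT y:{x - h..x}. \<omega> y powr (1 - conj_exponent p)))
             powr (1 / conj_exponent p) \<le> C))}"

section \<open>Weighted Lebesgue and Sobolev spaces\<close>

definition Lp_space :: "real \<Rightarrow> real measure \<Rightarrow> (real \<Rightarrow> real) set" where
  "Lp_space p M = {f. f \<in> borel_measurable M \<and> integrable M (\<lambda>x. \<bar>f x\<bar> powr p)}"

definition Lp_norm :: "real \<Rightarrow> real measure \<Rightarrow> (real \<Rightarrow> real) \<Rightarrow> real" where
  "Lp_norm p M f = (\<integral>x. \<bar>f x\<bar> powr p \<partial>M) powr (1 / p)"

text \<open>The interval integral is oriented, so the formula also covers \<open>x < x0\<close>.\<close>

definition exp_factor :: "(real \<Rightarrow> real) \<Rightarrow> real \<Rightarrow> real \<Rightarrow> real" where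
  "exp_factor a x0 x = exp (- (LBINT y=ereal x0..ereal x. a y))"

definition weighted_measure ::
    "real \<Rightarrow> (real \<Rightarrow> real) \<Rightarrow> real \<Rightarrow> (real \<Rightarrow> real) \<Rightarrow> real measure" where
  "weighted_measure p a x0 \<omega> =
     density lborel (\<lambda>x. ennreal (exp_factor a x0 x powr (- p) * \<omega> x))"

definition smooth :: "(real \<Rightarrow> real) \<Rightarrow> bool" where
  "smooth \<phi> \<longleftrightarrow> (\<forall>n x. (deriv ^^ n) \<phi> differentiable (at x))"

definition supp :: "(real \<Rightarrow> real) \<Rightarrow> real set" where
  "supp \<phi> = closure (support_on UNIV \<phi>)"

definition test_functions :: "(real \<Rightarrow> real) set" where
  "test_functions = {\<phi>. smooth \<phi> \<and> compact (supp \<phi>)}"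

definition has_weak_deriv :: "(real \<Rightarrow> real) \<Rightarrow> (real \<Rightarrow> real) \<Rightarrow> bool" where
  "has_weak_deriv f g \<longleftrightarrow> locally_integrable f \<and> locally_integrable g \<and>
     (\<forall>\<phi>\<in>test_functions. (\<integral>x. f x * deriv \<phi> x \<partial>lborel) = - (\<integral>x. g x * \<phi> x \<partial>lborel))"

text \<open>\<open>v = u' + a u\<close> in the weak sense.\<close>

definition has_left_deriv :: "(real \<Rightarrow> real) \<Rightarrow> (real \<Rightarrow> real) \<Rightarrow> (real \<Rightarrow> real) \<Rightarrow> bool" where
  "has_left_deriv a u v \<longleftrightarrow> has_weak_deriv u (\<lambda>x. v x - a x * u x)"

text \<open>The weak derivative is unique up to null sets; this selects a representative.\<close>

definition left_deriv :: "(real \<Rightarrow> real) \<Rightarrow> (real \<Rightarrow> real) \<Rightarrow> real \<Rightarrow> real" where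
  "left_deriv a u = (SOME v. v \<in> borel_measurable lborel \<and> has_left_deriv a u v)"

definition Sobolev ::
    "real \<Rightarrow> (real \<Rightarrow> real) \<Rightarrow> real \<Rightarrow> (real \<Rightarrow> real) \<Rightarrow> (real \<Rightarrow> real) set" where
  "Sobolev p a x0 \<omega> = {u \<in> Lp_space p (weighted_measure p a x0 \<omega>).
     \<exists>v \<in> Lp_space p (weighted_measure p a x0 \<omega>). has_left_deriv a u v}"

definition Sobolev_norm ::
    "real \<Rightarrow> (real \<Rightarrow> real) \<Rightarrow> real \<Rightarrow> (real \<Rightarrow> real) \<Rightarrow> (real \<Rightarrow> real) \<Rightarrow> real" where
  "Sobolev_norm p a x0 \<omega> u =
     (Lp_norm p (weighted_measure p a x0 \<omega>) u powr p +
      Lp_norm p (weighted_measure p a x0 \<omega>) (left_deriv a u) powr p) powr (1 / p)"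

section \<open>Fractional powers\<close>

definition schwartz :: "(real \<Rightarrow> real) \<Rightarrow> bool" where
  "schwartz \<phi> \<longleftrightarrow> smooth \<phi> \<and> (\<forall>k n. bounded (range (\<lambda>x. x ^ k * (deriv ^^ n) \<phi> x)))"

definition schwartz_minus :: "(real \<Rightarrow> real) set" where
  "schwartz_minus = {\<phi>. schwartz \<phi> \<and> (\<exists>A. supp \<phi> \<subseteq> {..A})}"

definition frac_const :: "real \<Rightarrow> real" where
  "frac_const \<alpha> = 1 / \<bar>Gamma (- \<alpha>)\<bar>"

definition frac_right :: "real \<Rightarrow> (real \<Rightarrow> real) \<Rightarrow> real \<Rightarrow> real" where
  "frac_right \<alpha> \<phi> x =
     frac_const \<alpha> * (LBINT t:{x<..}. (\<phi> x - \<phi> t) / (t - x) powr (1 + \<alpha>))"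

text \<open>The fractional power of \<open>u\<close>, which is defined by duality with \<open>schwartz_minus\<close>, equals the
  function \<open>g\<close>. If \<open>u\<close> and \<open>g\<close> are in the weighted Lebesgue space of a weight in \<open>Ap_minus p\<close>, both
  integrals converge absolutely: \<open>frac_right \<alpha> \<phi>\<close> vanishes to the right of the support of \<open>\<phi>\<close> and
  decays like \<open>\<bar>x\<bar> powr (- 1 - \<alpha>)\<close> at minus infinity.\<close>

definition has_frac_left ::
    "(real \<Rightarrow> real) \<Rightarrow> real \<Rightarrow> real \<Rightarrow> (real \<Rightarrow> real) \<Rightarrow> (real \<Rightarrow> real) \<Rightarrow> bool" where
  "has_frac_left a x0 \<alpha> u g \<longleftrightarrow>
     (\<forall>\<phi>\<in>schwartz_minus.
        (\<integral>x. inverse (exp_factor a x0 x) * u x * frac_right \<alpha> \<phi> x \<partial>lborel) =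
        (\<integral>x. inverse (exp_factor a x0 x) * g x * \<phi> x \<partial>lborel))"

definition frac_left_integrand ::
    "(real \<Rightarrow> real) \<Rightarrow> real \<Rightarrow> real \<Rightarrow> (real \<Rightarrow> real) \<Rightarrow> real \<Rightarrow> real \<Rightarrow> real" where
  "frac_left_integrand a x0 \<alpha> u x t =
     (inverse (exp_factor a x0 x) * u x - inverse (exp_factor a x0 t) * u t)
       / (x - t) powr (1 + \<alpha>)"

definition frac_left_pointwise ::
    "(real \<Rightarrow> real) \<Rightarrow> real \<Rightarrow> real \<Rightarrow> (real \<Rightarrow> real) \<Rightarrow> real \<Rightarrow> real" where
  "frac_left_pointwise a x0 \<alpha> u x =
     frac_const \<alpha> * exp_factor a x0 x * (LBINT t:{..<x}. frac_left_integrand a x0 \<alpha> u x t)"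

text \<open>Convergence of the fractional powers of \<open>u\<close> to \<open>left_deriv a u\<close> as \<open>\<alpha>\<close> tends to \<open>1\<close> from the
  left, in the weighted Lebesgue space and almost everywhere. Convergence in norm does not depend on
  the representatives \<open>g \<alpha>\<close>. Almost everywhere convergence does, because \<open>\<alpha>\<close> ranges over an
  uncountable set, and therefore refers to the representatives given by the pointwise formula.\<close>

definition frac_left_tends_to_deriv ::
    "real \<Rightarrow> (real \<Rightarrow> real) \<Rightarrow> real \<Rightarrow> (real \<Rightarrow> real) \<Rightarrow> (real \<Rightarrow> real) \<Rightarrow> bool" where
  "frac_left_tends_to_deriv p a x0 \<omega> u \<longleftrightarrow>
     (\<forall>g. (\<forall>\<alpha>\<in>{0<..<1}. g \<alpha> \<in> Lp_space p (weighted_measure p a x0 \<omega>) \<and>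
                        has_frac_left a x0 \<alpha> u (g \<alpha>)) \<longrightarrow>
        ((\<lambda>\<alpha>. Lp_norm p (weighted_measure p a x0 \<omega>) (\<lambda>x. g \<alpha> x - left_deriv a u x))
           \<longlongrightarrow> 0) (at_left 1)) \<and>
     (AE x in lborel. ((\<lambda>\<alpha>. frac_left_pointwise a x0 \<alpha> u x) \<longlongrightarrow> left_deriv a u x) (at_left 1))"

end

theory Submission
  imports Defs
begin

text \<open>Dividing by \<open>\<E>\<close>, a positive \<open>C\<^sup>1\<close> function with \<open>\<E>' = - a \<E>\<close>, removes the coefficient \<open>a\<close>: with
\<open>w = u / \<E>\<close> and \<open>f = v / \<E>\<close>, one has \<open>v = u' + a u\<close> exactly if \<open>w' = f\<close>, and the norm of \<open>u\<close> is the norm of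
\<open>w\<close> in \<open>L\<^sup>p(\<omega>)\<close>. A function with a weak derivative is almost everywhere equal to an antiderivative \<open>W\<close> of it
(\<open>weak_deriv_antiderivative\<close>), so the theorem is about
\<open>D\<^sup>\<alpha> W(x) = c\<^sub>\<alpha> \<integral>\<^sub>0\<^sup>\<infinity> (W(x) - W(x - s)) s\<^sup>-\<^sup>1\<^sup>-\<^sup>\<alpha> ds\<close>, where \<open>c\<^sub>\<alpha>\<close> is of the order of
\<open>\<alpha> (1 - \<alpha>)\<close>.

The weight enters through one inequality, \<open>one_sided_bound\<close>, which compares the average of a function over
\<open>[x - h, x]\<close> with the mass of \<open>\<omega>\<close> on \<open>[x, x + h]\<close>. Jensen's inequality derives it from the Muckenhoupt condition for
\<open>p > 1\<close>, and for \<open>p = 1\<close> it follows from the bound on the maximal function. It implies that the averages over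
\<open>[x - 2 h, x - h]\<close> are bounded on \<open>L\<^sup>p(\<omega>)\<close> uniformly in \<open>h\<close>, and since a decreasing kernel is
dominated by a superposition of such averages, convolution with it is bounded by its mass
(\<open>wint_antitone_convolution\<close>). Maximal operators are unbounded on \<open>L\<^sup>1(\<omega>)\<close>;
estimating the convolutions directly treats all \<open>p \<ge> 1\<close> alike.

The norm estimate (\<open>wint_frac_deriv_uniform\<close>) splits the integral at \<open>s = 1\<close>. An increment of \<open>W\<close> over a
length \<open>s \<le> 1\<close> is an integral of \<open>f\<close>, which gives a convolution of \<open>\<bar>f\<bar>\<close> with a kernel of mass
\<open>1 / (\<alpha> (1 - \<alpha>))\<close>. The part \<open>s > 1\<close> gives \<open>\<bar>W\<bar>\<close> and a convolution of it, with constants of order \<open>1 / \<alpha>\<close>. The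
constant \<open>c\<^sub>\<alpha>\<close> absorbs these factors.

As \<open>\<alpha>\<close> tends to \<open>1\<close>, the measure \<open>(1 - \<alpha>) s\<^sup>-\<^sup>\<alpha> ds\<close> on \<open>(0, 1]\<close> concentrates at \<open>0\<close>, and \<open>D\<^sup>\<alpha> W\<close> inherits
the limit of the difference quotients of \<open>W\<close>: almost everywhere by Lebesgue differentiation, and in norm because the
difference quotients converge in \<open>L\<^sup>p(\<omega>)\<close>, by approximation with bounded functions of bounded support. As \<open>\<alpha>\<close>
tends to \<open>0\<close>, the measure \<open>\<alpha> s\<^sup>-\<^sup>1\<^sup>-\<^sup>\<alpha> ds\<close> on \<open>(1, \<infinity>)\<close> escapes to infinity, where the averages of \<open>W\<close> are small
(\<open>tail_small\<close>), and only \<open>W(x)\<close> remains.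

That \<open>D\<^sup>\<alpha> W\<close> is the fractional power defined by duality is Fubini's theorem (\<open>frac_deriv_duality\<close>): for
every \<open>s\<close>, the functions \<open>W(x) (\<phi>(x) - \<phi>(x + s))\<close> and \<open>\<phi>(x) (W(x) - W(x - s))\<close> have the same integral over
the line, and in this form both double integrals converge absolutely. For the converse, the right fractional derivatives
of a test function \<open>\<phi>\<close> tend to \<open>- \<phi>'\<close> under a common integrable bound, so the limit in norm of the fractional
powers satisfies the definition of the weak derivative.\<close>

section \<open>Powers of extended nonnegative reals and Jensen's inequality\<close>

text \<open>The power \<open>x\<^sup>p\<close> on \<open>[0, \<infinity>]\<close>. With values in this range, Tonelli's theorem applies to all the estimates below
without integrability conditions.\<close>
definition epow :: "real \<Rightarrow> ennreal \<Rightarrow> ennreal" where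
  "epow p x = (if x = top then top else ennreal (enn2real x powr p))"

lemma epow_ennreal: "0 \<le> r \<Longrightarrow> epow p (ennreal r) = ennreal (r powr p)"
  by (simp add: epow_def)

lemma epow_top [simp]: "epow p top = top"
  by (simp add: epow_def)

lemma epow_0 [simp]: "epow p 0 = 0"
  by (simp add: epow_def)

lemma epow_eq_0_iff [simp]: "epow p x = 0 \<longleftrightarrow> x = 0"
  by (cases x) (simp_all add: epow_def)

lemma epow_one: "epow 1 x = x"
  by (cases x) (simp_all add: epow_def)

lemma epow_mono: "0 \<le> p \<Longrightarrow> x \<le> y \<Longrightarrow> epow p x \<le> epow p y"
  by (cases x; cases y) (auto simp: epow_def top_unique intro!: powr_mono2 ennreal_leI)

lemma epow_mult: "epow p (x * y) = epow p x * epow p y"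
proof -
  have fin: "epow p (ennreal r * top) = epow p (ennreal r) * top" if "0 \<le> r" for r
    using that by (cases "r = 0") (simp_all add: epow_ennreal ennreal_mult_top)
  show ?thesis
  proof (cases x; cases y)
    fix r s assume "x = ennreal r" "y = ennreal s" "0 \<le> r" "0 \<le> s"
    then show ?thesis
      by (simp add: epow_ennreal powr_mult flip: ennreal_mult)
  next
    fix r assume "x = ennreal r" "y = top" "0 \<le> r"
    then show ?thesis using fin[of r] by simp
  next
    fix r assume "y = ennreal r" "x = top" "0 \<le> r"
    then show ?thesis using fin[of r] by (simp add: mult.commute)
  qed simp
qed

lemma epow_measurable [measurable]: "epow p \<in> borel_measurable borel"
  unfolding epow_def by measurable

lemma epow_add_le:
  assumes "0 \<le> p" shows "epow p (x + y) \<le> ennreal (2 powr p) * (epow p x + epow p y)"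
proof -
  have "x + y \<le> 2 * max x y"
    by (metis add_mono max.cobounded1 max.cobounded2 mult_2)
  then have "epow p (x + y) \<le> epow p (2 * max x y)" by (rule epow_mono[OF assms])
  also have "\<dots> = ennreal (2 powr p) * epow p (max x y)"
    using epow_ennreal[of 2 p] by (simp add: epow_mult)
  also have "\<dots> \<le> ennreal (2 powr p) * (epow p x + epow p y)"
    by (intro mult_left_mono) (auto simp: max_def)
  finally show ?thesis .
qed

text \<open>Young's inequality with a free parameter \<open>l\<close>. Its right-hand side is affine in \<open>x\<^sup>p\<close>, so it can be integrated;
Jensen's inequality is the optimal choice of \<open>l\<close> afterwards.\<close>
lemma young_epow:
  assumes p: "1 \<le> p" and l: "0 < l"
  shows "x \<le> ennreal (l powr (1 - p) / p) * epow p x + ennreal (l * (1 - 1 / p))"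
proof (cases x)
  case (real r)
  have "r \<le> l powr (1 - p) / p * r powr p + l * (1 - 1 / p)"
  proof (cases "r = 0")
    case True
    then show ?thesis using p l by simp
  next
    case False
    with real have r: "0 < r" by simp
    have "((r / l) powr p) powr (1/p) * 1 powr (1 - 1/p) \<le> (1/p) * ((r / l) powr p) + (1 - 1/p) * 1"
      by (rule Youngs_inequality_0) (use p l r in auto)
    then have "r / l \<le> (1/p) * ((r / l) powr p) + (1 - 1/p)"
      using p l r by (simp add: powr_powr)
    then have "l * (r / l) \<le> l * ((1/p) * ((r / l) powr p) + (1 - 1/p))"
      using l by (intro mult_left_mono) auto
    moreover have "l * (r / l) = r" using l by simp
    moreover have "l * ((1/p) * ((r / l) powr p)) = l powr (1 - p) / p * r powr p"
      using l r by (simp add: powr_divide powr_diff)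
    ultimately show ?thesis by (simp only: distrib_left)
  qed
  then have "ennreal r \<le> ennreal (l powr (1 - p) / p * r powr p + l * (1 - 1 / p))"
    by (rule ennreal_leI)
  also have "\<dots> = ennreal (l powr (1 - p) / p) * ennreal (r powr p) + ennreal (l * (1 - 1 / p))"
    using p l by (subst ennreal_plus, simp, simp, subst ennreal_mult) auto
  finally show ?thesis using real by (simp add: epow_ennreal)
next
  case top
  have "0 < l powr (1 - p) / p" using p l by simp
  then have "ennreal (l powr (1 - p) / p) \<noteq> 0" using p l by simp
  then show ?thesis using top by (simp add: ennreal_mult_top)
qed

lemma jensen_epow:
  assumes p: "1 \<le> p" and m: "0 < m" "emeasure M (space M) \<le> ennreal m"
    and F[measurable]: "F \<in> borel_measurable M"
  shows "epow p (\<integral>\<^sup>+x. F x \<partial>M) \<le> ennreal (m powr (p - 1)) * (\<integral>\<^sup>+x. epow p (F x) \<partial>M)"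
proof (cases "\<integral>\<^sup>+x. epow p (F x) \<partial>M")
  case (real J)
  show ?thesis
  proof (cases "J = 0")
    case True
    have "AE x in M. epow p (F x) = 0"
      using real True by (subst nn_integral_0_iff_AE[symmetric]) auto
    then have "AE x in M. F x = 0" by simp
    then have "(\<integral>\<^sup>+x. F x \<partial>M) = 0" by (subst nn_integral_0_iff_AE) auto
    then show ?thesis by simp
  next
    case False
    with real have J: "0 < J" by simp
    \<comment> \<open>the minimizer of the integrated right-hand side of Young's inequality\<close>
    define l where "l = (J / m) powr (1/p)"
    have l: "0 < l" using J m by (simp add: l_def)
    have "(\<integral>\<^sup>+x. F x \<partial>M) \<le>
        (\<integral>\<^sup>+x. ennreal (l powr (1 - p) / p) * epow p (F x) + ennreal (l * (1 - 1 / p)) \<partial>M)"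
      by (intro nn_integral_mono young_epow p l)
    also have "\<dots> = ennreal (l powr (1 - p) / p) * ennreal J + ennreal (l * (1 - 1 / p)) * emeasure M (space M)"
      using real by (subst nn_integral_add) (auto simp: nn_integral_cmult)
    also have "\<dots> \<le> ennreal (l powr (1 - p) / p) * ennreal J + ennreal (l * (1 - 1 / p)) * ennreal m"
      by (intro add_mono mult_left_mono m) auto
    also have "\<dots> = ennreal (l powr (1 - p) / p * J + l * (1 - 1 / p) * m)"
      using l p J m by (simp flip: ennreal_mult ennreal_plus)
    also have "l powr (1 - p) / p * J + l * (1 - 1 / p) * m = m * l"
    proof -
      have "l powr p = J / m" using p J m by (simp add: l_def powr_powr)
      then have "l powr (1 - p) * J = m * l" using l m J by (simp add: powr_diff)
      then show ?thesis using p by (simp add: field_simps)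
    qed
    finally have "epow p (\<integral>\<^sup>+x. F x \<partial>M) \<le> epow p (ennreal (m * l))"
      using p by (intro epow_mono) auto
    also have "\<dots> = ennreal ((m * l) powr p)" using m l by (simp add: epow_ennreal)
    also have "(m * l) powr p = m powr (p - 1) * J"
      using m l p J by (simp add: powr_mult l_def powr_powr powr_diff)
    finally show ?thesis using real by (simp add: ennreal_mult)
  qed
next
  case top
  then show ?thesis using m by (simp add: ennreal_mult_top)
qed

section \<open>Convolutions on a space with a one-sided weight\<close>

lemma ennreal_mult_collapse:
  "0 \<le> a \<Longrightarrow> 0 \<le> b \<Longrightarrow> ennreal a * (ennreal b * x) = ennreal (a * b) * x"
  by (simp add: mult.assoc ennreal_mult)

lemma nn_integral_reflect:
  fixes f :: "real \<Rightarrow> ennreal"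
  assumes [measurable]: "f \<in> borel_measurable borel"
  shows "(\<integral>\<^sup>+y. f y \<partial>lborel) = (\<integral>\<^sup>+s. f (x - s) \<partial>lborel)"
  using nn_integral_real_affine[of f "-1" x] by simp

lemma nn_integral_interval_reflect:
  fixes f :: "real \<Rightarrow> ennreal"
  assumes [measurable]: "f \<in> borel_measurable borel"
  shows "(\<integral>\<^sup>+y\<in>{x - b..x - a}. f y \<partial>lborel) = (\<integral>\<^sup>+s\<in>{a..b}. f (x - s) \<partial>lborel)"
  by (subst nn_integral_reflect[where x = x]) (auto intro!: nn_integral_cong simp: indicator_def)

lemma indicator_interval_measurable [measurable]:
  fixes a b c :: "'a \<Rightarrow> real"
  assumes [measurable]: "a \<in> borel_measurable M" "b \<in> borel_measurable M" "c \<in> borel_measurable M"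
  shows "(\<lambda>x. indicator {a x..b x} (c x) :: ennreal) \<in> borel_measurable M"
  unfolding indicator_def by simp

text \<open>For a decreasing kernel, \<open>k s\<close> is at most the average of \<open>k\<close> over \<open>[s / 2, s]\<close>. Inserting this and exchanging
the integrals turns the convolution into a superposition of averages over intervals \<open>[x - 2 t, x - t]\<close> that stay away
from \<open>x\<close>.\<close>
lemma antitone_kernel_le_averages:
  fixes k f :: "real \<Rightarrow> ennreal"
  assumes [measurable]: "k \<in> borel_measurable borel" "f \<in> borel_measurable borel"
    and anti: "\<And>r s. 0 < r \<Longrightarrow> r \<le> s \<Longrightarrow> k s \<le> k r"
  shows "(\<integral>\<^sup>+s\<in>{0<..}. k s * f (x - s) \<partial>lborel) \<le>
    2 * (\<integral>\<^sup>+t\<in>{0<..}. k t * (ennreal (1 / t) * (\<integral>\<^sup>+y\<in>{x - 2 * t..x - t}. f y \<partial>lborel)) \<partial>lborel)"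
proof -
  have inner: "k s * f (x - s) * indicator {0<..} s \<le>
      2 * (\<integral>\<^sup>+t. k t * ennreal (1 / t) * indicator {0<..} t * (f (x - s) * indicator {t..2 * t} s) \<partial>lborel)" for s
  proof (cases "0 < s")
    case True
    have aux: "ennreal (1 / s) * (f (x - s) * ennreal (s / 2)) = inverse 2 * f (x - s)"
      using True ennreal_mult_collapse[of "1/s" "s/2" "f (x - s)"] inverse_ennreal[of 2]
      by (simp add: mult.commute[of "f _"] inverse_eq_divide)
    have "k s * f (x - s) * ennreal (1/2) = (\<integral>\<^sup>+t. k s * ennreal (1 / s) * f (x - s) * indicator {s/2..s} t \<partial>lborel)"
      using True by (subst nn_integral_cmult_indicator) (auto simp: aux mult_ac)
    also have "\<dots> \<le> (\<integral>\<^sup>+t. k t * ennreal (1 / t) * indicator {0<..} t * (f (x - s) * indicator {t..2 * t} s) \<partial>lborel)"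
      using True
      by (intro nn_integral_mono)
         (auto simp: indicator_def mult.assoc intro!: mult_mono anti ennreal_leI divide_left_mono)
    finally have "2 * (k s * f (x - s) * ennreal (1/2)) \<le> 2 * \<dots>" by (intro mult_left_mono) auto
    moreover have "2 * (k s * f (x - s) * ennreal (1/2)) = k s * f (x - s)"
      using ennreal_mult[of 2 "1/2"] by (simp add: mult_ac) (metis mult.assoc mult.left_commute mult_1)
    ultimately show ?thesis using True by simp
  qed simp
  have "(\<integral>\<^sup>+s\<in>{0<..}. k s * f (x - s) \<partial>lborel) \<le>
     (\<integral>\<^sup>+s. 2 * (\<integral>\<^sup>+t. k t * ennreal (1 / t) * indicator {0<..} t * (f (x - s) * indicator {t..2 * t} s) \<partial>lborel) \<partial>lborel)"
    by (intro nn_integral_mono inner)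
  also have "\<dots> = 2 * (\<integral>\<^sup>+s. (\<integral>\<^sup>+t. k t * ennreal (1 / t) * indicator {0<..} t * (f (x - s) * indicator {t..2 * t} s) \<partial>lborel) \<partial>lborel)"
    by (intro nn_integral_cmult) measurable
  also have "\<dots> = 2 * (\<integral>\<^sup>+t. (\<integral>\<^sup>+s. k t * ennreal (1 / t) * indicator {0<..} t * (f (x - s) * indicator {t..2 * t} s) \<partial>lborel) \<partial>lborel)"
    by (subst lborel_pair.Fubini') auto
  also have "(\<integral>\<^sup>+t. (\<integral>\<^sup>+s. k t * ennreal (1 / t) * indicator {0<..} t * (f (x - s) * indicator {t..2 * t} s) \<partial>lborel) \<partial>lborel)
     = (\<integral>\<^sup>+t\<in>{0<..}. k t * (ennreal (1 / t) * (\<integral>\<^sup>+y\<in>{x - 2 * t..x - t}. f y \<partial>lborel)) \<partial>lborel)"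
    by (intro nn_integral_cong, subst nn_integral_cmult, measurable)
       (simp add: nn_integral_interval_reflect mult_ac)
  finally show ?thesis .
qed

text \<open>The only property of the weight that the estimates use. Testing it on indicator functions shows that the mass of
the weight on the right interval is controlled by the mass on subsets of the left one.\<close>
definition one_sided_bound :: "real \<Rightarrow> real \<Rightarrow> (real \<Rightarrow> real) \<Rightarrow> bool" where
  "one_sided_bound p K \<omega> \<longleftrightarrow> (\<forall>f \<in> borel_measurable borel. \<forall>x. \<forall>h>0.
     epow p (\<integral>\<^sup>+y\<in>{x - h..x}. f y \<partial>lborel) * (\<integral>\<^sup>+y\<in>{x..x + h}. ennreal (\<omega> y) \<partial>lborel)
       \<le> ennreal (K * h powr p) * (\<integral>\<^sup>+y\<in>{x - h..x}. epow p (f y) * ennreal (\<omega> y) \<partial>lborel))"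

locale one_sided_weight =
  fixes p K :: real and \<omega> :: "real \<Rightarrow> real"
  assumes p: "1 \<le> p" and K: "0 < K"
    and meas_w [measurable]: "\<omega> \<in> borel_measurable borel"
    and nonneg_w: "\<And>x. 0 \<le> \<omega> x"
    and pos_w: "AE x in lborel. 0 < \<omega> x"
    and loc_w: "\<And>a b. (\<integral>\<^sup>+y\<in>{a..b}. ennreal (\<omega> y) \<partial>lborel) < top"
    and bound: "one_sided_bound p K \<omega>"
begin

lemma one_sided_bound_le:
  assumes "f \<in> borel_measurable borel" "0 < h"
  shows "epow p (\<integral>\<^sup>+y\<in>{x - h..x}. f y \<partial>lborel) * (\<integral>\<^sup>+y\<in>{x..x + h}. ennreal (\<omega> y) \<partial>lborel)
       \<le> ennreal (K * h powr p) * (\<integral>\<^sup>+y\<in>{x - h..x}. epow p (f y) * ennreal (\<omega> y) \<partial>lborel)"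
  using bound assms unfolding one_sided_bound_def by blast

text \<open>The \<open>p\<close>-th power of the norm in \<open>L\<^sup>p(\<omega>)\<close>, as an element of \<open>[0, \<infinity>]\<close>.\<close>
definition wint :: "(real \<Rightarrow> ennreal) \<Rightarrow> ennreal" where
  "wint f = (\<integral>\<^sup>+x. epow p (f x) * ennreal (\<omega> x) \<partial>lborel)"

abbreviation wabs :: "(real \<Rightarrow> real) \<Rightarrow> ennreal" where "wabs f \<equiv> wint (\<lambda>x. ennreal \<bar>f x\<bar>)"

lemma wint_mono_AE: "AE x in lborel. f x \<le> g x \<Longrightarrow> wint f \<le> wint g"
  unfolding wint_def
  by (rule nn_integral_mono_AE) (use p in \<open>auto intro!: mult_right_mono epow_mono elim!: eventually_mono\<close>)

lemma wint_mono: "(\<And>x. f x \<le> g x) \<Longrightarrow> wint f \<le> wint g"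
  by (rule wint_mono_AE) simp

lemma wint_cmult:
  assumes [measurable]: "f \<in> borel_measurable borel"
  shows "wint (\<lambda>x. c * f x) = epow p c * wint f"
  unfolding wint_def by (simp add: epow_mult nn_integral_cmult mult.assoc)

lemma wint_add_le:
  assumes [measurable]: "f \<in> borel_measurable borel" "g \<in> borel_measurable borel"
  shows "wint (\<lambda>x. f x + g x) \<le> ennreal (2 powr p) * (wint f + wint g)"
proof -
  have "wint (\<lambda>x. f x + g x) \<le> (\<integral>\<^sup>+x. ennreal (2 powr p) * (epow p (f x) * ennreal (\<omega> x) + epow p (g x) * ennreal (\<omega> x)) \<partial>lborel)"
    unfolding wint_def distrib_right[symmetric] mult.assoc[symmetric]
    using p by (intro nn_integral_mono mult_right_mono epow_add_le) auto
  also have "\<dots> = ennreal (2 powr p) * (wint f + wint g)"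
    unfolding wint_def by (simp add: nn_integral_cmult nn_integral_add)
  finally show ?thesis .
qed

lemma finite_AE_of_wint:
  assumes [measurable]: "f \<in> borel_measurable borel" and "wint f < top"
  shows "AE x in lborel. f x < top"
proof -
  have "AE x in lborel. epow p (f x) * ennreal (\<omega> x) \<noteq> \<infinity>"
    using assms(2) unfolding wint_def by (intro nn_integral_noteq_infinite) auto
  with pos_w show ?thesis
  proof eventually_elim
    case (elim x)
    then show ?case by (cases "f x = top") (auto simp: ennreal_top_mult less_top)
  qed
qed

text \<open>For \<open>z \<in> [x - h, x]\<close> the interval \<open>[x - 2 h, x - h]\<close> lies in \<open>[z - 2 h, z]\<close>. Averaging over such \<open>z\<close> and
exchanging the integrals leaves, for each \<open>z\<close>, the product in the one-sided bound at the point \<open>z\<close>: the gap of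
length \<open>h\<close> is what makes room for the weight on the right of \<open>z\<close>.\<close>
lemma wint_detached_average:
  assumes [measurable]: "f \<in> borel_measurable borel" and h: "0 < h"
  shows "wint (\<lambda>x. \<integral>\<^sup>+y\<in>{x - 2 * h..x - h}. f y \<partial>lborel) \<le> ennreal (2 * K * (2 * h) powr p) * wint f"
proof -
  let ?I = "\<lambda>z. \<integral>\<^sup>+y\<in>{z - 2 * h..z}. f y \<partial>lborel"
  have 1: "ennreal h * epow p (\<integral>\<^sup>+y\<in>{x - 2 * h..x - h}. f y \<partial>lborel) \<le> (\<integral>\<^sup>+z\<in>{x - h..x}. epow p (?I z) \<partial>lborel)" for x
  proof -
    have "ennreal h * epow p (\<integral>\<^sup>+y\<in>{x - 2 * h..x - h}. f y \<partial>lborel) =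
       (\<integral>\<^sup>+z\<in>{x - h..x}. epow p (\<integral>\<^sup>+y\<in>{x - 2 * h..x - h}. f y \<partial>lborel) \<partial>lborel)"
      using h by (subst nn_integral_cmult_indicator) (auto simp: mult.commute)
    also have "\<dots> \<le> (\<integral>\<^sup>+z\<in>{x - h..x}. epow p (?I z) \<partial>lborel)"
      using p by (intro nn_integral_mono) (auto simp: indicator_def intro!: epow_mono nn_integral_mono)
    finally show ?thesis .
  qed
  have "ennreal h * wint (\<lambda>x. \<integral>\<^sup>+y\<in>{x - 2 * h..x - h}. f y \<partial>lborel) =
      (\<integral>\<^sup>+x. ennreal h * (epow p (\<integral>\<^sup>+y\<in>{x - 2 * h..x - h}. f y \<partial>lborel) * ennreal (\<omega> x)) \<partial>lborel)"
    unfolding wint_def by (rule nn_integral_cmult[symmetric]) measurable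
  also have "\<dots> \<le> (\<integral>\<^sup>+x. (\<integral>\<^sup>+z. epow p (?I z) * indicator {x - h..x} z * ennreal (\<omega> x) \<partial>lborel) \<partial>lborel)"
    by (intro nn_integral_mono, subst nn_integral_multc, measurable)
       (use 1 in \<open>simp add: mult.assoc[symmetric] mult_right_mono\<close>)
  also have "\<dots> = (\<integral>\<^sup>+z. (\<integral>\<^sup>+x. epow p (?I z) * indicator {x - h..x} z * ennreal (\<omega> x) \<partial>lborel) \<partial>lborel)"
    by (subst lborel_pair.Fubini') auto
  also have "\<dots> = (\<integral>\<^sup>+z. epow p (?I z) * (\<integral>\<^sup>+x\<in>{z..z + h}. ennreal (\<omega> x) \<partial>lborel) \<partial>lborel)"
    by (intro nn_integral_cong, subst nn_integral_cmult[symmetric], measurable)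
       (auto intro!: nn_integral_cong simp: indicator_def)
  also have "\<dots> \<le> (\<integral>\<^sup>+z. epow p (?I z) * (\<integral>\<^sup>+x\<in>{z..z + 2 * h}. ennreal (\<omega> x) \<partial>lborel) \<partial>lborel)"
    using h by (intro nn_integral_mono mult_left_mono) (auto simp: indicator_def)
  also have "\<dots> \<le> (\<integral>\<^sup>+z. ennreal (K * (2 * h) powr p) * (\<integral>\<^sup>+y\<in>{z - 2 * h..z}. epow p (f y) * ennreal (\<omega> y) \<partial>lborel) \<partial>lborel)"
    using h by (intro nn_integral_mono one_sided_bound_le) auto
  also have "\<dots> = ennreal (K * (2 * h) powr p) * (\<integral>\<^sup>+z. (\<integral>\<^sup>+y\<in>{z - 2 * h..z}. epow p (f y) * ennreal (\<omega> y) \<partial>lborel) \<partial>lborel)"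
    by (intro nn_integral_cmult) measurable
  also have "(\<integral>\<^sup>+z. (\<integral>\<^sup>+y\<in>{z - 2 * h..z}. epow p (f y) * ennreal (\<omega> y) \<partial>lborel) \<partial>lborel) =
      (\<integral>\<^sup>+y. (\<integral>\<^sup>+z. epow p (f y) * ennreal (\<omega> y) * indicator {z - 2 * h..z} y \<partial>lborel) \<partial>lborel)"
    by (subst lborel_pair.Fubini') auto
  also have "\<dots> = (\<integral>\<^sup>+y. (\<integral>\<^sup>+z. epow p (f y) * ennreal (\<omega> y) * indicator {y..y + 2 * h} z \<partial>lborel) \<partial>lborel)"
    by (intro nn_integral_cong) (auto simp: indicator_def)
  also have "\<dots> = (\<integral>\<^sup>+y. ennreal (2 * h) * (epow p (f y) * ennreal (\<omega> y)) \<partial>lborel)"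
    using h by (intro nn_integral_cong, subst nn_integral_cmult_indicator) (auto simp: mult.commute)
  also have "\<dots> = ennreal (2 * h) * wint f"
    unfolding wint_def by (intro nn_integral_cmult) measurable
  also have "ennreal (K * (2 * h) powr p) * (ennreal (2 * h) * wint f) = ennreal h * (ennreal (2 * K * (2 * h) powr p) * wint f)"
    using h K by (simp add: ennreal_mult_collapse) (simp add: algebra_simps)
  finally have *: "ennreal h * wint (\<lambda>x. \<integral>\<^sup>+y\<in>{x - 2 * h..x - h}. f y \<partial>lborel) \<le>
      ennreal h * (ennreal (2 * K * (2 * h) powr p) * wint f)" .
  have "ennreal (1/h) * (ennreal h * wint (\<lambda>x. \<integral>\<^sup>+y\<in>{x - 2 * h..x - h}. f y \<partial>lborel)) \<le>
      ennreal (1/h) * (ennreal h * (ennreal (2 * K * (2 * h) powr p) * wint f))"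
    by (intro mult_left_mono *) auto
  then show ?thesis using h ennreal_mult_collapse[of "1/h" h] by simp
qed

text \<open>The bound for convolution with a decreasing kernel of mass \<open>1\<close>, for \<open>p\<close>-th powers of norms.\<close>
definition convC :: real where "convC = 2 * K * 4 powr p"

lemma convC_pos: "0 < convC" using K by (simp add: convC_def)

text \<open>The workhorse for all norm estimates. Jensen's inequality for the measure \<open>k t dt\<close> moves the power inside the
superposition of detached averages, and each of these is bounded independently of its scale.\<close>
theorem wint_antitone_convolution:
  fixes k f :: "real \<Rightarrow> ennreal"
  assumes k[measurable]: "k \<in> borel_measurable borel" and f[measurable]: "f \<in> borel_measurable borel"
    and anti: "\<And>r s. 0 < r \<Longrightarrow> r \<le> s \<Longrightarrow> k s \<le> k r"
    and m: "(\<integral>\<^sup>+s\<in>{0<..}. k s \<partial>lborel) \<le> ennreal m" "0 < m"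
  shows "wint (\<lambda>x. \<integral>\<^sup>+s\<in>{0<..}. k s * f (x - s) \<partial>lborel) \<le> ennreal (convC * m powr p) * wint f"
proof -
  let ?A = "\<lambda>x t. ennreal (1 / t) * (\<integral>\<^sup>+y\<in>{x - 2 * t..x - t}. f y \<partial>lborel)"
  let ?M = "density lborel (\<lambda>t. k t * indicator {0<..} t)"
  have A: "wint (\<lambda>x. ?A x t) \<le> ennreal (2 * K * 2 powr p) * wint f" if t: "0 < t" for t
  proof -
    have "wint (\<lambda>x. ?A x t) = ennreal ((1/t) powr p) * wint (\<lambda>x. \<integral>\<^sup>+y\<in>{x - 2 * t..x - t}. f y \<partial>lborel)"
      using t by (subst wint_cmult) (auto simp: epow_ennreal)
    also have "\<dots> \<le> ennreal ((1/t) powr p) * (ennreal (2 * K * (2 * t) powr p) * wint f)"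
      using t by (intro mult_left_mono wint_detached_average) auto
    also have "\<dots> = ennreal (2 * K * 2 powr p) * wint f"
      using t K by (simp add: ennreal_mult_collapse powr_mult powr_divide mult.assoc)
    finally show ?thesis .
  qed
  have 1: "epow p (\<integral>\<^sup>+s\<in>{0<..}. k s * f (x - s) \<partial>lborel) \<le>
     ennreal (2 powr p * m powr (p - 1)) * (\<integral>\<^sup>+t\<in>{0<..}. k t * epow p (?A x t) \<partial>lborel)" for x
  proof -
    have "epow p (\<integral>\<^sup>+s\<in>{0<..}. k s * f (x - s) \<partial>lborel) \<le> epow p (2 * (\<integral>\<^sup>+t\<in>{0<..}. k t * ?A x t \<partial>lborel))"
      using p by (intro epow_mono antitone_kernel_le_averages k f anti) auto
    also have "(\<integral>\<^sup>+t\<in>{0<..}. k t * ?A x t \<partial>lborel) = (\<integral>\<^sup>+t. ?A x t \<partial>?M)"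
      by (subst nn_integral_density, measurable) (auto intro!: nn_integral_cong simp: mult_ac)
    also have "epow p (2 * (\<integral>\<^sup>+t. ?A x t \<partial>?M)) = ennreal (2 powr p) * epow p (\<integral>\<^sup>+t. ?A x t \<partial>?M)"
      using epow_ennreal[of 2 p] by (simp add: epow_mult)
    also have "\<dots> \<le> ennreal (2 powr p) * (ennreal (m powr (p - 1)) * (\<integral>\<^sup>+t. epow p (?A x t) \<partial>?M))"
    proof (intro mult_left_mono jensen_epow p m)
      show "emeasure ?M (space ?M) \<le> ennreal m"
        using m by (subst emeasure_density) auto
      show "?A x \<in> borel_measurable ?M" by measurable
    qed auto
    also have "(\<integral>\<^sup>+t. epow p (?A x t) \<partial>?M) = (\<integral>\<^sup>+t\<in>{0<..}. k t * epow p (?A x t) \<partial>lborel)"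
      by (subst nn_integral_density, measurable) (auto intro!: nn_integral_cong simp: mult_ac)
    finally show ?thesis using m by (simp add: ennreal_mult_collapse)
  qed
  have "wint (\<lambda>x. \<integral>\<^sup>+s\<in>{0<..}. k s * f (x - s) \<partial>lborel) \<le>
     (\<integral>\<^sup>+x. ennreal (2 powr p * m powr (p - 1)) * (\<integral>\<^sup>+t\<in>{0<..}. k t * epow p (?A x t) \<partial>lborel) * ennreal (\<omega> x) \<partial>lborel)"
    unfolding wint_def by (intro nn_integral_mono mult_right_mono 1) auto
  also have "\<dots> = ennreal (2 powr p * m powr (p - 1)) *
      (\<integral>\<^sup>+x. (\<integral>\<^sup>+t\<in>{0<..}. k t * epow p (?A x t) \<partial>lborel) * ennreal (\<omega> x) \<partial>lborel)"
    unfolding mult.assoc by (intro nn_integral_cmult) measurable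
  also have "(\<integral>\<^sup>+x. (\<integral>\<^sup>+t\<in>{0<..}. k t * epow p (?A x t) \<partial>lborel) * ennreal (\<omega> x) \<partial>lborel) =
      (\<integral>\<^sup>+x. (\<integral>\<^sup>+t. k t * indicator {0<..} t * (epow p (?A x t) * ennreal (\<omega> x)) \<partial>lborel) \<partial>lborel)"
    by (intro nn_integral_cong, subst nn_integral_multc[symmetric], measurable)
       (auto intro!: nn_integral_cong simp: mult_ac)
  also have "\<dots> = (\<integral>\<^sup>+t. (\<integral>\<^sup>+x. k t * indicator {0<..} t * (epow p (?A x t) * ennreal (\<omega> x)) \<partial>lborel) \<partial>lborel)"
    by (subst lborel_pair.Fubini') auto
  also have "\<dots> = (\<integral>\<^sup>+t. k t * indicator {0<..} t * wint (\<lambda>x. ?A x t) \<partial>lborel)"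
    unfolding wint_def by (intro nn_integral_cong nn_integral_cmult) measurable
  also have "\<dots> \<le> (\<integral>\<^sup>+t. k t * indicator {0<..} t * (ennreal (2 * K * 2 powr p) * wint f) \<partial>lborel)"
  proof (rule nn_integral_mono)
    fix t show "k t * indicator {0<..} t * wint (\<lambda>x. ?A x t) \<le>
        k t * indicator {0<..} t * (ennreal (2 * K * 2 powr p) * wint f)"
      using A[of t] by (cases "0 < t") (auto intro: mult_left_mono)
  qed
  also have "\<dots> = (\<integral>\<^sup>+t\<in>{0<..}. k t \<partial>lborel) * (ennreal (2 * K * 2 powr p) * wint f)"
    by (intro nn_integral_multc) measurable
  also have "\<dots> \<le> ennreal m * (ennreal (2 * K * 2 powr p) * wint f)"
    by (intro mult_right_mono m) auto
  also have "ennreal (2 powr p * m powr (p - 1)) * (ennreal m * (ennreal (2 * K * 2 powr p) * wint f)) =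
     ennreal (convC * m powr p) * wint f"
  proof -
    have "(2 powr p * m powr (p - 1)) * (m * (2 * K * 2 powr p)) = convC * m powr p"
      using m by (simp add: convC_def powr_diff powr_mult[of 2 2, simplified])
    then show ?thesis using K m by (simp add: ennreal_mult_collapse)
  qed
  finally show ?thesis by (simp add: mult_left_mono)
qed

end

section \<open>One-sided Muckenhoupt weights\<close>

lemma locally_integrable_borel:
  assumes "locally_integrable f" shows "f \<in> borel_measurable borel"
proof (rule borel_measurable_LIMSEQ_real)
  show "(\<lambda>x. indicator {- real n..real n} x *\<^sub>R f x) \<in> borel_measurable borel" for n
    using assms unfolding locally_integrable_def set_integrable_def
    by (metis borel_measurable_integrable measurable_lborel2)
  show "(\<lambda>n. indicator {- real n..real n} x *\<^sub>R f x) \<longlonglongrightarrow> f x" for x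
  proof (rule tendsto_eventually)
    show "\<forall>\<^sub>F n in sequentially. indicator {- real n..real n} x *\<^sub>R f x = f x"
      using eventually_ge_at_top[of "nat \<lceil>\<bar>x\<bar>\<rceil>"]
      by eventually_elim (auto simp: indicator_def)
  qed
qed

lemma set_nn_integral_eq_LBINT:
  fixes f :: "real \<Rightarrow> real"
  assumes "set_integrable lborel A f" "\<And>x. x \<in> A \<Longrightarrow> 0 \<le> f x"
  shows "(\<integral>\<^sup>+x\<in>A. ennreal (f x) \<partial>lborel) = ennreal (LBINT x:A. f x)"
proof -
  have "(\<integral>\<^sup>+x\<in>A. ennreal (f x) \<partial>lborel) = (\<integral>\<^sup>+x. ennreal (indicator A x *\<^sub>R f x) \<partial>lborel)"
    by (intro nn_integral_cong) (auto simp: indicator_def)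
  also have "\<dots> = ennreal (\<integral>x. indicator A x *\<^sub>R f x \<partial>lborel)"
    using assms unfolding set_integrable_def
    by (intro nn_integral_eq_integral) (auto simp: indicator_def)
  finally show ?thesis by (simp add: set_lebesgue_integral_def)
qed

text \<open>For almost every \<open>y \<in> [x - h, x]\<close>, the interval \<open>[y, y + 2 h]\<close> contains \<open>[x, x + h]\<close>, so the maximal
function at \<open>y\<close> bounds the mass of the weight there by \<open>2 h C \<omega>(y)\<close>.\<close>
lemma one_sided_bound_A1:
  assumes [measurable]: "\<omega> \<in> borel_measurable borel" and nonneg: "\<And>x. 0 \<le> \<omega> x" and C: "0 < C"
    and A1: "AE x in lborel. maximal_right \<omega> x \<le> ennreal (C * \<omega> x)"
  shows "one_sided_bound 1 (2 * C) \<omega>"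
  unfolding one_sided_bound_def epow_one
proof (intro ballI allI impI)
  fix f :: "real \<Rightarrow> ennreal" and x h :: real
  assume [measurable]: "f \<in> borel_measurable borel" and h: "0 < h"
  let ?c = "\<integral>\<^sup>+y\<in>{x..x + h}. ennreal (\<omega> y) \<partial>lborel"
  have *: "AE y in lborel. f y * indicator {x - h..x} y * ?c \<le>
    ennreal (2 * C * h powr 1) * (f y * ennreal (\<omega> y) * indicator {x - h..x} y)"
    using A1
  proof eventually_elim
    case (elim y)
    show ?case
    proof (cases "y \<in> {x - h..x}")
      case True
      have "ennreal (1 / (2 * h)) * (\<integral>\<^sup>+z\<in>{y..y + 2 * h}. ennreal \<bar>\<omega> z\<bar> \<partial>lborel) \<le> maximal_right \<omega> y"
        unfolding maximal_right_def using h by (intro SUP_upper2[of "2 * h"]) auto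
      also have "\<dots> \<le> ennreal (C * \<omega> y)" by (fact elim)
      finally have "ennreal (2 * h) * (ennreal (1 / (2 * h)) * (\<integral>\<^sup>+z\<in>{y..y + 2 * h}. ennreal \<bar>\<omega> z\<bar> \<partial>lborel))
          \<le> ennreal (2 * h) * ennreal (C * \<omega> y)"
        by (rule mult_left_mono) auto
      then have "(\<integral>\<^sup>+z\<in>{y..y + 2 * h}. ennreal \<bar>\<omega> z\<bar> \<partial>lborel) \<le> ennreal (2 * h) * ennreal (C * \<omega> y)"
        using h by (simp add: ennreal_mult_collapse)
      moreover have "?c \<le> (\<integral>\<^sup>+z\<in>{y..y + 2 * h}. ennreal \<bar>\<omega> z\<bar> \<partial>lborel)"
        using True nonneg h by (intro nn_integral_mono) (auto simp: indicator_def)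
      ultimately have "?c \<le> ennreal (2 * h) * ennreal (C * \<omega> y)" by (rule order_trans[rotated])
      also have "\<dots> = ennreal (2 * C * h powr 1) * ennreal (\<omega> y)"
        using h C nonneg by (simp add: mult_ac flip: ennreal_mult)
      finally have "f y * ?c \<le> f y * (ennreal (2 * C * h powr 1) * ennreal (\<omega> y))"
        by (rule mult_left_mono) auto
      then show ?thesis using True by (simp add: mult_ac)
    qed simp
  qed
  have "(\<integral>\<^sup>+y\<in>{x - h..x}. f y \<partial>lborel) * ?c = (\<integral>\<^sup>+y. f y * indicator {x - h..x} y * ?c \<partial>lborel)"
    by (rule nn_integral_multc[symmetric]) measurable
  also have "\<dots> \<le> (\<integral>\<^sup>+y. ennreal (2 * C * h powr 1) * (f y * ennreal (\<omega> y) * indicator {x - h..x} y) \<partial>lborel)"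
    by (intro nn_integral_mono_AE *)
  also have "\<dots> = ennreal (2 * C * h powr 1) * (\<integral>\<^sup>+y\<in>{x - h..x}. f y * ennreal (\<omega> y) \<partial>lborel)"
    by (intro nn_integral_cmult) measurable
  finally show "(\<integral>\<^sup>+y\<in>{x - h..x}. f y \<partial>lborel) * ?c \<le>
     ennreal (2 * C * h powr 1) * (\<integral>\<^sup>+y\<in>{x - h..x}. f y * ennreal (\<omega> y) \<partial>lborel)" .
qed

text \<open>Jensen's inequality for the function \<open>f / \<sigma>\<close> and the measure \<open>\<sigma> dy\<close>, with \<open>\<sigma>\<close> the dual weight
\<open>\<omega>\<^sup>1\<^sup>-\<^sup>q\<close>; it is Hoelder's inequality, because \<open>\<sigma>\<^sup>1\<^sup>-\<^sup>p = \<omega>\<close>. The power of the mass of \<open>\<sigma>\<close> that appears is the one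
in the Muckenhoupt condition.\<close>
lemma one_sided_bound_Ap:
  assumes p: "1 < p" and [measurable]: "\<omega> \<in> borel_measurable borel" and nonneg: "\<And>x. 0 \<le> \<omega> x"
    and pos: "AE x in lborel. 0 < \<omega> x" and loc: "\<And>a b. set_integrable lborel {a..b} \<omega>" and C: "0 < C"
    and sint: "\<And>x h. 0 < h \<Longrightarrow> set_integrable lborel {x - h..x} (\<lambda>y. \<omega> y powr (1 - conj_exponent p))"
    and Ap: "\<And>x h. 0 < h \<Longrightarrow> (1 / h * (LBINT y:{x..x + h}. \<omega> y)) powr (1 / p) *
           (1 / h * (LBINT y:{x - h..x}. \<omega> y powr (1 - conj_exponent p)))
             powr (1 / conj_exponent p) \<le> C"
  shows "one_sided_bound p (C powr p) \<omega>"
  unfolding one_sided_bound_def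
proof (intro ballI allI impI)
  fix f :: "real \<Rightarrow> ennreal" and x h :: real
  assume f[measurable]: "f \<in> borel_measurable borel" and h: "0 < h"
  define q where "q = conj_exponent p"
  define \<sigma> where "\<sigma> y = \<omega> y powr (1 - q)" for y
  have [measurable]: "\<sigma> \<in> borel_measurable borel" unfolding \<sigma>_def by measurable
  have pq: "(1 - q) * (1 - p) = 1" "p / q = p - 1"
    using p by (simp_all add: q_def conj_exponent_def field_simps)
  have q0: "0 < q" using p by (simp add: q_def conj_exponent_def)
  let ?I = "{x - h..x}" and ?J = "{x..x + h}"
  define S where "S = (LBINT y:?I. \<sigma> y)"
  define W where "W = (LBINT y:?J. \<omega> y)"
  have S: "(\<integral>\<^sup>+y\<in>?I. ennreal (\<sigma> y) \<partial>lborel) = ennreal S"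
    unfolding S_def using sint[OF h] by (intro set_nn_integral_eq_LBINT) (auto simp: \<sigma>_def q_def)
  have W: "(\<integral>\<^sup>+y\<in>?J. ennreal (\<omega> y) \<partial>lborel) = ennreal W"
    unfolding W_def using loc nonneg by (intro set_nn_integral_eq_LBINT) auto
  have W0: "0 \<le> W" unfolding W_def using nonneg by (auto simp: set_lebesgue_integral_def intro!: Bochner_Integration.integral_nonneg)
  have S0: "0 \<le> S" unfolding S_def by (auto simp: set_lebesgue_integral_def \<sigma>_def intro!: Bochner_Integration.integral_nonneg)
  have "S \<noteq> 0"
  proof
    assume "S = 0"
    with S have "AE y in lborel. ennreal (\<sigma> y) * indicator ?I y = 0"
      by (subst nn_integral_0_iff_AE[symmetric]) auto
    with pos have "AE y in lborel. y \<notin> ?I"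
      by eventually_elim (auto simp: \<sigma>_def indicator_def split: if_splits)
    then have "emeasure lborel ?I = 0"
      by (subst (asm) AE_iff_measurable[of ?I]) auto
    then show False using h by simp
  qed
  with S0 have S1: "0 < S" by simp
  let ?M = "density lborel (\<lambda>y. ennreal (\<sigma> y) * indicator ?I y)"
  let ?G = "\<lambda>y. f y * ennreal (1 / \<sigma> y)"
  have "AE y in lborel. ennreal (\<sigma> y) * indicator ?I y * ?G y = f y * indicator ?I y"
    using pos
  proof eventually_elim
    case (elim y)
    then have "0 < \<sigma> y" by (simp add: \<sigma>_def)
    then have "ennreal (\<sigma> y) * ennreal (1 / \<sigma> y) = 1" by (simp flip: ennreal_mult)
    then show ?case by (simp add: indicator_def mult_ac)
  qed
  then have 1: "(\<integral>\<^sup>+y\<in>?I. f y \<partial>lborel) = (\<integral>\<^sup>+y. ?G y \<partial>?M)"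
    by (subst nn_integral_density, measurable) (auto intro!: nn_integral_cong_AE elim!: eventually_mono)
  have "AE y in lborel. ennreal (\<sigma> y) * indicator ?I y * epow p (?G y) = epow p (f y) * ennreal (\<omega> y) * indicator ?I y"
    using pos
  proof eventually_elim
    case (elim y)
    then have s: "0 < \<sigma> y" by (simp add: \<sigma>_def)
    have "\<sigma> y * (1 / \<sigma> y) powr p = \<sigma> y powr (1 - p)" using s by (simp add: powr_diff powr_divide)
    also have "\<dots> = \<omega> y" using elim by (simp add: \<sigma>_def powr_powr pq)
    finally have "ennreal (\<sigma> y) * ennreal ((1 / \<sigma> y) powr p) = ennreal (\<omega> y)"
      using s by (simp flip: ennreal_mult)
    then have "ennreal (\<sigma> y) * epow p (?G y) = epow p (f y) * ennreal (\<omega> y)"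
      using s by (simp add: epow_mult epow_ennreal mult.left_commute[of "ennreal (\<sigma> y)"])
    then show ?case by (simp add: indicator_def)
  qed
  then have 2: "(\<integral>\<^sup>+y. epow p (?G y) \<partial>?M) = (\<integral>\<^sup>+y\<in>?I. epow p (f y) * ennreal (\<omega> y) \<partial>lborel)"
    by (subst nn_integral_density, measurable) (auto intro!: nn_integral_cong_AE)
  have 3: "epow p (\<integral>\<^sup>+y\<in>?I. f y \<partial>lborel) \<le>
      ennreal (S powr (p - 1)) * (\<integral>\<^sup>+y\<in>?I. epow p (f y) * ennreal (\<omega> y) \<partial>lborel)"
    unfolding 1 2[symmetric]
    using p S1 S by (intro jensen_epow) (auto simp: emeasure_density)
  have "((1 / h * W) powr (1 / p) * (1 / h * S) powr (1 / q)) powr p \<le> C powr p"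
    using Ap[OF h, of x] p unfolding W_def S_def \<sigma>_def q_def by (intro powr_mono2) auto
  then have "(W / h) * (S / h) powr (p - 1) \<le> C powr p"
    using W0 S1 h p q0 by (simp add: powr_mult powr_powr pq(2))
  then have "S powr (p - 1) * W \<le> C powr p * h powr p"
    using h S1 by (simp add: powr_divide powr_diff field_simps)
  then have 4: "ennreal (S powr (p - 1)) * ennreal W \<le> ennreal (C powr p * h powr p)"
    using W0 by (simp flip: ennreal_mult)
  have "epow p (\<integral>\<^sup>+y\<in>?I. f y \<partial>lborel) * ennreal W \<le>
     ennreal (S powr (p - 1)) * (\<integral>\<^sup>+y\<in>?I. epow p (f y) * ennreal (\<omega> y) \<partial>lborel) * ennreal W"
    by (intro mult_right_mono 3) auto
  also have "\<dots> = (ennreal (S powr (p - 1)) * ennreal W) * (\<integral>\<^sup>+y\<in>?I. epow p (f y) * ennreal (\<omega> y) \<partial>lborel)"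
    by (simp add: mult_ac)
  also have "\<dots> \<le> ennreal (C powr p * h powr p) * (\<integral>\<^sup>+y\<in>?I. epow p (f y) * ennreal (\<omega> y) \<partial>lborel)"
    by (intro mult_right_mono 4) auto
  finally show "epow p (\<integral>\<^sup>+y\<in>?I. f y \<partial>lborel) * (\<integral>\<^sup>+y\<in>?J. ennreal (\<omega> y) \<partial>lborel)
      \<le> ennreal (C powr p * h powr p) * (\<integral>\<^sup>+y\<in>?I. epow p (f y) * ennreal (\<omega> y) \<partial>lborel)"
    unfolding W .
qed

theorem Ap_minus_one_sided_weight:
  assumes p: "1 \<le> p" and w: "\<omega> \<in> Ap_minus p"
  shows "\<exists>K. one_sided_weight p K \<omega>"
proof -
  have wt: "weight \<omega>" using w by (simp add: Ap_minus_def)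
  then have nonneg: "\<And>x. 0 \<le> \<omega> x" and pos: "AE x in lborel. 0 < \<omega> x" and li: "locally_integrable \<omega>"
    by (auto simp: weight_def)
  have [measurable]: "\<omega> \<in> borel_measurable borel" by (rule locally_integrable_borel[OF li])
  have loc: "set_integrable lborel {a..b} \<omega>" for a b using li by (auto simp: locally_integrable_def)
  have loc': "(\<integral>\<^sup>+y\<in>{a..b}. ennreal (\<omega> y) \<partial>lborel) < top" for a b
    using loc nonneg by (subst set_nn_integral_eq_LBINT) auto
  have "\<exists>K>0. one_sided_bound p K \<omega>"
  proof (cases "p = 1")
    case True
    then obtain C where "0 < C" "AE x in lborel. maximal_right \<omega> x \<le> ennreal (C * \<omega> x)"
      using w by (auto simp: Ap_minus_def)
    then show ?thesis using True one_sided_bound_A1[of \<omega> C] nonneg by (intro exI[of _ "2 * C"]) auto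
  next
    case False
    then obtain C where "0 < C" and C: "\<And>x h. 0 < h \<Longrightarrow>
           set_integrable lborel {x - h..x} (\<lambda>y. \<omega> y powr (1 - conj_exponent p)) \<and>
           (1 / h * (LBINT y:{x..x + h}. \<omega> y)) powr (1 / p) *
           (1 / h * (LBINT y:{x - h..x}. \<omega> y powr (1 - conj_exponent p)))
             powr (1 / conj_exponent p) \<le> C"
      using w by (auto simp: Ap_minus_def)
    with one_sided_bound_Ap[of p \<omega> C] False p nonneg pos loc show ?thesis
      by (intro exI[of _ "C powr p"]) auto
  qed
  then obtain K where "0 < K" "one_sided_bound p K \<omega>" by auto
  then show ?thesis using p nonneg pos loc' by (intro exI[of _ K]) (unfold_locales, auto)
qed

section \<open>Lebesgue differentiation from the left\<close>

lemma AE_lborel_reflect: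
  assumes "AE y in lborel. P (y::real)" shows "AE s in lborel. P (x - s)"
proof -
  obtain N where N: "\<And>y. y \<in> space lborel - N \<Longrightarrow> P y" "N \<in> null_sets lborel"
    using AE_E3[OF assms] by blast
  have "AE y in lborel. y \<notin> N" using N(2) by (rule AE_not_in)
  then have "AE s in lborel. x + (-1) * s \<notin> N"
    using N by (intro AE_borel_affine) (auto simp: null_sets_def)
  then show ?thesis by eventually_elim (use N in auto)
qed

lemma LBINT_reflect:
  fixes f :: "real \<Rightarrow> real"
  shows "(LBINT y:{a..b}. f (- y)) = (LBINT y:{-b..-a}. f y)"
  unfolding set_lebesgue_integral_def
  by (subst lborel_integral_real_affine[where c = "-1" and t = 0])
     (auto intro!: Bochner_Integration.integral_cong simp: indicator_def)

lemma locally_integrable_uminus: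
  assumes "locally_integrable f" shows "locally_integrable (\<lambda>y. f (- y))"
  unfolding locally_integrable_def
proof (intro allI)
  fix a b :: real
  have "integrable lborel (\<lambda>y. indicator {-b..-a} y *\<^sub>R f y)"
    using assms by (auto simp: locally_integrable_def set_integrable_def)
  from lborel_integrable_real_affine[OF this, of "-1" 0]
  show "set_integrable lborel {a..b} (\<lambda>y. f (- y))"
    unfolding set_integrable_def
    by (rule Bochner_Integration.integrable_cong[THEN iffD1, rotated 2]) (auto simp: indicator_def)
qed

text \<open>Lebesgue's theorem for averages over the cubes with lower corner at the point gives, in dimension one, averages to the
right; reflection turns them into averages to the left.\<close>
theorem lebesgue_differentiation_left:
  assumes f: "locally_integrable f"
  shows "AE x in lborel. ((\<lambda>s. (LBINT y:{x - s..x}. f y) / s) \<longlongrightarrow> f x) (at_right 0)"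
proof -
  define g where "g y = f (- y)" for y
  have g: "set_integrable lborel {a..b} g" for a b
    using locally_integrable_uminus[OF f] by (simp add: locally_integrable_def g_def[abs_def])
  have "g integrable_on cbox a b" for a b
    using set_borel_integral_eq_integral(1)[OF g] by simp
  then obtain N where N: "negligible N" and lim: "\<And>x e. \<lbrakk>x \<notin> N; 0 < e\<rbrakk> \<Longrightarrow>
       \<exists>d>0. \<forall>h. 0 < h \<and> h < d \<longrightarrow> norm (integral (cbox x (x + h *\<^sub>R One)) g /\<^sub>R h ^ DIM(real) - g x) < e"
    using integrable_ccontinuous_explicit[of g] by blast
  have "AE x in lebesgue. x \<notin> N"
    using N by (intro AE_not_in) (simp add: negligible_iff_null_sets)
  then have "AE x in lborel. x \<notin> N" by (simp add: AE_completion_iff)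
  from AE_lborel_reflect[OF this, of 0] have "AE x in lborel. - x \<notin> N" by simp
  then show ?thesis
  proof eventually_elim
    case (elim x)
    show ?case
    proof (rule tendstoI)
      fix e :: real assume "0 < e"
      from lim[OF elim this] obtain d where d: "0 < d"
        and dd: "\<And>h. 0 < h \<Longrightarrow> h < d \<Longrightarrow> norm (integral {-x..-x + h} g /\<^sub>R h - g (-x)) < e"
        by auto
      have "\<forall>\<^sub>F s in at_right 0. s < d \<and> 0 < (s::real)"
        using d by (intro eventually_conj eventually_at_right_less) (auto simp: eventually_at_right_field)
      then show "\<forall>\<^sub>F s in at_right 0. dist ((LBINT y:{x - s..x}. f y) / s) (f x) < e"
      proof eventually_elim
        case (elim s)
        have "integral {-x..-x + s} g = (LBINT y:{-x..-x + s}. g y)"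
          using set_borel_integral_eq_integral(2)[OF g] by simp
        also have "\<dots> = (LBINT y:{x - s..x}. f y)"
          unfolding g_def LBINT_reflect by simp
        finally show ?case using dd[of s] elim by (simp add: dist_real_def g_def divide_inverse_commute)
      qed
    qed
  qed
qed

section \<open>Smooth bump functions\<close>

text \<open>Differentiability up to a finite order allows induction on the order, which derives closure of smooth functions
under products from the product rule alone.\<close>
definition diff_upto :: "nat \<Rightarrow> (real \<Rightarrow> real) \<Rightarrow> bool" where
  "diff_upto n f \<longleftrightarrow> (\<forall>m\<le>n. \<forall>x. (deriv ^^ m) f differentiable (at x))"

lemma smooth_iff_diff_upto: "smooth f \<longleftrightarrow> (\<forall>n. diff_upto n f)"
  unfolding smooth_def diff_upto_def by auto

lemma diff_upto_0: "diff_upto 0 f \<longleftrightarrow> (\<forall>x. f differentiable (at x))"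
  by (simp add: diff_upto_def)

lemma diff_upto_Suc: "diff_upto (Suc n) f \<longleftrightarrow> (\<forall>x. f differentiable (at x)) \<and> diff_upto n (deriv f)"
proof -
  have "(\<forall>m\<le>Suc n. P m) \<longleftrightarrow> P 0 \<and> (\<forall>m\<le>n. P (Suc m))" for P
    by (metis Suc_le_mono le0 not0_implies_Suc)
  then show ?thesis unfolding diff_upto_def
    by (simp add: funpow_Suc_right del: funpow.simps)
qed

lemma diff_upto_mono: "diff_upto n f \<Longrightarrow> m \<le> n \<Longrightarrow> diff_upto m f"
  by (auto simp: diff_upto_def)

lemma diff_upto_DERIV:
  assumes "diff_upto n f" shows "(f has_real_derivative deriv f x) (at x)"
proof -
  from assms have "(deriv ^^ 0) f differentiable (at x)" unfolding diff_upto_def by blast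
  then show ?thesis by (simp add: DERIV_deriv_iff_real_differentiable)
qed

lemma diff_uptoI:
  assumes "\<And>x. (f has_real_derivative f' x) (at x)" "diff_upto n f'"
  shows "diff_upto (Suc n) f"
proof -
  have "deriv f = f'" using assms(1) by (intro ext DERIV_imp_deriv)
  then show ?thesis using assms by (auto simp: diff_upto_Suc real_differentiable_def)
qed

lemma diff_upto_const: "diff_upto n (\<lambda>x. c)"
proof (induction n arbitrary: c)
  case (Suc n)
  show ?case by (rule diff_uptoI[where f' = "\<lambda>x. 0"]) (auto intro: Suc)
qed (simp add: diff_upto_0)

lemma diff_upto_add: "diff_upto n f \<Longrightarrow> diff_upto n g \<Longrightarrow> diff_upto n (\<lambda>x. f x + g x)"
proof (induction n arbitrary: f g)
  case (Suc n)
  have "diff_upto n (\<lambda>x. deriv f x + deriv g x)"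
    using Suc by (simp add: diff_upto_Suc)
  then show ?case
    by (intro diff_uptoI[where f' = "\<lambda>x. deriv f x + deriv g x"] derivative_intros
         diff_upto_DERIV[OF Suc.prems(1)] diff_upto_DERIV[OF Suc.prems(2)])
qed (simp add: diff_upto_0)

lemma diff_upto_mult: "diff_upto n f \<Longrightarrow> diff_upto n g \<Longrightarrow> diff_upto n (\<lambda>x. f x * g x)"
proof (induction n arbitrary: f g)
  case (Suc n)
  have "diff_upto n (\<lambda>x. deriv f x * g x + deriv g x * f x)"
    using Suc.prems diff_upto_mono[OF Suc.prems(1), of n] diff_upto_mono[OF Suc.prems(2), of n]
    by (intro diff_upto_add Suc.IH) (auto simp: diff_upto_Suc)
  then show ?case
    by (rule diff_uptoI[rotated])
       (intro DERIV_mult diff_upto_DERIV[OF Suc.prems(1)] diff_upto_DERIV[OF Suc.prems(2)])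
qed (simp add: diff_upto_0)

lemma diff_upto_affine: "diff_upto n f \<Longrightarrow> diff_upto n (\<lambda>x. f (c * x + d))"
proof (induction n arbitrary: f)
  case 0
  have "((\<lambda>x. f (c * x + d)) has_real_derivative deriv f (c * x + d) * c) (at x)" for x
    by (rule DERIV_chain2[OF diff_upto_DERIV[OF 0]]) (auto intro!: derivative_eq_intros)
  then show ?case by (auto simp: diff_upto_0 real_differentiable_def)
next
  case (Suc n)
  have "diff_upto n (\<lambda>x. deriv f (c * x + d) * c)"
    using Suc by (intro diff_upto_mult diff_upto_const Suc.IH) (simp add: diff_upto_Suc)
  moreover have "((\<lambda>x. f (c * x + d)) has_real_derivative deriv f (c * x + d) * c) (at x)" for x
    by (rule DERIV_chain2[OF diff_upto_DERIV[OF Suc.prems]]) (auto intro!: derivative_eq_intros)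
  ultimately show ?case by (intro diff_uptoI)
qed

lemma smooth_DERIV: "smooth f \<Longrightarrow> (f has_real_derivative deriv f x) (at x)"
  using diff_upto_DERIV[of 0 f x] by (simp add: smooth_iff_diff_upto)

lemma smooth_deriv: "smooth f \<Longrightarrow> smooth (deriv f)"
  using diff_upto_Suc smooth_iff_diff_upto by blast

lemma smooth_const: "smooth (\<lambda>x. c)"
  and smooth_add: "smooth f \<Longrightarrow> smooth g \<Longrightarrow> smooth (\<lambda>x. f x + g x)"
  and smooth_mult: "smooth f \<Longrightarrow> smooth g \<Longrightarrow> smooth (\<lambda>x. f x * g x)"
  and smooth_affine: "smooth f \<Longrightarrow> smooth (\<lambda>x. f (c * x + d))"
  by (simp_all add: smooth_iff_diff_upto diff_upto_const diff_upto_add diff_upto_mult diff_upto_affine)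

lemma smoothI_DERIV:
  assumes "\<And>x. (f has_real_derivative f' x) (at x)" "smooth f'" shows "smooth f"
proof -
  have "diff_upto (Suc n) f" for n
    by (rule diff_uptoI[OF assms(1)]) (use assms(2) in \<open>simp add: smooth_iff_diff_upto\<close>)
  then show ?thesis using diff_upto_mono by (auto simp: smooth_iff_diff_upto) (meson le_SucI order_refl)
qed

lemma smooth_continuous: "smooth f \<Longrightarrow> continuous_on A f"
  by (meson DERIV_isCont continuous_at_imp_continuous_on smooth_DERIV)

lemma smooth_borel: "smooth f \<Longrightarrow> f \<in> borel_measurable borel"
  by (intro borel_measurable_continuous_onI smooth_continuous)

text \<open>The functions \<open>P(1 / x) exp(- 1 / x)\<close>, extended by zero. They form a class that is closed under differentiation,
so all of them are smooth.\<close>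
definition flat :: "real poly \<Rightarrow> real \<Rightarrow> real" where
  "flat P x = (if 0 < x then poly P (1 / x) * exp (- (1 / x)) else 0)"

lemma flat_poly_tendsto_0: "((\<lambda>x. poly P (1 / x) * exp (- (1 / x))) \<longlongrightarrow> 0) (at_right (0::real))"
proof -
  have mono: "((\<lambda>y. y ^ k * exp (- y)) \<longlongrightarrow> 0) (at_top :: real filter)" for k
    using tendsto_power_div_exp_0[of k] by (simp add: exp_minus divide_inverse)
  have "((\<lambda>y. poly P y * exp (- y)) \<longlongrightarrow> 0) at_top"
  proof -
    have "((\<lambda>y. \<Sum>i\<le>degree P. coeff P i * (y ^ i * exp (- y))) \<longlongrightarrow> (\<Sum>i\<le>degree P. coeff P i * 0)) at_top"
      by (intro tendsto_sum tendsto_mult tendsto_const mono)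
    then show ?thesis by (simp add: poly_altdef sum_distrib_right mult.assoc)
  qed
  from filterlim_compose[OF this filterlim_inverse_at_top_right]
  show ?thesis by (simp add: inverse_eq_divide)
qed

lemma flat_DERIV:
  "(flat P has_real_derivative flat ([:0, 0, 1:] * (P - pderiv P)) x) (at x)"
proof -
  consider "0 < x" | "x < 0" | "x = 0" by linarith
  then show ?thesis
  proof cases
    case 1
    have "((\<lambda>x. poly P (1 / x) * exp (- (1 / x))) has_real_derivative
        flat ([:0, 0, 1:] * (P - pderiv P)) x) (at x)"
      using 1 unfolding flat_def
      by (auto intro!: derivative_eq_intros DERIV_chain2[OF poly_DERIV] simp: field_simps power2_eq_square)
    moreover have "\<forall>\<^sub>F y in nhds x. poly P (1 / y) * exp (- (1 / y)) = flat P y"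
      using eventually_nhds_in_open[of "{0<..}" x] 1 by (auto elim!: eventually_mono simp: flat_def)
    ultimately show ?thesis by (subst DERIV_cong_ev[OF refl _ refl, symmetric])
  next
    case 2
    have "((\<lambda>x. 0) has_real_derivative flat ([:0, 0, 1:] * (P - pderiv P)) x) (at x)"
      using 2 by (simp add: flat_def)
    moreover have "\<forall>\<^sub>F y in nhds x. 0 = flat P y"
      using eventually_nhds_in_open[of "{..<0}" x] 2 by (auto elim!: eventually_mono simp: flat_def)
    ultimately show ?thesis by (subst DERIV_cong_ev[OF refl _ refl, symmetric])
  next
    case 3
    have "((\<lambda>h. (flat P (0 + h) - flat P 0) / h) \<longlongrightarrow> 0) (at 0)"
      unfolding filterlim_at_split
    proof
      show "((\<lambda>h. (flat P (0 + h) - flat P 0) / h) \<longlongrightarrow> 0) (at_left 0)"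
        by (rule tendsto_eventually) (auto simp: flat_def eventually_at_filter)
      have "\<forall>\<^sub>F h in at_right 0. poly ([:0, 1:] * P) (1 / h) * exp (- (1 / h)) = (flat P (0 + h) - flat P 0) / h"
        by (auto simp: flat_def eventually_at_filter)
      then show "((\<lambda>h. (flat P (0 + h) - flat P 0) / h) \<longlongrightarrow> 0) (at_right 0)"
        using flat_poly_tendsto_0[of "[:0, 1:] * P"] by (rule Lim_transform_eventually[rotated])
    qed
    then show ?thesis using 3 by (simp add: DERIV_def flat_def)
  qed
qed

lemma smooth_flat: "smooth (flat P)"
proof -
  have "diff_upto n (flat P)" for n P
  proof (induction n arbitrary: P)
    case 0
    then show ?case using flat_DERIV by (auto simp: diff_upto_0 real_differentiable_def)
  next
    case (Suc n)
    show ?case by (rule diff_uptoI[OF flat_DERIV Suc])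
  qed
  then show ?thesis by (simp add: smooth_iff_diff_upto)
qed

text \<open>Since \<open>exp(- 1 / y)\<close> tends to \<open>1\<close> for large \<open>y\<close>, these functions increase to the indicator of the interval
\<open>(a, b)\<close> as \<open>n\<close> grows.\<close>
definition bump :: "real \<Rightarrow> real \<Rightarrow> nat \<Rightarrow> real \<Rightarrow> real" where
  "bump a b n x = flat 1 (real n * (x - a)) * flat 1 (real n * (b - x))"

lemma bump_outside: "x \<notin> {a<..<b} \<Longrightarrow> bump a b n x = 0"
  by (auto simp: bump_def flat_def not_less mult_nonneg_nonpos zero_less_mult_iff)

lemma flat_1_bounds: "0 \<le> flat 1 x" "flat 1 x \<le> 1"
  by (auto simp: flat_def)

lemma bump_bounds: "0 \<le> bump a b n x" "bump a b n x \<le> 1"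
  using flat_1_bounds by (auto simp: bump_def intro!: mult_nonneg_nonneg mult_le_one)

lemma smooth_bump: "smooth (bump a b n)"
proof -
  have "smooth (\<lambda>x. flat 1 (real n * x + (- real n * a)) * flat 1 ((- real n) * x + real n * b))"
    by (intro smooth_mult smooth_affine smooth_flat)
  moreover have "(\<lambda>x. flat 1 (real n * x + (- real n * a)) * flat 1 ((- real n) * x + real n * b)) = bump a b n"
    by (auto simp: bump_def algebra_simps)
  ultimately show ?thesis by simp
qed

lemma compact_suppI:
  assumes "\<And>x. x \<notin> {a..b} \<Longrightarrow> f x = 0" shows "compact (supp f)"
proof -
  have "supp f \<subseteq> {a..b}"
    unfolding supp_def by (rule closure_minimal) (use assms in \<open>force simp: support_on_def\<close>)+
  then show ?thesis
    using compact_Icc by (metis bounded_closure bounded_subset compact_eq_bounded_closed closed_closure supp_def)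
qed

lemma compact_suppE:
  assumes "compact (supp f)" obtains R where "0 < R" "\<And>x. x \<notin> {-R..R} \<Longrightarrow> f x = 0"
proof -
  obtain B where "\<And>x. x \<in> supp f \<Longrightarrow> norm x \<le> B" "0 < B"
    using assms by (metis bounded_pos compact_imp_bounded)
  moreover have "x \<in> supp f" if "f x \<noteq> 0" for x
    using closure_subset[of "support_on UNIV f"] that by (auto simp: supp_def support_on_def)
  ultimately show ?thesis by (intro that[of B]) fastforce+
qed

lemma bump_test: "bump a b n \<in> test_functions"
  unfolding test_functions_def
  using smooth_bump by (auto intro!: compact_suppI[of a b] bump_outside)

lemma bump_tendsto: "(\<lambda>n. bump a b n x) \<longlonglongrightarrow> indicator {a<..<b} x"
proof (cases "x \<in> {a<..<b}")
  case True
  have *: "(\<lambda>n. flat 1 (real n * c)) \<longlonglongrightarrow> 1" if "0 < c" for c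
  proof -
    have "(\<lambda>n. exp (- (1 / c / real n))) \<longlonglongrightarrow> exp (- 0)"
      by (intro tendsto_intros lim_const_over_n)
    moreover have "\<forall>\<^sub>F n in sequentially. exp (- (1 / c / real n)) = flat 1 (real n * c)"
      using eventually_gt_at_top[of 0] by eventually_elim (use that in \<open>auto simp: flat_def mult.commute\<close>)
    ultimately show ?thesis by (auto intro: Lim_transform_eventually)
  qed
  have "(\<lambda>n. bump a b n x) \<longlonglongrightarrow> 1 * 1"
    unfolding bump_def using True by (intro tendsto_mult *) auto
  then show ?thesis using True by simp
next
  case False
  then show ?thesis using bump_outside[OF False] by simp
qed

section \<open>Weak derivatives and antiderivatives\<close>

lemma continuous_imp_locally_integrable:
  fixes f :: "real \<Rightarrow> real"
  assumes "continuous_on UNIV f" shows "locally_integrable f"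
  unfolding locally_integrable_def set_integrable_def
  using borel_integrable_compact[OF compact_Icc continuous_on_subset[OF assms]] by simp

lemma locally_integrable_mult_continuous:
  assumes f: "locally_integrable f" and c: "continuous_on UNIV c"
  shows "locally_integrable (\<lambda>x. f x * c x)"
  unfolding locally_integrable_def
proof (intro allI)
  fix a b :: real
  have [measurable]: "f \<in> borel_measurable borel" "c \<in> borel_measurable borel"
    using f c by (auto intro: locally_integrable_borel borel_measurable_continuous_onI)
  have "bounded (c ` {a..b})"
    by (intro compact_imp_bounded compact_continuous_image compact_Icc continuous_on_subset[OF c]) auto
  then obtain B where B: "\<And>x. x \<in> {a..b} \<Longrightarrow> \<bar>c x\<bar> \<le> B" unfolding bounded_iff by (metis image_eqI real_norm_def)
  have "integrable lborel (\<lambda>x. B * (indicator {a..b} x *\<^sub>R f x))"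
    using f by (intro integrable_mult_right) (auto simp: locally_integrable_def set_integrable_def)
  then show "set_integrable lborel {a..b} (\<lambda>x. f x * c x)"
    unfolding set_integrable_def
  proof (rule Bochner_Integration.integrable_bound)
    show "AE x in lborel. norm (indicator {a..b} x *\<^sub>R (f x * c x)) \<le> norm (B * (indicator {a..b} x *\<^sub>R f x))"
    proof (rule AE_I2)
      fix x
      show "norm (indicator {a..b} x *\<^sub>R (f x * c x)) \<le> norm (B * (indicator {a..b} x *\<^sub>R f x))"
      proof (cases "x \<in> {a..b}")
        case True
        then have "\<bar>c x\<bar> \<le> \<bar>B\<bar>" using B[of x] by auto
        then show ?thesis using True by (simp add: abs_mult mult.commute mult_right_mono)
      qed simp
    qed
  qed measurable
qed

lemma integrable_locally_integrable_mult:
  assumes f: "locally_integrable f" and c: "continuous_on UNIV c" and s: "\<And>x. x \<notin> {-R..R} \<Longrightarrow> c x = 0"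
  shows "integrable lborel (\<lambda>x. f x * c x)"
proof -
  have "integrable lborel (\<lambda>x. indicator {-R..R} x *\<^sub>R (f x * c x))"
    using locally_integrable_mult_continuous[OF f c] by (simp add: locally_integrable_def set_integrable_def)
  moreover have "(\<lambda>x. indicator {-R..R} x *\<^sub>R (f x * c x)) = (\<lambda>x. f x * c x)"
  proof
    fix x show "indicator {-R..R} x *\<^sub>R (f x * c x) = f x * c x"
      using s[of x] by (cases "x \<in> {-R..R}") auto
  qed
  ultimately show ?thesis by simp
qed

lemma locally_integrable_add:
  "locally_integrable f \<Longrightarrow> locally_integrable g \<Longrightarrow> locally_integrable (\<lambda>x. f x + g x)"
  and locally_integrable_diff:
  "locally_integrable f \<Longrightarrow> locally_integrable g \<Longrightarrow> locally_integrable (\<lambda>x. f x - g x)"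
  by (auto simp: locally_integrable_def)

lemma LBINT_Icc_eq_Ioo:
  fixes f :: "real \<Rightarrow> real"
  assumes [measurable]: "f \<in> borel_measurable borel"
  shows "(LBINT y:{a..b}. f y) = (LBINT y:{a<..<b}. f y)" "(LBINT y:{a..b}. f y) = (LBINT y:{a<..b}. f y)"
proof -
  have "AE y in lborel. y \<noteq> a" "AE y in lborel. y \<noteq> b" by (rule AE_lborel_singleton)+
  then have "AE y in lborel. y \<noteq> a \<and> y \<noteq> b" by eventually_elim simp
  then have "AE y in lborel. indicator {a..b} y *\<^sub>R f y = indicator {a<..<b} y *\<^sub>R f y"
    "AE y in lborel. indicator {a..b} y *\<^sub>R f y = indicator {a<..b} y *\<^sub>R f y"
    by (eventually_elim, auto simp: indicator_def)+
  then show "(LBINT y:{a..b}. f y) = (LBINT y:{a<..<b}. f y)" "(LBINT y:{a..b}. f y) = (LBINT y:{a<..b}. f y)"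
    unfolding set_lebesgue_integral_def by (intro integral_cong_AE; measurable)+
qed

text \<open>Bump functions exhaust intervals, so the integral of \<open>f\<close> over every interval vanishes, and then so do its
averages and their limits.\<close>
theorem fundamental_lemma:
  assumes f: "locally_integrable f" and 0: "\<And>\<phi>. \<phi> \<in> test_functions \<Longrightarrow> (\<integral>x. f x * \<phi> x \<partial>lborel) = 0"
  shows "AE x in lborel. f x = 0"
proof -
  have [measurable]: "f \<in> borel_measurable borel" by (rule locally_integrable_borel[OF f])
  have [measurable]: "bump a b n \<in> borel_measurable borel" for a b n by (rule smooth_borel[OF smooth_bump])
  have int0: "(LBINT y:{a..b}. f y) = 0" for a b
  proof -
    have "(\<lambda>n. \<integral>x. f x * bump a b n x \<partial>lborel) \<longlonglongrightarrow> (\<integral>x. f x * indicator {a<..<b} x \<partial>lborel)"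
    proof (rule integral_dominated_convergence)
      show "integrable lborel (\<lambda>x. norm (indicator {a..b} x *\<^sub>R f x))"
        using f by (intro integrable_norm) (auto simp: locally_integrable_def set_integrable_def)
      show "AE x in lborel. (\<lambda>n. f x * bump a b n x) \<longlonglongrightarrow> f x * indicator {a<..<b} x"
        by (intro AE_I2 tendsto_intros bump_tendsto)
      show "AE x in lborel. norm (f x * bump a b n x) \<le> norm (indicator {a..b} x *\<^sub>R f x)" for n
      proof (rule AE_I2)
        fix x show "norm (f x * bump a b n x) \<le> norm (indicator {a..b} x *\<^sub>R f x)"
          using bump_outside[of x a b n] bump_bounds[of a b n x]
          by (cases "x \<in> {a..b}") (auto simp: abs_mult mult_left_le)
      qed
    qed measurable
    moreover have "(\<lambda>n. \<integral>x. f x * bump a b n x \<partial>lborel) = (\<lambda>n. 0)" using 0[OF bump_test] by simp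
    ultimately have "(\<integral>x. f x * indicator {a<..<b} x \<partial>lborel) = 0" by (simp add: LIMSEQ_const_iff)
    then show ?thesis unfolding LBINT_Icc_eq_Ioo(1)[OF \<open>f \<in> _\<close>]
      by (simp add: set_lebesgue_integral_def mult.commute)
  qed
  from lebesgue_differentiation_left[OF f] show ?thesis
  proof eventually_elim
    case (elim x)
    then have "((\<lambda>s::real. 0) \<longlongrightarrow> f x) (at_right 0)" by (simp add: int0)
    then show ?case by (simp add: tendsto_const_iff)
  qed
qed

text \<open>The fundamental theorem of calculus taken as a definition: \<open>W\<close> is locally absolutely continuous with derivative
\<open>g\<close>.\<close>
definition antiderivative :: "(real \<Rightarrow> real) \<Rightarrow> (real \<Rightarrow> real) \<Rightarrow> bool" where
  "antiderivative W g \<longleftrightarrow> locally_integrable g \<and> (\<forall>x y. x \<le> y \<longrightarrow> W y - W x = (LBINT t:{x..y}. g t))"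

text \<open>The difference of the two indicator functions gives the oriented integral from \<open>0\<close> to \<open>x\<close> for either sign of
\<open>x\<close>.\<close>
lemma antiderivative_exists:
  assumes g: "locally_integrable g" shows "\<exists>W. antiderivative W g"
proof -
  have [measurable]: "g \<in> borel_measurable borel" by (rule locally_integrable_borel[OF g])
  define W where "W x = (\<integral>t. (indicator {..x} t - indicator {..0} t) * g t \<partial>lborel)" for x
  have int: "integrable lborel (\<lambda>t. (indicator {..x} t - indicator {..0} t) * g t)" for x
  proof (rule Bochner_Integration.integrable_bound)
    show "integrable lborel (\<lambda>t. indicator {-\<bar>x\<bar>..\<bar>x\<bar>} t *\<^sub>R g t)"
      using g by (auto simp: locally_integrable_def set_integrable_def)
    show "AE t in lborel. norm ((indicator {..x} t - indicator {..0} t) * g t) \<le> norm (indicator {-\<bar>x\<bar>..\<bar>x\<bar>} t *\<^sub>R g t)"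
      by (rule AE_I2) (auto simp: indicator_def)
  qed measurable
  have "W y - W x = (LBINT t:{x..y}. g t)" if "x \<le> y" for x y
  proof -
    have "W y - W x = (\<integral>t. indicator {x<..y} t *\<^sub>R g t \<partial>lborel)"
      unfolding W_def Bochner_Integration.integral_diff[OF int int, symmetric]
      using that by (intro Bochner_Integration.integral_cong) (auto simp: indicator_def)
    then show ?thesis unfolding LBINT_Icc_eq_Ioo(2)[OF \<open>g \<in> _\<close>]
      by (simp add: set_lebesgue_integral_def)
  qed
  then show ?thesis using g by (auto simp: antiderivative_def)
qed

lemma antiderivative_continuous:
  assumes W: "antiderivative W g" shows "continuous_on UNIV W"
proof -
  have "continuous_on {-R..R} W" for R
  proof -
    have g: "set_integrable lborel {a..b} g" for a b using W by (auto simp: antiderivative_def locally_integrable_def)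
    have "continuous_on {-R..R} (\<lambda>x. W (-R) + integral {-R..x} g)"
      using set_borel_integral_eq_integral(1)[OF g]
      by (intro continuous_intros indefinite_integral_continuous_1)
    moreover have "W (-R) + integral {-R..x} g = W x" if "x \<in> {-R..R}" for x
      using set_borel_integral_eq_integral(2)[OF g, of "-R" x] W that by (simp add: antiderivative_def) (metis add_diff_cancel_left' add_diff_eq diff_add_cancel)
    ultimately show ?thesis by (rule continuous_on_eq)
  qed
  then have "isCont W x" for x
    by (rule continuous_on_interior[of "{-(\<bar>x\<bar>+1)..\<bar>x\<bar>+1}"]) auto
  then show ?thesis by (simp add: continuous_at_imp_continuous_on)
qed

lemma DERIV_imp_antiderivative:
  assumes D: "\<And>x. (\<phi> has_real_derivative \<phi>' x) (at x)" and c: "continuous_on UNIV \<phi>'"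
  shows "antiderivative \<phi> \<phi>'"
  unfolding antiderivative_def
proof (intro conjI allI impI)
  show "locally_integrable \<phi>'" by (rule continuous_imp_locally_integrable[OF c])
  fix x y :: real assume "x \<le> y"
  then have "(\<integral>t. \<phi>' t * indicator {x..y} t \<partial>lborel) = \<phi> y - \<phi> x"
    using c by (intro integral_FTC_Icc_real D) (auto simp: continuous_on_eq_continuous_at)
  then show "\<phi> y - \<phi> x = (LBINT t:{x..y}. \<phi>' t)" by (simp add: set_lebesgue_integral_def mult.commute)
qed

lemma DERIV_zero_outside:
  assumes D: "\<And>x. (\<phi> has_real_derivative \<phi>' x) (at x)" and s: "\<And>x. x \<notin> {-R..R} \<Longrightarrow> \<phi> x = 0"
    and x: "x \<notin> {-R..R::real}"
  shows "\<phi>' x = 0"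
proof -
  have "\<forall>\<^sub>F y in nhds x. \<phi> y = 0"
    using eventually_nhds_in_open[OF open_Compl[OF closed_atLeastAtMost], of x "-R" R] x
    by (auto elim!: eventually_mono intro: s simp del: atLeastAtMost_iff)
  then have "((\<lambda>_. 0) has_real_derivative \<phi>' x) (at x)" using D[of x] DERIV_cong_ev[of x x \<phi> "\<lambda>_. 0"] by simp
  then show ?thesis using DERIV_unique DERIV_const by blast
qed

text \<open>Fubini's theorem on the triangle \<open>t \<le> x\<close> for the product \<open>g(t) \<phi>'(x)\<close>. The test function is only required to
be \<open>C\<^sup>1\<close>, because the product rule below multiplies test functions by a \<open>C\<^sup>1\<close> factor.\<close>
theorem antiderivative_by_parts:
  assumes W: "antiderivative W g"
    and D: "\<And>x. (\<phi> has_real_derivative \<phi>' x) (at x)" and c: "continuous_on UNIV \<phi>'"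
    and s: "\<And>x. x \<notin> {-R..R} \<Longrightarrow> \<phi> x = 0"
  shows "(\<integral>x. W x * \<phi>' x \<partial>lborel) = - (\<integral>x. g x * \<phi> x \<partial>lborel)"
proof -
  have g: "locally_integrable g" using W by (simp add: antiderivative_def)
  have [measurable]: "g \<in> borel_measurable borel" by (rule locally_integrable_borel[OF g])
  have [measurable]: "\<phi>' \<in> borel_measurable borel" using c by (rule borel_measurable_continuous_onI)
  \<comment> \<open>strictly beyond the support, so that \<open>\<phi>\<close> vanishes at both end points\<close>
  define r where "r = \<bar>R\<bar> + 1"
  have s': "\<phi>' x = 0" if "x \<notin> {-r<..<r}" for x
    by (rule DERIV_zero_outside[OF D s]) (use that in \<open>auto simp: r_def\<close>)
  have phi0: "\<phi> r = 0" "\<phi> (-r) = 0" by (auto intro!: s simp: r_def)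
  have phi0': "\<phi> x = 0" if "x \<notin> {-r<..<r}" for x using that by (auto intro!: s simp: r_def)
  have anti: "(LBINT t:{x..y}. \<phi>' t) = \<phi> y - \<phi> x" if "x \<le> y" for x y
    using DERIV_imp_antiderivative[OF D c] that by (simp add: antiderivative_def)
  define F where "F x t = indicator {-r..r} t * g t * (indicator {t..r} x * \<phi>' x)" for x t
  have ig: "integrable lborel (\<lambda>t. indicator {-r..r} t * g t)"
    using g by (auto simp: locally_integrable_def set_integrable_def)
  have ip: "integrable lborel (\<lambda>x. indicator {a..b} x * \<phi>' x)" for a b
    using continuous_imp_locally_integrable[OF c] by (auto simp: locally_integrable_def set_integrable_def)
  have [measurable]: "(\<lambda>(x, t). F x t) \<in> borel_measurable (borel \<Otimes>\<^sub>M borel)"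
    unfolding F_def indicator_def atLeastAtMost_iff split_beta by measurable
  have F_int: "integrable (lborel \<Otimes>\<^sub>M lborel) (\<lambda>(x, t). F x t)"
  proof (rule Bochner_Integration.integrable_bound)
    show "integrable (lborel \<Otimes>\<^sub>M lborel) (\<lambda>(x, t). (indicator {-r..r} x * \<phi>' x) * (indicator {-r..r} t * g t))"
    proof (rule lborel_pair.Fubini_integrable)
      show "integrable lborel (\<lambda>x. \<integral>y. norm (case (x, y) of (x, t) \<Rightarrow> (indicator {-r..r} x * \<phi>' x) * (indicator {-r..r} t * g t)) \<partial>lborel)"
        using integrable_norm[OF ip[of "-r" r]] integrable_norm[OF ig] by (simp add: abs_mult)
      show "AE x in lborel. integrable lborel (\<lambda>y. case (x, y) of (x, t) \<Rightarrow> (indicator {-r..r} x * \<phi>' x) * (indicator {-r..r} t * g t))"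
        using ig by (auto intro!: AE_I2)
    qed measurable
    show "AE z in lborel \<Otimes>\<^sub>M lborel. norm (case z of (x, t) \<Rightarrow> F x t) \<le>
      norm (case z of (x, t) \<Rightarrow> (indicator {-r..r} x * \<phi>' x) * (indicator {-r..r} t * g t))"
      by (rule AE_I2) (auto simp: F_def indicator_def abs_mult)
  qed measurable
  have "(\<integral>x. W x * \<phi>' x \<partial>lborel) = (\<integral>x. (\<integral>t. F x t \<partial>lborel) + W (-r) * (indicator {-r..r} x * \<phi>' x) \<partial>lborel)"
  proof (intro Bochner_Integration.integral_cong refl)
    fix x
    show "W x * \<phi>' x = (\<integral>t. F x t \<partial>lborel) + W (-r) * (indicator {-r..r} x * \<phi>' x)"
    proof (cases "x \<in> {-r..r}")
      case True
      have "(\<integral>t. F x t \<partial>lborel) = (\<integral>t. \<phi>' x * (indicator {-r..x} t *\<^sub>R g t) \<partial>lborel)"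
        using True by (intro Bochner_Integration.integral_cong) (auto simp: F_def indicator_def)
      also have "\<dots> = \<phi>' x * (W x - W (-r))"
        using W True by (simp add: antiderivative_def set_lebesgue_integral_def)
      finally show ?thesis using True by (simp add: algebra_simps)
    next
      case False
      then have "\<phi>' x = 0" by (intro s') auto
      then show ?thesis by (simp add: F_def)
    qed
  qed
  also have "\<dots> = (\<integral>x. (\<integral>t. F x t \<partial>lborel) \<partial>lborel) + W (-r) * (LBINT x:{-r..r}. \<phi>' x)"
    using lborel_pair.integrable_fst[OF F_int] ip[of "-r" r]
    by (subst Bochner_Integration.integral_add) (auto simp: set_lebesgue_integral_def)
  also have "(LBINT x:{-r..r}. \<phi>' x) = 0"
    by (subst anti) (auto simp: phi0, simp add: r_def)
  also have "(\<integral>x. (\<integral>t. F x t \<partial>lborel) \<partial>lborel) = (\<integral>t. (\<integral>x. F x t \<partial>lborel) \<partial>lborel)"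
    by (rule lborel_pair.Fubini_integral[symmetric, OF F_int])
  also have "\<dots> = (\<integral>t. - (g t * \<phi> t) \<partial>lborel)"
  proof (intro Bochner_Integration.integral_cong refl)
    fix t
    show "(\<integral>x. F x t \<partial>lborel) = - (g t * \<phi> t)"
    proof (cases "t \<in> {-r..r}")
      case True
      then show ?thesis using anti[of t r] by (simp add: F_def set_lebesgue_integral_def phi0)
    next
      case False
      then show ?thesis using phi0'[of t] by (auto simp: F_def)
    qed
  qed
  finally show ?thesis by simp
qed

text \<open>An antiderivative that vanishes to the left of the support is constant to the right of it, and this constant is the
integral of \<open>\<psi>\<close>.\<close>
lemma smooth_antiderivative_of_mean_zero:
  assumes sm: "smooth \<psi>" and s: "\<And>x. x \<notin> {-R..R} \<Longrightarrow> \<psi> x = 0" and 0: "(\<integral>x. \<psi> x \<partial>lborel) = 0"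
  shows "\<exists>\<phi>\<in>test_functions. deriv \<phi> = \<psi>"
proof -
  have c: "continuous_on UNIV \<psi>" by (rule smooth_continuous[OF sm])
  obtain \<Phi> where D: "\<And>x. (\<Phi> has_real_derivative \<psi> x) (at x)"
    using einterval_antiderivative[of "-\<infinity>" \<infinity> \<psi>] c
    by (auto simp: continuous_on_eq_continuous_at has_real_derivative_iff_has_vector_derivative)
  have anti: "\<Phi> y - \<Phi> x = (LBINT t:{x..y}. \<psi> t)" if "x \<le> y" for x y
    using DERIV_imp_antiderivative[OF D c] that by (simp add: antiderivative_def)
  define r where "r = \<bar>R\<bar> + 1"
  have s': "\<psi> x = 0" if "x \<notin> {-r<..<r}" for x using that by (auto intro!: s simp: r_def)
  have left: "\<Phi> x = \<Phi> (-r)" if "x \<le> -r" for x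
  proof -
    have "(LBINT t:{x..-r}. \<psi> t) = (LBINT t:{x..-r}. 0)"
      by (intro set_lebesgue_integral_cong) (auto intro!: s')
    then show ?thesis using anti[OF that] by simp
  qed
  have right: "\<Phi> x = \<Phi> (-r)" if "r \<le> x" for x
  proof -
    have "(LBINT t:{-r..x}. \<psi> t) = (\<integral>x. \<psi> x \<partial>lborel)"
      unfolding set_lebesgue_integral_def using that
      by (intro Bochner_Integration.integral_cong) (auto simp: indicator_def intro: ccontr s')
    moreover have "-r \<le> x" using that by (auto simp: r_def)
    ultimately show ?thesis using anti[of "-r" x] 0 by simp
  qed
  define \<phi> where "\<phi> x = \<Phi> x - \<Phi> (-r)" for x
  have D': "(\<phi> has_real_derivative \<psi> x) (at x)" for x
    unfolding \<phi>_def using D by (auto intro!: derivative_eq_intros)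
  have "\<phi> x = 0" if "x \<notin> {-r..r}" for x using that left[of x] right[of x] by (auto simp: \<phi>_def)
  then have "\<phi> \<in> test_functions"
    unfolding test_functions_def using smoothI_DERIV[OF D' sm] by (auto intro!: compact_suppI[of "-r" r])
  moreover have "deriv \<phi> = \<psi>" using D' by (intro ext DERIV_imp_deriv)
  ultimately show ?thesis by blast
qed

lemma test_functionE:
  assumes "\<phi> \<in> test_functions"
  obtains R where "smooth \<phi>" "0 < R" "\<And>x. x \<notin> {-R..R} \<Longrightarrow> \<phi> x = 0"
  using assms compact_suppE unfolding test_functions_def by blast

lemma deriv_zero_outside:
  "smooth \<phi> \<Longrightarrow> (\<And>x. x \<notin> {-R..R} \<Longrightarrow> \<phi> x = 0) \<Longrightarrow> x \<notin> {-R..R} \<Longrightarrow> deriv \<phi> x = 0"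
  by (rule DERIV_zero_outside[of \<phi> "deriv \<phi>" R]) (auto intro: smooth_DERIV)

text \<open>Subtracting a multiple of a fixed bump function makes any test function have integral zero, hence the derivative of
a test function; the constant is the mean of \<open>h\<close> against that bump function.\<close>
theorem du_bois_reymond:
  assumes h: "locally_integrable h"
    and 0: "\<And>\<phi>. \<phi> \<in> test_functions \<Longrightarrow> (\<integral>x. h x * deriv \<phi> x \<partial>lborel) = 0"
  shows "\<exists>c. AE x in lborel. h x = c"
proof -
  let ?b = "bump 0 1 1"
  define m where "m = (\<integral>x. ?b x \<partial>lborel)"
  have bb: "?b x = 0" if "x \<notin> {-1..1}" for x using that by (intro bump_outside) auto
  have bint: "integrable lborel ?b"
    using integrable_locally_integrable_mult[of "\<lambda>_. 1" ?b 1] bb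
    by (simp add: continuous_imp_locally_integrable smooth_continuous[OF smooth_bump])
  have "m \<noteq> 0"
  proof
    assume "m = 0"
    then have "AE x in lborel. ?b x = 0"
      using integral_nonneg_eq_0_iff_AE[OF bint] bump_bounds by (auto simp: m_def)
    then have "AE x in lborel. x \<notin> {0<..<1::real}"
      by eventually_elim (auto simp: bump_def flat_def)
    then have "emeasure lborel {0<..<1::real} = 0"
      by (subst (asm) AE_iff_measurable[of "{0<..<1}"]) auto
    then show False by simp
  qed
  define c where "c = (\<integral>x. h x * ?b x \<partial>lborel) / m"
  have "AE x in lborel. h x - c = 0"
  proof (rule fundamental_lemma)
    show "locally_integrable (\<lambda>x. h x - c)"
      by (intro locally_integrable_diff h continuous_imp_locally_integrable) auto
    fix \<psi> assume psi: "\<psi> \<in> test_functions"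
    from test_functionE[OF psi] obtain R where sm: "smooth \<psi>" and R: "0 < R" "\<And>x. x \<notin> {-R..R} \<Longrightarrow> \<psi> x = 0" by blast
    have pint: "integrable lborel \<psi>"
      using integrable_locally_integrable_mult[of "\<lambda>_. 1" \<psi> R] R
      by (simp add: continuous_imp_locally_integrable smooth_continuous[OF sm])
    have hp: "integrable lborel (\<lambda>x. h x * \<psi> x)" "integrable lborel (\<lambda>x. h x * ?b x)"
      by (rule integrable_locally_integrable_mult[OF h smooth_continuous[OF sm] R(2)], simp)
         (rule integrable_locally_integrable_mult[OF h smooth_continuous[OF smooth_bump] bb], simp)
    define k where "k = (\<integral>x. \<psi> x \<partial>lborel) / m"
    define \<psi>0 where "\<psi>0 x = \<psi> x + (- k) * ?b x" for x
    have "\<exists>\<phi>\<in>test_functions. deriv \<phi> = \<psi>0"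
    proof (rule smooth_antiderivative_of_mean_zero)
      show "smooth \<psi>0" unfolding \<psi>0_def by (intro smooth_add smooth_mult smooth_const sm smooth_bump)
      show "\<psi>0 x = 0" if "x \<notin> {-(R + 1)..R + 1}" for x
        using that R bb by (auto simp: \<psi>0_def)
      show "(\<integral>x. \<psi>0 x \<partial>lborel) = 0"
        unfolding \<psi>0_def using pint bint \<open>m \<noteq> 0\<close> by (simp add: m_def k_def)
    qed
    then have "(\<integral>x. h x * \<psi>0 x \<partial>lborel) = 0" using 0 by auto
    moreover have "(\<integral>x. h x * \<psi>0 x \<partial>lborel) = (\<integral>x. h x * \<psi> x - k * (h x * ?b x) \<partial>lborel)"
      by (intro Bochner_Integration.integral_cong) (auto simp: \<psi>0_def algebra_simps)
    ultimately have "(\<integral>x. h x * \<psi> x \<partial>lborel) = k * (\<integral>x. h x * ?b x \<partial>lborel)" using hp by simp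
    also have "\<dots> = c * (\<integral>x. \<psi> x \<partial>lborel)" by (simp add: c_def k_def)
    finally have "(\<integral>x. h x * \<psi> x - c * \<psi> x \<partial>lborel) = 0" using hp pint by simp
    then show "(\<integral>x. (h x - c) * \<psi> x \<partial>lborel) = 0" by (simp add: left_diff_distrib)
  qed
  then have "AE x in lborel. h x = c" by simp
  then show ?thesis by blast
qed

text \<open>The difference of \<open>f\<close> and any antiderivative of \<open>g\<close> has weak derivative zero.\<close>
theorem weak_deriv_antiderivative:
  assumes "has_weak_deriv f g"
  shows "\<exists>W. antiderivative W g \<and> (AE x in lborel. f x = W x)"
proof -
  have f: "locally_integrable f" and g: "locally_integrable g"
    and wd: "\<And>\<phi>. \<phi> \<in> test_functions \<Longrightarrow> (\<integral>x. f x * deriv \<phi> x \<partial>lborel) = - (\<integral>x. g x * \<phi> x \<partial>lborel)"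
    using assms by (auto simp: has_weak_deriv_def)
  obtain V where V: "antiderivative V g" using antiderivative_exists[OF g] by blast
  have Vl: "locally_integrable V" using continuous_imp_locally_integrable[OF antiderivative_continuous[OF V]] .
  have "\<exists>c. AE x in lborel. f x - V x = c"
  proof (rule du_bois_reymond)
    show "locally_integrable (\<lambda>x. f x - V x)" by (intro locally_integrable_diff f Vl)
    fix \<phi> assume phi: "\<phi> \<in> test_functions"
    from test_functionE[OF phi] obtain R where sm: "smooth \<phi>" and R: "0 < R" "\<And>x. x \<notin> {-R..R} \<Longrightarrow> \<phi> x = 0" by blast
    have cd: "continuous_on UNIV (deriv \<phi>)" by (intro smooth_continuous smooth_deriv sm)
    have "(\<integral>x. V x * deriv \<phi> x \<partial>lborel) = - (\<integral>x. g x * \<phi> x \<partial>lborel)"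
      by (rule antiderivative_by_parts[OF V smooth_DERIV[OF sm] cd R(2)])
    moreover have "integrable lborel (\<lambda>x. f x * deriv \<phi> x)" "integrable lborel (\<lambda>x. V x * deriv \<phi> x)"
      by (auto intro!: integrable_locally_integrable_mult[OF _ cd] f Vl deriv_zero_outside[OF sm R(2)])
    ultimately show "(\<integral>x. (f x - V x) * deriv \<phi> x \<partial>lborel) = 0"
      using wd[OF phi] by (simp add: left_diff_distrib)
  qed
  then obtain c where "AE x in lborel. f x - V x = c" by blast
  then have "AE x in lborel. f x = V x + c" by eventually_elim simp
  moreover have "antiderivative (\<lambda>x. V x + c) g" using V by (simp add: antiderivative_def)
  ultimately show ?thesis by blast
qed

text \<open>The definition of the weak derivative quantifies over smooth test functions. Passing to an antiderivative extends
it to \<open>C\<^sup>1\<close> test functions.\<close>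
lemma weak_deriv_C1_test:
  assumes wd: "has_weak_deriv f g"
    and D: "\<And>x. (\<phi> has_real_derivative \<phi>' x) (at x)" and c: "continuous_on UNIV \<phi>'"
    and s: "\<And>x. x \<notin> {-R..R} \<Longrightarrow> \<phi> x = 0"
  shows "(\<integral>x. f x * \<phi>' x \<partial>lborel) = - (\<integral>x. g x * \<phi> x \<partial>lborel)"
proof -
  obtain W where W: "antiderivative W g" "AE x in lborel. f x = W x"
    using weak_deriv_antiderivative[OF wd] by blast
  have [measurable]: "f \<in> borel_measurable borel" "W \<in> borel_measurable borel" "\<phi>' \<in> borel_measurable borel"
    using wd antiderivative_continuous[OF W(1)] c
    by (auto intro: locally_integrable_borel borel_measurable_continuous_onI simp: has_weak_deriv_def)
  have "(\<integral>x. f x * \<phi>' x \<partial>lborel) = (\<integral>x. W x * \<phi>' x \<partial>lborel)"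
    using W(2) by (intro integral_cong_AE) auto
  also have "\<dots> = - (\<integral>x. g x * \<phi> x \<partial>lborel)" by (rule antiderivative_by_parts[OF W(1) D c s])
  finally show ?thesis .
qed

text \<open>If \<open>\<phi>\<close> is a test function then \<open>e \<phi>\<close> is a \<open>C\<^sup>1\<close> test function, and the rule is the definition of the weak
derivative of \<open>f\<close> applied to it.\<close>
theorem weak_deriv_mult_C1:
  assumes wd: "has_weak_deriv f g"
    and D: "\<And>x. (e has_real_derivative e' x) (at x)" and c': "continuous_on UNIV e'"
  shows "has_weak_deriv (\<lambda>x. f x * e x) (\<lambda>x. g x * e x + f x * e' x)"
proof -
  have f: "locally_integrable f" and g: "locally_integrable g" using wd by (auto simp: has_weak_deriv_def)
  have c: "continuous_on UNIV e" using D by (meson DERIV_isCont continuous_at_imp_continuous_on)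
  show ?thesis unfolding has_weak_deriv_def
  proof (intro conjI ballI)
    show "locally_integrable (\<lambda>x. f x * e x)" "locally_integrable (\<lambda>x. g x * e x + f x * e' x)"
      by (intro locally_integrable_add locally_integrable_mult_continuous f g c c')+
    fix \<phi> assume phi: "\<phi> \<in> test_functions"
    from test_functionE[OF phi] obtain R where sm: "smooth \<phi>" and R: "0 < R" "\<And>x. x \<notin> {-R..R} \<Longrightarrow> \<phi> x = 0" by blast
    have cp: "continuous_on UNIV \<phi>" and cd: "continuous_on UNIV (deriv \<phi>)"
      by (intro smooth_continuous smooth_deriv sm)+
    have "((\<lambda>x. e x * \<phi> x) has_real_derivative e' x * \<phi> x + deriv \<phi> x * e x) (at x)" for x
      by (intro DERIV_mult D smooth_DERIV sm)
    then have "(\<integral>x. f x * (e' x * \<phi> x + deriv \<phi> x * e x) \<partial>lborel) = - (\<integral>x. g x * (e x * \<phi> x) \<partial>lborel)"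
      by (rule weak_deriv_C1_test[OF wd]) (auto intro!: continuous_intros cp cd c c' R(2))
    moreover have i1: "integrable lborel (\<lambda>x. f x * (e' x * \<phi> x))" and i2: "integrable lborel (\<lambda>x. f x * (deriv \<phi> x * e x))"
      and i3: "integrable lborel (\<lambda>x. g x * (e x * \<phi> x))"
      by (auto intro!: integrable_locally_integrable_mult[where R = R] f g continuous_intros cp cd c c' R(2)
            deriv_zero_outside[OF sm R(2)])
    ultimately have "(\<integral>x. f x * (e' x * \<phi> x) \<partial>lborel) + (\<integral>x. f x * (deriv \<phi> x * e x) \<partial>lborel) =
       - (\<integral>x. g x * (e x * \<phi> x) \<partial>lborel)"
      by (simp add: distrib_left)
    moreover have "(\<integral>x. (g x * e x + f x * e' x) * \<phi> x \<partial>lborel) =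
        (\<integral>x. g x * (e x * \<phi> x) \<partial>lborel) + (\<integral>x. f x * (e' x * \<phi> x) \<partial>lborel)"
      by (subst Bochner_Integration.integral_add[OF i3 i1, symmetric])
         (auto intro!: Bochner_Integration.integral_cong simp: algebra_simps)
    ultimately show "(\<integral>x. f x * e x * deriv \<phi> x \<partial>lborel) = - (\<integral>x. (g x * e x + f x * e' x) * \<phi> x \<partial>lborel)"
      by (simp add: mult_ac)
  qed
qed

lemma weak_deriv_unique:
  assumes "has_weak_deriv f g" "has_weak_deriv f h" shows "AE x in lborel. g x = h x"
proof -
  have g: "locally_integrable g" and h: "locally_integrable h"
    using assms by (auto simp: has_weak_deriv_def)
  have "AE x in lborel. g x - h x = 0"
  proof (rule fundamental_lemma)
    show "locally_integrable (\<lambda>x. g x - h x)" by (intro locally_integrable_diff g h)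
    fix \<phi> assume phi: "\<phi> \<in> test_functions"
    from test_functionE[OF phi] obtain R where sm: "smooth \<phi>" and R: "0 < R" "\<And>x. x \<notin> {-R..R} \<Longrightarrow> \<phi> x = 0" by blast
    have "integrable lborel (\<lambda>x. g x * \<phi> x)" "integrable lborel (\<lambda>x. h x * \<phi> x)"
      by (auto intro!: integrable_locally_integrable_mult[OF _ smooth_continuous[OF sm] R(2)] g h)
    then show "(\<integral>x. (g x - h x) * \<phi> x \<partial>lborel) = 0"
      using assms phi by (auto simp: has_weak_deriv_def left_diff_distrib)
  qed
  then show ?thesis by simp
qed

section \<open>The fractional derivative at a point\<close>

lemma Gamma_pos: "0 < (x::real) \<Longrightarrow> 0 < Gamma x"
  by (simp add: Gamma_real_pos_exp)

text \<open>Two applications of the functional equation of the Gamma function. The right-hand side exhibits the zeros at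
\<open>\<alpha> = 0\<close> and \<open>\<alpha> = 1\<close> that compensate the divergence of the integrals at these endpoints.\<close>
lemma frac_const_eq:
  assumes "0 < \<alpha>" "\<alpha> < 1"
  shows "frac_const \<alpha> = \<alpha> * (1 - \<alpha>) / Gamma (2 - \<alpha>)"
proof -
  have notint: "- \<alpha> \<notin> \<int>\<^sub>\<le>\<^sub>0"
  proof
    assume "- \<alpha> \<in> \<int>\<^sub>\<le>\<^sub>0"
    then have "\<alpha> \<in> \<int>" using nonpos_Ints_Int by force
    then obtain n where "\<alpha> = of_int n" by (auto elim: Ints_cases)
    with assms show False by simp
  qed
  have 1: "Gamma (1 - \<alpha>) = - \<alpha> * Gamma (- \<alpha>)" using Gamma_plus1[OF notint] by (simp add: add.commute)
  have 2: "Gamma (2 - \<alpha>) = (1 - \<alpha>) * Gamma (1 - \<alpha>)"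
    using assms Gamma_plus1[of "1 - \<alpha>"] by (simp add: add.commute) (metis diff_add_eq diff_gt_0_iff_gt nonpos_Ints_nonpos not_le one_add_one)
  have 3: "\<bar>Gamma (- \<alpha>)\<bar> = Gamma (1 - \<alpha>) / \<alpha>"
    using 1 assms Gamma_pos[of "1 - \<alpha>"] by (simp add: field_simps) (smt (verit) mult_nonneg_nonneg zero_less_mult_iff)
  show ?thesis unfolding frac_const_def 3 2 using assms by simp
qed

lemma frac_const_pos: "0 < \<alpha> \<Longrightarrow> \<alpha> < 1 \<Longrightarrow> 0 < frac_const \<alpha>"
  using Gamma_pos[of "2 - \<alpha>"] by (simp add: frac_const_eq)

lemma Gamma_2_minus_tendsto:
  "0 \<le> c \<Longrightarrow> c \<le> 1 \<Longrightarrow> ((\<lambda>\<alpha>. Gamma (2 - \<alpha>)) \<longlongrightarrow> Gamma (2 - c)) (at (c::real) within S)"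
proof -
  assume "0 \<le> c" "c \<le> 1"
  then have "2 - c \<notin> \<int>\<^sub>\<le>\<^sub>0" using nonpos_Ints_nonpos[of "2 - c"] by auto
  then show ?thesis by (intro tendsto_Gamma tendsto_intros)
qed

lemma Gamma_2: "Gamma (2::real) = 1" using Gamma_fact[of 1, where 'a = real] by simp

lemma frac_const_tendsto_1: "((\<lambda>\<alpha>. frac_const \<alpha> / (1 - \<alpha>)) \<longlongrightarrow> 1) (at_left 1)"
proof -
  have "((\<lambda>\<alpha>. \<alpha> / Gamma (2 - \<alpha>)) \<longlongrightarrow> 1 / Gamma (2 - 1 :: real)) (at_left 1)"
    by (intro tendsto_intros Gamma_2_minus_tendsto) auto
  moreover have "\<forall>\<^sub>F \<alpha> in at_left (1::real). 0 < \<alpha> \<and> \<alpha> < 1"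
    using eventually_at_left_real[of 0 1] by (auto elim: eventually_mono)
  then have "\<forall>\<^sub>F \<alpha> in at_left (1::real). \<alpha> / Gamma (2 - \<alpha>) = frac_const \<alpha> / (1 - \<alpha>)"
    by eventually_elim (simp add: frac_const_eq)
  ultimately show ?thesis by (auto intro: Lim_transform_eventually)
qed

lemma frac_const_tendsto_0: "((\<lambda>\<alpha>. frac_const \<alpha> / \<alpha>) \<longlongrightarrow> 1) (at_right 0)"
proof -
  have "((\<lambda>\<alpha>. (1 - \<alpha>) / Gamma (2 - \<alpha>)) \<longlongrightarrow> (1 - 0) / Gamma (2 - 0 :: real)) (at_right 0)"
    by (intro tendsto_intros Gamma_2_minus_tendsto) (auto simp: Gamma_2)
  moreover have "\<forall>\<^sub>F \<alpha> in at_right (0::real). 0 < \<alpha> \<and> \<alpha> < 1"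
    using eventually_at_right_real[of 0 1] by (auto elim: eventually_mono)
  then have "\<forall>\<^sub>F \<alpha> in at_right (0::real). (1 - \<alpha>) / Gamma (2 - \<alpha>) = frac_const \<alpha> / \<alpha>"
    by eventually_elim (simp add: frac_const_eq)
  ultimately show ?thesis by (auto intro: Lim_transform_eventually simp: Gamma_2)
qed

lemma frac_const_bound:
  "\<exists>G>0. \<forall>\<alpha>. 0 < \<alpha> \<longrightarrow> \<alpha> < 1 \<longrightarrow> frac_const \<alpha> \<le> G * (\<alpha> * (1 - \<alpha>))"
proof -
  have "continuous_on {1..2::real} Gamma"
    by (intro continuous_on_Gamma) (auto dest: nonpos_Ints_nonpos)
  then obtain y :: real where y: "y \<in> {1..2}" "\<And>x. x \<in> {1..2} \<Longrightarrow> Gamma y \<le> Gamma x"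
    using continuous_attains_inf[of "{1..2::real}" Gamma] by fastforce
  have pos: "0 < Gamma y" using y by (intro Gamma_pos) auto
  have "frac_const \<alpha> \<le> (1 / Gamma y) * (\<alpha> * (1 - \<alpha>))" if "0 < \<alpha>" "\<alpha> < 1" for \<alpha>
    using that pos y(2)[of "2 - \<alpha>"] by (simp add: frac_const_eq divide_left_mono)
  then show ?thesis using pos by (intro exI[of _ "1 / Gamma y"]) auto
qed

lemma nn_integral_powr_from_0:
  fixes \<alpha> :: real
  assumes "\<alpha> < 1"
  shows "(\<integral>\<^sup>+s\<in>{0<..1}. ennreal (s powr - \<alpha>) \<partial>lborel) = ennreal (1 / (1 - \<alpha>))"
proof -
  have "(\<integral>\<^sup>+s\<in>{0<..1}. ennreal (s powr - \<alpha>) \<partial>lborel) = (\<integral>\<^sup>+s\<in>{0..1}. ennreal (s powr - \<alpha>) \<partial>lborel)"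
    by (intro nn_integral_cong) (auto simp: indicator_def)
  also have "\<dots> = ennreal (1 powr (- \<alpha> + 1) / (- \<alpha> + 1))"
    using assms by (intro nn_integral_has_integral_lebesgue' has_integral_powr_from_0) auto
  finally show ?thesis by simp
qed

lemma nn_integral_powr_to_infinity:
  assumes "0 < \<alpha>" "0 < r"
  shows "(\<integral>\<^sup>+s\<in>{r..}. ennreal (s powr - (1 + \<alpha>)) \<partial>lborel) = ennreal (r powr - \<alpha> / \<alpha>)"
proof -
  have "(\<integral>\<^sup>+s\<in>{r..}. ennreal (s powr - (1 + \<alpha>)) \<partial>lborel) = ennreal (- (r powr (- (1 + \<alpha>) + 1)) / (- (1 + \<alpha>) + 1))"
    using assms by (intro nn_integral_has_integral_lebesgue' has_integral_powr_to_inf) auto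
  then show ?thesis by simp
qed

text \<open>The kernel \<open>s\<^sup>-\<^sup>1\<^sup>-\<^sup>\<alpha>\<close> of the part \<open>s > 1\<close>, continued by the constant \<open>1\<close> so that it decreases on all of
\<open>(0, \<infinity>)\<close> and remains integrable.\<close>
definition tail_kernel :: "real \<Rightarrow> real \<Rightarrow> ennreal" where
  "tail_kernel \<alpha> s = ennreal (min 1 (s powr - (1 + \<alpha>)))"

lemma tail_kernel_measurable [measurable]: "tail_kernel \<alpha> \<in> borel_measurable borel"
  unfolding tail_kernel_def by measurable

lemma tail_kernel_antitone: "0 < \<alpha> \<Longrightarrow> 0 < r \<Longrightarrow> r \<le> s \<Longrightarrow> tail_kernel \<alpha> s \<le> tail_kernel \<alpha> r"
  unfolding tail_kernel_def by (intro ennreal_leI min.mono powr_mono2') auto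

lemma tail_kernel_mass:
  assumes "0 < \<alpha>" shows "(\<integral>\<^sup>+s\<in>{0<..}. tail_kernel \<alpha> s \<partial>lborel) \<le> ennreal (1 + 1 / \<alpha>)"
proof -
  have "(\<integral>\<^sup>+s\<in>{0<..}. tail_kernel \<alpha> s \<partial>lborel) \<le>
      (\<integral>\<^sup>+s. indicator {0..1::real} s + ennreal (s powr - (1 + \<alpha>)) * indicator {1..} s \<partial>lborel)"
    by (intro nn_integral_mono) (auto simp: tail_kernel_def indicator_def)
  also have "\<dots> = 1 + ennreal (1 / \<alpha>)"
    using assms nn_integral_powr_to_infinity[of \<alpha> 1] by (subst nn_integral_add) auto
  also have "\<dots> = ennreal (1 + 1 / \<alpha>)" using assms by (subst ennreal_plus) auto
  finally show ?thesis .
qed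

text \<open>The measures \<open>(1 - \<alpha>) s\<^sup>-\<^sup>\<alpha> ds\<close> on \<open>(0, 1]\<close> have mass \<open>1\<close>, and on \<open>[\<delta>, 1]\<close> their density is at most
\<open>(1 - \<alpha>) / \<delta>\<close>.\<close>
lemma powr_concentration:
  fixes q :: "real \<Rightarrow> ennreal"
  assumes [measurable]: "q \<in> borel_measurable borel"
    and q0: "(q \<longlongrightarrow> 0) (at_right 0)"
    and fin: "\<And>\<delta>. 0 < \<delta> \<Longrightarrow> (\<integral>\<^sup>+s\<in>{\<delta>..1}. q s \<partial>lborel) < top"
  shows "((\<lambda>\<alpha>. ennreal (1 - \<alpha>) * (\<integral>\<^sup>+s\<in>{0<..1}. ennreal (s powr - \<alpha>) * q s \<partial>lborel)) \<longlongrightarrow> 0) (at_left 1)"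
proof (rule tendsto_zero_ennreal)
    fix e :: real assume e: "0 < e"
    have "\<forall>\<^sub>F s in at_right 0. q s < ennreal (e / 2)"
      using q0 e by (intro order_tendstoD(2)) auto
    then obtain b where b: "0 < b" "\<And>s. 0 < s \<Longrightarrow> s < b \<Longrightarrow> q s < ennreal (e / 2)"
      unfolding eventually_at_right_field by auto
    define \<delta> where "\<delta> = min b 1"
    have d: "0 < \<delta>" "\<delta> \<le> 1" "\<And>s. 0 < s \<Longrightarrow> s < \<delta> \<Longrightarrow> q s \<le> ennreal (e / 2)"
      using b by (auto simp: \<delta>_def intro: less_imp_le)
    obtain M where M: "(\<integral>\<^sup>+s\<in>{\<delta>..1}. q s \<partial>lborel) = ennreal M" "0 \<le> M"
      using fin[OF d(1)] by (cases "\<integral>\<^sup>+s\<in>{\<delta>..1}. q s \<partial>lborel") auto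
    have bound: "ennreal (1 - \<alpha>) * (\<integral>\<^sup>+s\<in>{0<..1}. ennreal (s powr - \<alpha>) * q s \<partial>lborel) \<le>
        ennreal (e / 2 + (1 - \<alpha>) / \<delta> * M)" if a: "0 < \<alpha>" "\<alpha> < 1" for \<alpha>
    proof -
      have "(\<integral>\<^sup>+s\<in>{0<..1}. ennreal (s powr - \<alpha>) * q s \<partial>lborel) \<le>
         (\<integral>\<^sup>+s. ennreal (e / 2) * (ennreal (s powr - \<alpha>) * indicator {0<..1} s) + ennreal (1 / \<delta>) * (q s * indicator {\<delta>..1} s) \<partial>lborel)"
      proof (rule nn_integral_mono)
        fix s :: real
        show "ennreal (s powr - \<alpha>) * q s * indicator {0<..1} s \<le>
          ennreal (e / 2) * (ennreal (s powr - \<alpha>) * indicator {0<..1} s) + ennreal (1 / \<delta>) * (q s * indicator {\<delta>..1} s)"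
        proof (cases "s \<in> {0<..1}")
          case True
          show ?thesis
          proof (cases "s < \<delta>")
            case t: True
            have "ennreal (s powr - \<alpha>) * q s \<le> ennreal (e / 2) * ennreal (s powr - \<alpha>)"
              using d(3)[of s] True t by (subst mult.commute) (simp add: mult_right_mono)
            then show ?thesis using True by (simp add: add_increasing2)
          next
            case False
            have "s powr - \<alpha> \<le> \<delta> powr - \<alpha>" using False d a by (intro powr_mono2') auto
            also have "\<dots> \<le> \<delta> powr - 1" using d a by (intro powr_mono') auto
            also have "\<dots> = 1 / \<delta>" using d by (simp add: powr_minus_divide)
            finally have "ennreal (s powr - \<alpha>) * q s \<le> ennreal (1 / \<delta>) * q s"
              by (intro mult_right_mono ennreal_leI) auto
            then show ?thesis using True False by (simp add: add_increasing)
          qed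
        qed simp
      qed
      also have "\<dots> = ennreal (e / 2) * ennreal (1 / (1 - \<alpha>)) + ennreal (1 / \<delta>) * ennreal M"
        using nn_integral_powr_from_0[OF a(2)] M by (simp add: nn_integral_add nn_integral_cmult)
      finally have "ennreal (1 - \<alpha>) * (\<integral>\<^sup>+s\<in>{0<..1}. ennreal (s powr - \<alpha>) * q s \<partial>lborel) \<le>
          ennreal (1 - \<alpha>) * (ennreal (e / 2) * ennreal (1 / (1 - \<alpha>)) + ennreal (1 / \<delta>) * ennreal M)"
        by (intro mult_left_mono) auto
      also have "\<dots> = ennreal ((1 - \<alpha>) * (e / 2 * (1 / (1 - \<alpha>)) + 1 / \<delta> * M))"
        using a d M e by (simp flip: ennreal_mult ennreal_plus)
      also have "(1 - \<alpha>) * (e / 2 * (1 / (1 - \<alpha>)) + 1 / \<delta> * M) = e / 2 + (1 - \<alpha>) / \<delta> * M"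
        using a by (simp add: field_simps)
      finally show ?thesis .
    qed
    have "((\<lambda>\<alpha>. e / 2 + (1 - \<alpha>) / \<delta> * M) \<longlongrightarrow> e / 2 + (1 - 1) / \<delta> * M) (at_left 1)"
      using d by (intro tendsto_intros) auto
    then have "\<forall>\<^sub>F \<alpha> in at_left 1. e / 2 + (1 - \<alpha>) / \<delta> * M < e"
      by (rule order_tendstoD(2)) (use e in simp)
    moreover have "\<forall>\<^sub>F \<alpha> in at_left (1::real). 0 < \<alpha> \<and> \<alpha> < 1"
      using eventually_at_left_real[of 0 1] by (auto elim: eventually_mono)
    ultimately show "\<forall>\<^sub>F \<alpha> in at_left 1. ennreal (1 - \<alpha>) * (\<integral>\<^sup>+s\<in>{0<..1}. ennreal (s powr - \<alpha>) * q s \<partial>lborel) < ennreal e"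
    proof eventually_elim
      case (elim \<alpha>)
      have "ennreal (e / 2 + (1 - \<alpha>) / \<delta> * M) < ennreal e"
        using elim e d M by (intro ennreal_lessI) auto
      with bound[of \<alpha>] elim show ?case by (auto intro: le_less_trans)
    qed
qed

text \<open>The left fractional derivative in the variable \<open>s = x - t\<close>.\<close>
definition frac_deriv :: "real \<Rightarrow> (real \<Rightarrow> real) \<Rightarrow> real \<Rightarrow> real" where
  "frac_deriv \<alpha> w x = frac_const \<alpha> * (LBINT s:{0<..}. (w x - w (x - s)) / s powr (1 + \<alpha>))"

lemma set_integrableI_nn:
  fixes F :: "real \<Rightarrow> real"
  assumes [measurable]: "F \<in> borel_measurable borel" "A \<in> sets borel"
    and "(\<integral>\<^sup>+s\<in>A. ennreal \<bar>F s\<bar> \<partial>lborel) < top"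
  shows "set_integrable lborel A F"
  unfolding set_integrable_def
proof (rule integrableI_bounded)
  have "(\<integral>\<^sup>+x. ennreal (norm (indicator A x *\<^sub>R F x)) \<partial>lborel) = (\<integral>\<^sup>+s\<in>A. ennreal \<bar>F s\<bar> \<partial>lborel)"
    by (intro nn_integral_cong) (auto simp: indicator_def)
  then show "(\<integral>\<^sup>+x. ennreal (norm (indicator A x *\<^sub>R F x)) \<partial>lborel) < \<infinity>" using assms(3) by simp
qed measurable

lemma abs_LBINT_le:
  fixes F :: "real \<Rightarrow> real"
  shows "ennreal \<bar>(LBINT s:A. F s)\<bar> \<le> (\<integral>\<^sup>+s\<in>A. ennreal \<bar>F s\<bar> \<partial>lborel)"
proof (cases "set_integrable lborel A F")
  case True
  have "(\<integral>\<^sup>+x. ennreal (norm (indicator A x *\<^sub>R F x)) \<partial>lborel) = (\<integral>\<^sup>+s\<in>A. ennreal \<bar>F s\<bar> \<partial>lborel)"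
    by (intro nn_integral_cong) (auto simp: indicator_def)
  then show ?thesis using integral_norm_bound_ennreal[OF True[unfolded set_integrable_def]]
    by (simp add: set_lebesgue_integral_def)
next
  case False
  then show ?thesis by (simp add: set_integrable_def set_lebesgue_integral_def not_integrable_integral_eq)
qed

lemma LBINT_powr_from_0:
  fixes \<alpha> :: real
  assumes "\<alpha> < 1"
  shows "set_integrable lborel {0<..1} (\<lambda>s. s powr - \<alpha>)" "(LBINT s:{0<..1}. s powr - \<alpha>) = 1 / (1 - \<alpha>)"
proof -
  show i: "set_integrable lborel {0<..1} (\<lambda>s. s powr - \<alpha>)"
    by (rule set_integrableI_nn) (use nn_integral_powr_from_0[OF assms] in auto)
  have "ennreal (LBINT s:{0<..1}. s powr - \<alpha>) = ennreal (1 / (1 - \<alpha>))"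
    using set_nn_integral_eq_LBINT[OF i] nn_integral_powr_from_0[OF assms] by simp
  moreover have "0 \<le> (LBINT s:{0<..1}. s powr - \<alpha>)"
    unfolding set_lebesgue_integral_def by (intro Bochner_Integration.integral_nonneg) auto
  ultimately show "(LBINT s:{0<..1}. s powr - \<alpha>) = 1 / (1 - \<alpha>)" using assms by simp
qed

lemma LBINT_powr_to_infinity:
  fixes \<alpha> :: real
  assumes "0 < \<alpha>"
  shows "set_integrable lborel {1<..} (\<lambda>s. s powr - (1 + \<alpha>))" "(LBINT s:{1<..}. s powr - (1 + \<alpha>)) = 1 / \<alpha>"
proof -
  have "AE s in lborel. s \<noteq> (1::real)" by (rule AE_lborel_singleton)
  then have eq: "(\<integral>\<^sup>+s\<in>{1<..}. ennreal (s powr - (1 + \<alpha>)) \<partial>lborel) = ennreal (1 / \<alpha>)"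
    using nn_integral_powr_to_infinity[OF assms, of 1]
    by (subst nn_integral_cong_AE[where v = "\<lambda>s. ennreal (s powr - (1 + \<alpha>)) * indicator {1..} s"])
       (auto simp: indicator_def elim!: eventually_mono)
  show i: "set_integrable lborel {1<..} (\<lambda>s. s powr - (1 + \<alpha>))"
    by (rule set_integrableI_nn) (use eq in auto)
  have "ennreal (LBINT s:{1<..}. s powr - (1 + \<alpha>)) = ennreal (1 / \<alpha>)"
    using set_nn_integral_eq_LBINT[OF i] eq by simp
  moreover have "0 \<le> (LBINT s:{1<..}. s powr - (1 + \<alpha>))"
    unfolding set_lebesgue_integral_def by (intro Bochner_Integration.integral_nonneg) auto
  ultimately show "(LBINT s:{1<..}. s powr - (1 + \<alpha>)) = 1 / \<alpha>" using assms by simp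
qed

definition near_part :: "real \<Rightarrow> (real \<Rightarrow> real) \<Rightarrow> real \<Rightarrow> ennreal" where
  "near_part \<alpha> w x = (\<integral>\<^sup>+s\<in>{0<..1}. ennreal \<bar>(w x - w (x - s)) / s powr (1 + \<alpha>)\<bar> \<partial>lborel)"

definition far_part :: "real \<Rightarrow> (real \<Rightarrow> real) \<Rightarrow> real \<Rightarrow> ennreal" where
  "far_part \<alpha> w x = (\<integral>\<^sup>+s\<in>{1<..}. ennreal \<bar>(w x - w (x - s)) / s powr (1 + \<alpha>)\<bar> \<partial>lborel)"

text \<open>Holds without integrability of \<open>h\<close>: if an integral on the right diverges then the bound is infinite, and otherwise
the integral of \<open>h\<close> may be split.\<close>
lemma LBINT_split_approx:
  fixes h k :: "real \<Rightarrow> real"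
  assumes [measurable]: "h \<in> borel_measurable borel" "k \<in> borel_measurable borel" "A \<in> sets borel" "B \<in> sets borel"
    and AB: "A \<inter> B = {}" and k: "set_integrable lborel A k"
  shows "ennreal \<bar>(LBINT s:A \<union> B. h s) - (LBINT s:A. k s)\<bar> \<le>
    (\<integral>\<^sup>+s\<in>A. ennreal \<bar>h s - k s\<bar> \<partial>lborel) + (\<integral>\<^sup>+s\<in>B. ennreal \<bar>h s\<bar> \<partial>lborel)" (is "_ \<le> ?N + ?F")
proof (cases "?N + ?F = top")
  case False
  have d: "set_integrable lborel A (\<lambda>s. h s - k s)" and B: "set_integrable lborel B h"
    by (rule set_integrableI_nn; use False in \<open>auto simp: less_top\<close>)+
  have A: "set_integrable lborel A h" "(LBINT s:A. h s) = (LBINT s:A. h s - k s) + (LBINT s:A. k s)"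
    using set_integral_add[OF d k] by auto
  have "(LBINT s:A \<union> B. h s) - (LBINT s:A. k s) = (LBINT s:A. h s - k s) + (LBINT s:B. h s)"
    using set_integral_Un[OF AB A(1) B] A(2) by simp
  then have "ennreal \<bar>(LBINT s:A \<union> B. h s) - (LBINT s:A. k s)\<bar> \<le> ennreal \<bar>(LBINT s:A. h s - k s)\<bar> + ennreal \<bar>(LBINT s:B. h s)\<bar>"
    by (simp flip: ennreal_plus)
  also have "\<dots> \<le> ?N + ?F" by (intro add_mono abs_LBINT_le)
  finally show ?thesis .
next
  case True
  show ?thesis unfolding True by simp
qed

lemma frac_deriv_approx:
  assumes c: "0 < frac_const \<alpha>"
    and le: "ennreal \<bar>(LBINT s:{0<..}. (w x - w (x - s)) / s powr (1 + \<alpha>)) - d / b\<bar> \<le> R"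
  shows "ennreal \<bar>frac_deriv \<alpha> w x - d\<bar> \<le> ennreal \<bar>(frac_const \<alpha> / b - 1) * d\<bar> + ennreal (frac_const \<alpha>) * R"
proof -
  let ?I = "LBINT s:{0<..}. (w x - w (x - s)) / s powr (1 + \<alpha>)"
  have "frac_deriv \<alpha> w x - d = (frac_const \<alpha> / b - 1) * d + frac_const \<alpha> * (?I - d / b)"
    unfolding frac_deriv_def by (simp add: algebra_simps)
  then have "\<bar>frac_deriv \<alpha> w x - d\<bar> \<le> \<bar>(frac_const \<alpha> / b - 1) * d\<bar> + frac_const \<alpha> * \<bar>?I - d / b\<bar>"
    using c abs_triangle_ineq[of "(frac_const \<alpha> / b - 1) * d" "frac_const \<alpha> * (?I - d / b)"]
    by (simp only: abs_mult[of "frac_const \<alpha>"] abs_of_pos)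
  then have "ennreal \<bar>frac_deriv \<alpha> w x - d\<bar> \<le> ennreal (\<bar>(frac_const \<alpha> / b - 1) * d\<bar> + frac_const \<alpha> * \<bar>?I - d / b\<bar>)"
    by (rule ennreal_leI)
  also have "\<dots> = ennreal \<bar>(frac_const \<alpha> / b - 1) * d\<bar> + ennreal (frac_const \<alpha>) * ennreal \<bar>?I - d / b\<bar>"
    using c by (simp add: ennreal_mult)
  also have "\<dots> \<le> ennreal \<bar>(frac_const \<alpha> / b - 1) * d\<bar> + ennreal (frac_const \<alpha>) * R"
    by (intro add_left_mono mult_left_mono le) auto
  finally show ?thesis .
qed

text \<open>The approximation behind the limit at \<open>\<alpha> = 1\<close>, for an arbitrary candidate \<open>d\<close> for the derivative: near \<open>s = 0\<close> the
integrand is compared with \<open>d s\<^sup>-\<^sup>\<alpha>\<close>, whose integral is \<open>d / (1 - \<alpha>)\<close>.\<close>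
lemma frac_deriv_near_deriv:
  assumes a: "0 < \<alpha>" "\<alpha> < 1" and [measurable]: "w \<in> borel_measurable borel"
  shows "ennreal \<bar>frac_deriv \<alpha> w x - d\<bar> \<le> ennreal \<bar>(frac_const \<alpha> / (1 - \<alpha>) - 1) * d\<bar>
    + ennreal (frac_const \<alpha>) * ((\<integral>\<^sup>+s\<in>{0<..1}. ennreal (s powr - \<alpha>) * ennreal \<bar>(w x - w (x - s)) / s - d\<bar> \<partial>lborel)
        + far_part \<alpha> w x)"
proof (rule frac_deriv_approx[OF frac_const_pos[OF a]])
  let ?h = "\<lambda>s. (w x - w (x - s)) / s powr (1 + \<alpha>)"
  have U: "{0<..} = {0<..1} \<union> {1::real<..}" "{0<..1} \<inter> {1::real<..} = {}" by auto
  have k: "(LBINT s:{0<..1}. d * s powr - \<alpha>) = d / (1 - \<alpha>)" using LBINT_powr_from_0[OF a(2)] by simp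
  have "ennreal \<bar>?h s - d * s powr - \<alpha>\<bar> * indicator {0<..1} s =
      ennreal (s powr - \<alpha>) * ennreal \<bar>(w x - w (x - s)) / s - d\<bar> * indicator {0<..1} s" for s
  proof (cases "s \<in> {0<..1}")
    case True
    have "?h s - d * s powr - \<alpha> = s powr - \<alpha> * ((w x - w (x - s)) / s - d)"
      using True by (simp add: powr_add powr_minus field_simps)
    then show ?thesis by (simp add: abs_mult ennreal_mult)
  qed simp
  then have N: "(\<integral>\<^sup>+s\<in>{0<..1}. ennreal \<bar>?h s - d * s powr - \<alpha>\<bar> \<partial>lborel) =
      (\<integral>\<^sup>+s\<in>{0<..1}. ennreal (s powr - \<alpha>) * ennreal \<bar>(w x - w (x - s)) / s - d\<bar> \<partial>lborel)" by simp
  show "ennreal \<bar>(LBINT s:{0<..}. ?h s) - d / (1 - \<alpha>)\<bar> \<le>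
      (\<integral>\<^sup>+s\<in>{0<..1}. ennreal (s powr - \<alpha>) * ennreal \<bar>(w x - w (x - s)) / s - d\<bar> \<partial>lborel) + far_part \<alpha> w x"
    unfolding U(1) k[symmetric] N[symmetric] far_part_def
    by (rule LBINT_split_approx[OF _ _ _ _ U(2)]) (use LBINT_powr_from_0[OF a(2)] in auto)
qed

text \<open>The corresponding approximation for the limit at \<open>\<alpha> = 0\<close>. Now the part \<open>s > 1\<close> is dominant: in it,
\<open>w(x)\<close> contributes \<open>w(x) / \<alpha>\<close>.\<close>
lemma frac_deriv_near_id:
  assumes a: "0 < \<alpha>" "\<alpha> < 1" and [measurable]: "w \<in> borel_measurable borel"
  shows "ennreal \<bar>frac_deriv \<alpha> w x - w x\<bar> \<le> ennreal \<bar>(frac_const \<alpha> / \<alpha> - 1) * w x\<bar>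
    + ennreal (frac_const \<alpha>) * ((\<integral>\<^sup>+s\<in>{1<..}. ennreal \<bar>w (x - s) * s powr - (1 + \<alpha>)\<bar> \<partial>lborel) + near_part \<alpha> w x)"
proof (rule frac_deriv_approx[OF frac_const_pos[OF a]])
  let ?h = "\<lambda>s. (w x - w (x - s)) / s powr (1 + \<alpha>)"
  have U: "{0<..} = {1<..} \<union> {0::real<..1}" "{1<..} \<inter> {0::real<..1} = {}" by auto
  have k: "(LBINT s:{1<..}. w x * s powr - (1 + \<alpha>)) = w x / \<alpha>" using LBINT_powr_to_infinity[OF a(1)] by simp
  have "ennreal \<bar>?h s - w x * s powr - (1 + \<alpha>)\<bar> * indicator {1<..} s =
      ennreal \<bar>w (x - s) * s powr - (1 + \<alpha>)\<bar> * indicator {1<..} s" for s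
    by (simp add: powr_minus_divide[of s "1 + \<alpha>"] diff_divide_distrib del: minus_add_distrib)
  then have N: "(\<integral>\<^sup>+s\<in>{1<..}. ennreal \<bar>?h s - w x * s powr - (1 + \<alpha>)\<bar> \<partial>lborel) =
      (\<integral>\<^sup>+s\<in>{1<..}. ennreal \<bar>w (x - s) * s powr - (1 + \<alpha>)\<bar> \<partial>lborel)" by simp
  show "ennreal \<bar>(LBINT s:{0<..}. ?h s) - w x / \<alpha>\<bar> \<le>
      (\<integral>\<^sup>+s\<in>{1<..}. ennreal \<bar>w (x - s) * s powr - (1 + \<alpha>)\<bar> \<partial>lborel) + near_part \<alpha> w x"
    unfolding U(1) k[symmetric] N[symmetric] near_part_def
    by (rule LBINT_split_approx[OF _ _ _ _ U(2)]) (use LBINT_powr_to_infinity[OF a(1)] in auto)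
qed

section \<open>Uniform bounds in the weighted norm\<close>

lemma near_part_measurable [measurable]:
  assumes [measurable]: "w \<in> borel_measurable borel"
  shows "near_part \<alpha> w \<in> borel_measurable borel" "far_part \<alpha> w \<in> borel_measurable borel"
  unfolding near_part_def far_part_def by measurable

lemma near_far_split:
  assumes [measurable]: "w \<in> borel_measurable borel"
  shows "(\<integral>\<^sup>+s\<in>{0<..}. ennreal \<bar>(w x - w (x - s)) / s powr (1 + \<alpha>)\<bar> \<partial>lborel) = near_part \<alpha> w x + far_part \<alpha> w x"
  unfolding near_part_def far_part_def
  by (subst nn_integral_add[symmetric]) (auto intro!: nn_integral_cong simp: indicator_def)

lemma abs_frac_deriv_le:
  assumes [measurable]: "w \<in> borel_measurable borel" and a: "0 < \<alpha>" "\<alpha> < 1"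
  shows "ennreal \<bar>frac_deriv \<alpha> w x\<bar> \<le> ennreal (frac_const \<alpha>) * (near_part \<alpha> w x + far_part \<alpha> w x)"
proof -
  have "ennreal \<bar>frac_deriv \<alpha> w x\<bar> = ennreal (frac_const \<alpha>) * ennreal \<bar>(LBINT s:{0<..}. (w x - w (x - s)) / s powr (1 + \<alpha>))\<bar>"
    using frac_const_pos[OF a] by (simp add: frac_deriv_def abs_mult ennreal_mult)
  also have "\<dots> \<le> ennreal (frac_const \<alpha>) * (near_part \<alpha> w x + far_part \<alpha> w x)"
    unfolding near_far_split[OF assms(1), symmetric] by (intro mult_left_mono abs_LBINT_le) auto
  finally show ?thesis .
qed

text \<open>The kernel \<open>s\<^sup>-\<^sup>\<alpha>\<close> on \<open>(0, 1]\<close>. It comes from integrating \<open>s\<^sup>-\<^sup>1\<^sup>-\<^sup>\<alpha>\<close> over the lengths of those intervals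
\<open>[x - s, x]\<close> that contain a given point.\<close>
definition near_kernel :: "real \<Rightarrow> real \<Rightarrow> ennreal" where
  "near_kernel \<alpha> s = ennreal (s powr - \<alpha>) * indicator {..1} s"

lemma near_kernel_measurable [measurable]: "near_kernel \<alpha> \<in> borel_measurable borel"
  unfolding near_kernel_def by measurable

lemma near_kernel_antitone: "0 < \<alpha> \<Longrightarrow> 0 < r \<Longrightarrow> r \<le> s \<Longrightarrow> near_kernel \<alpha> s \<le> near_kernel \<alpha> r"
  unfolding near_kernel_def by (auto simp: indicator_def intro!: ennreal_leI powr_mono2')

lemma near_kernel_mass:
  assumes "\<alpha> < 1" shows "(\<integral>\<^sup>+s\<in>{0<..}. near_kernel \<alpha> s \<partial>lborel) \<le> ennreal (1 / (1 - \<alpha>))"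
  unfolding nn_integral_powr_from_0[OF assms, symmetric]
  by (intro nn_integral_mono) (auto simp: near_kernel_def indicator_def)

lemma antiderivative_borel:
  "antiderivative W f \<Longrightarrow> W \<in> borel_measurable borel" "antiderivative W f \<Longrightarrow> f \<in> borel_measurable borel"
  using borel_measurable_continuous_onI[OF antiderivative_continuous[of W f]] locally_integrable_borel[of f]
  by (auto simp: antiderivative_def)

lemma antiderivative_increment_le:
  assumes W: "antiderivative W f" and s: "0 \<le> s"
  shows "ennreal \<bar>W x - W (x - s)\<bar> \<le> (\<integral>\<^sup>+r\<in>{0..s}. ennreal \<bar>f (x - r)\<bar> \<partial>lborel)"
proof -
  have [measurable]: "f \<in> borel_measurable borel" by (rule antiderivative_borel[OF W])
  have "W x - W (x - s) = (LBINT t:{x - s..x}. f t)" using W s by (simp add: antiderivative_def)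
  then have "ennreal \<bar>W x - W (x - s)\<bar> \<le> (\<integral>\<^sup>+t\<in>{x - s..x - 0}. ennreal \<bar>f t\<bar> \<partial>lborel)"
    using abs_LBINT_le[of "{x - s..x}" f] by simp
  also have "\<dots> = (\<integral>\<^sup>+r\<in>{0..s}. ennreal \<bar>f (x - r)\<bar> \<partial>lborel)"
    by (rule nn_integral_interval_reflect) measurable
  finally show ?thesis .
qed

text \<open>Writing the increment as an integral of \<open>f\<close> and exchanging the integrals, the point \<open>x - r\<close> receives the weight
\<open>\<integral> s\<^sup>-\<^sup>1\<^sup>-\<^sup>\<alpha> ds\<close> over \<open>s \<ge> r\<close>.\<close>
lemma near_part_le:
  assumes W: "antiderivative W f" and a: "0 < \<alpha>"
  shows "near_part \<alpha> W x \<le> ennreal (1 / \<alpha>) * (\<integral>\<^sup>+r\<in>{0<..}. near_kernel \<alpha> r * ennreal \<bar>f (x - r)\<bar> \<partial>lborel)"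
proof -
  note [measurable] = antiderivative_borel[OF W]
  have "near_part \<alpha> W x \<le> (\<integral>\<^sup>+s. (\<integral>\<^sup>+r. ennreal (s powr - (1 + \<alpha>)) * indicator {0<..1} s *
      (ennreal \<bar>f (x - r)\<bar> * indicator {0..s} r) \<partial>lborel) \<partial>lborel)"
    unfolding near_part_def
  proof (rule nn_integral_mono)
    fix s :: real
    show "ennreal \<bar>(W x - W (x - s)) / s powr (1 + \<alpha>)\<bar> * indicator {0<..1} s \<le>
      (\<integral>\<^sup>+r. ennreal (s powr - (1 + \<alpha>)) * indicator {0<..1} s * (ennreal \<bar>f (x - r)\<bar> * indicator {0..s} r) \<partial>lborel)"
    proof (cases "s \<in> {0<..1}")
      case True
      have "\<bar>(W x - W (x - s)) / s powr (1 + \<alpha>)\<bar> = s powr - (1 + \<alpha>) * \<bar>W x - W (x - s)\<bar>"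
        by (subst powr_minus_divide) simp
      then have "ennreal \<bar>(W x - W (x - s)) / s powr (1 + \<alpha>)\<bar> = ennreal (s powr - (1 + \<alpha>)) * ennreal \<bar>W x - W (x - s)\<bar>"
        by (simp only: ennreal_mult[OF powr_ge_zero abs_ge_zero])
      also have "\<dots> \<le> ennreal (s powr - (1 + \<alpha>)) * (\<integral>\<^sup>+r\<in>{0..s}. ennreal \<bar>f (x - r)\<bar> \<partial>lborel)"
        using True by (intro mult_left_mono antiderivative_increment_le[OF W]) auto
      finally show ?thesis using True by (simp add: nn_integral_cmult)
    qed simp
  qed
  also have "\<dots> = (\<integral>\<^sup>+r. (\<integral>\<^sup>+s. ennreal (s powr - (1 + \<alpha>)) * indicator {0<..1} s *
      (ennreal \<bar>f (x - r)\<bar> * indicator {0..s} r) \<partial>lborel) \<partial>lborel)"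
    by (subst lborel_pair.Fubini') auto
  also have "\<dots> \<le> (\<integral>\<^sup>+r. ennreal (1 / \<alpha>) * (near_kernel \<alpha> r * ennreal \<bar>f (x - r)\<bar> * indicator {0<..} r) \<partial>lborel)"
  proof (rule nn_integral_mono_AE)
    have "AE r in lborel. r \<noteq> (0::real)" by (rule AE_lborel_singleton)
    then show "AE r in lborel. (\<integral>\<^sup>+s. ennreal (s powr - (1 + \<alpha>)) * indicator {0<..1} s *
      (ennreal \<bar>f (x - r)\<bar> * indicator {0..s} r) \<partial>lborel) \<le> ennreal (1 / \<alpha>) * (near_kernel \<alpha> r * ennreal \<bar>f (x - r)\<bar> * indicator {0<..} r)"
    proof eventually_elim
      case (elim r)
      show ?case
      proof (cases "0 < r \<and> r \<le> 1")
        case True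
        have "(\<integral>\<^sup>+s. ennreal (s powr - (1 + \<alpha>)) * indicator {0<..1} s * (ennreal \<bar>f (x - r)\<bar> * indicator {0..s} r) \<partial>lborel) \<le>
          (\<integral>\<^sup>+s. ennreal \<bar>f (x - r)\<bar> * (ennreal (s powr - (1 + \<alpha>)) * indicator {r..} s) \<partial>lborel)"
          by (intro nn_integral_mono) (auto simp: indicator_def mult.commute)
        also have "\<dots> = ennreal \<bar>f (x - r)\<bar> * ennreal (r powr - \<alpha> / \<alpha>)"
          using nn_integral_powr_to_infinity[OF a, of r] True by (subst nn_integral_cmult) auto
        also have "\<dots> = ennreal (1 / \<alpha>) * (near_kernel \<alpha> r * ennreal \<bar>f (x - r)\<bar> * indicator {0<..} r)"
          using True a by (simp add: near_kernel_def mult.commute flip: ennreal_mult)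
        finally show ?thesis .
      next
        case False
        then have z: "ennreal (s powr - (1 + \<alpha>)) * indicator {0<..1} s * (ennreal \<bar>f (x - r)\<bar> * indicator {0..s} r) = 0" for s
          using elim by (auto simp: indicator_def)
        show ?thesis unfolding z by simp
      qed
    qed
  qed
  also have "\<dots> = ennreal (1 / \<alpha>) * (\<integral>\<^sup>+r\<in>{0<..}. near_kernel \<alpha> r * ennreal \<bar>f (x - r)\<bar> \<partial>lborel)"
    by (intro nn_integral_cmult) measurable
  finally show ?thesis .
qed

lemma far_part_le:
  assumes [measurable]: "w \<in> borel_measurable borel" and a: "0 < \<alpha>"
  shows "far_part \<alpha> w x \<le> ennreal (1 / \<alpha>) * ennreal \<bar>w x\<bar> +
    (\<integral>\<^sup>+s\<in>{0<..}. tail_kernel \<alpha> s * ennreal \<bar>w (x - s)\<bar> \<partial>lborel)"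
proof -
  have "far_part \<alpha> w x \<le> (\<integral>\<^sup>+s. ennreal \<bar>w x\<bar> * (ennreal (s powr - (1 + \<alpha>)) * indicator {1..} s) +
       tail_kernel \<alpha> s * ennreal \<bar>w (x - s)\<bar> * indicator {0<..} s \<partial>lborel)"
    unfolding far_part_def
  proof (rule nn_integral_mono)
    fix s :: real
    show "ennreal \<bar>(w x - w (x - s)) / s powr (1 + \<alpha>)\<bar> * indicator {1<..} s \<le>
      ennreal \<bar>w x\<bar> * (ennreal (s powr - (1 + \<alpha>)) * indicator {1..} s) +
       tail_kernel \<alpha> s * ennreal \<bar>w (x - s)\<bar> * indicator {0<..} s"
    proof (cases "1 < s")
      case True
      have "s powr - (1 + \<alpha>) \<le> 1 powr - (1 + \<alpha>)" using True a by (intro powr_mono2') auto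
      then have k: "tail_kernel \<alpha> s = ennreal (s powr - (1 + \<alpha>))" by (simp add: tail_kernel_def min_def)
      have "\<bar>(w x - w (x - s)) / s powr (1 + \<alpha>)\<bar> = s powr - (1 + \<alpha>) * \<bar>w x - w (x - s)\<bar>"
        by (subst powr_minus_divide) simp
      also have "\<dots> \<le> s powr - (1 + \<alpha>) * (\<bar>w x\<bar> + \<bar>w (x - s)\<bar>)"
        by (intro mult_left_mono) auto
      finally have "ennreal \<bar>(w x - w (x - s)) / s powr (1 + \<alpha>)\<bar> \<le> ennreal (s powr - (1 + \<alpha>) * (\<bar>w x\<bar> + \<bar>w (x - s)\<bar>))"
        by (rule ennreal_leI)
      also have "\<dots> = ennreal \<bar>w x\<bar> * ennreal (s powr - (1 + \<alpha>)) + ennreal (s powr - (1 + \<alpha>)) * ennreal \<bar>w (x - s)\<bar>"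
        by (simp add: distrib_left mult.commute ennreal_mult del: minus_add_distrib)
      finally show ?thesis using True k by simp
    qed simp
  qed
  also have "\<dots> = ennreal (1 / \<alpha>) * ennreal \<bar>w x\<bar> +
    (\<integral>\<^sup>+s\<in>{0<..}. tail_kernel \<alpha> s * ennreal \<bar>w (x - s)\<bar> \<partial>lborel)"
    using nn_integral_powr_to_infinity[OF a, of 1]
    by (subst nn_integral_add) (auto simp: nn_integral_cmult mult.commute)
  finally show ?thesis .
qed

context one_sided_weight begin

text \<open>Contributions of \<open>W(x)\<close> and of the convolution of \<open>W\<close> with the tail kernel, which has mass at most \<open>2 / \<alpha>\<close>.\<close>
definition farC :: real where "farC = 2 powr p * (1 + convC * 2 powr p)"

lemma farC_pos: "0 < farC" using convC_pos by (simp add: farC_def add_pos_pos)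

lemma wint_near_part:
  assumes W: "antiderivative W f" and a: "0 < \<alpha>" "\<alpha> < 1"
  shows "wint (near_part \<alpha> W) \<le> ennreal (convC * (1 / (\<alpha> * (1 - \<alpha>))) powr p) * wint (\<lambda>x. ennreal \<bar>f x\<bar>)"
proof -
  note [measurable] = antiderivative_borel[OF W]
  have "wint (near_part \<alpha> W) \<le> wint (\<lambda>x. ennreal (1 / \<alpha>) * (\<integral>\<^sup>+r\<in>{0<..}. near_kernel \<alpha> r * ennreal \<bar>f (x - r)\<bar> \<partial>lborel))"
    by (intro wint_mono near_part_le[OF W a(1)])
  also have "\<dots> = ennreal ((1 / \<alpha>) powr p) * wint (\<lambda>x. \<integral>\<^sup>+r\<in>{0<..}. near_kernel \<alpha> r * ennreal \<bar>f (x - r)\<bar> \<partial>lborel)"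
    using a by (subst wint_cmult) (auto simp: epow_ennreal)
  also have "\<dots> \<le> ennreal ((1 / \<alpha>) powr p) * (ennreal (convC * (1 / (1 - \<alpha>)) powr p) * wint (\<lambda>x. ennreal \<bar>f x\<bar>))"
    using a by (intro mult_left_mono wint_antitone_convolution near_kernel_mass near_kernel_antitone) auto
  also have "\<dots> = ennreal (convC * (1 / (\<alpha> * (1 - \<alpha>))) powr p) * wint (\<lambda>x. ennreal \<bar>f x\<bar>)"
    using a convC_pos by (simp add: ennreal_mult_collapse powr_divide powr_mult)
  finally show ?thesis .
qed

lemma wint_far_part:
  assumes [measurable]: "w \<in> borel_measurable borel" and a: "0 < \<alpha>" "\<alpha> < 1"
  shows "wint (far_part \<alpha> w) \<le> ennreal (farC * (1 / \<alpha>) powr p) * wint (\<lambda>x. ennreal \<bar>w x\<bar>)"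
proof -
  let ?w = "wint (\<lambda>x. ennreal \<bar>w x\<bar>)"
  have m: "(\<integral>\<^sup>+s\<in>{0<..}. tail_kernel \<alpha> s \<partial>lborel) \<le> ennreal (2 * (1 / \<alpha>))"
    using tail_kernel_mass[OF a(1)] by (rule order_trans) (use a in \<open>auto intro!: ennreal_leI simp: field_simps\<close>)
  have "wint (far_part \<alpha> w) \<le> wint (\<lambda>x. ennreal (1 / \<alpha>) * ennreal \<bar>w x\<bar> +
    (\<integral>\<^sup>+s\<in>{0<..}. tail_kernel \<alpha> s * ennreal \<bar>w (x - s)\<bar> \<partial>lborel))"
    using a by (intro wint_mono far_part_le) auto
  also have "\<dots> \<le> ennreal (2 powr p) * (wint (\<lambda>x. ennreal (1 / \<alpha>) * ennreal \<bar>w x\<bar>) +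
      wint (\<lambda>x. \<integral>\<^sup>+s\<in>{0<..}. tail_kernel \<alpha> s * ennreal \<bar>w (x - s)\<bar> \<partial>lborel))"
    by (intro wint_add_le) measurable
  also have "\<dots> \<le> ennreal (2 powr p) * (ennreal ((1 / \<alpha>) powr p) * ?w + ennreal (convC * (2 * (1 / \<alpha>)) powr p) * ?w)"
    using a m by (intro mult_left_mono add_mono wint_antitone_convolution tail_kernel_antitone)
       (auto simp: wint_cmult epow_ennreal)
  also have "\<dots> = ennreal (2 powr p * ((1 / \<alpha>) powr p + convC * (2 * (1 / \<alpha>)) powr p)) * ?w"
    using a convC_pos by (simp add: ennreal_mult_collapse flip: distrib_right ennreal_plus)
  also have "2 powr p * ((1 / \<alpha>) powr p + convC * (2 * (1 / \<alpha>)) powr p) = farC * (1 / \<alpha>) powr p"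
    using a unfolding farC_def powr_mult by (simp add: algebra_simps)
  finally show ?thesis .
qed

text \<open>The singular factors \<open>1 / (\<alpha> (1 - \<alpha>))\<close> and \<open>1 / \<alpha>\<close> of the two parts are absorbed by \<open>c\<^sub>\<alpha>\<close>, so the constant does
not depend on \<open>\<alpha>\<close>. The estimate is for the integral of the absolute value, which also yields absolute convergence
almost everywhere.\<close>
theorem wint_frac_deriv_uniform:
  "\<exists>D>0. \<forall>W f \<alpha>. antiderivative W f \<longrightarrow> 0 < \<alpha> \<longrightarrow> \<alpha> < 1 \<longrightarrow>
     wint (\<lambda>x. ennreal (frac_const \<alpha>) * (near_part \<alpha> W x + far_part \<alpha> W x)) \<le>
       ennreal D * (wint (\<lambda>x. ennreal \<bar>W x\<bar>) + wint (\<lambda>x. ennreal \<bar>f x\<bar>))"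
proof -
  obtain G where G: "0 < G" "\<And>\<alpha>. 0 < \<alpha> \<Longrightarrow> \<alpha> < 1 \<Longrightarrow> frac_const \<alpha> \<le> G * (\<alpha> * (1 - \<alpha>))"
    using frac_const_bound by blast
  let ?D = "2 powr p * G powr p * (convC + farC)"
  have "wint (\<lambda>x. ennreal (frac_const \<alpha>) * (near_part \<alpha> W x + far_part \<alpha> W x)) \<le>
       ennreal ?D * (wint (\<lambda>x. ennreal \<bar>W x\<bar>) + wint (\<lambda>x. ennreal \<bar>f x\<bar>))"
    if W: "antiderivative W f" and a: "0 < \<alpha>" "\<alpha> < 1" for W f \<alpha>
  proof -
    note [measurable] = antiderivative_borel[OF W]
    let ?W = "wint (\<lambda>x. ennreal \<bar>W x\<bar>)" and ?f = "wint (\<lambda>x. ennreal \<bar>f x\<bar>)" and ?c = "frac_const \<alpha>"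
    have c: "0 < ?c" by (rule frac_const_pos[OF a])
    have c1: "?c powr p * (1 / (\<alpha> * (1 - \<alpha>))) powr p \<le> G powr p"
    proof -
      have "(?c * (1 / (\<alpha> * (1 - \<alpha>)))) powr p \<le> G powr p"
        using G(2)[OF a] a c p by (intro powr_mono2) (auto simp: divide_le_eq)
      then show ?thesis using a c by (simp add: powr_mult powr_divide)
    qed
    have c2: "?c powr p * (1 / \<alpha>) powr p \<le> G powr p"
    proof -
      have "?c powr p * (1 / \<alpha>) powr p \<le> ?c powr p * (1 / (\<alpha> * (1 - \<alpha>))) powr p"
        using a p by (intro mult_left_mono powr_mono2) (auto simp: field_simps)
      with c1 show ?thesis by linarith
    qed
    have "wint (\<lambda>x. ennreal ?c * (near_part \<alpha> W x + far_part \<alpha> W x)) =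
      ennreal (?c powr p) * wint (\<lambda>x. near_part \<alpha> W x + far_part \<alpha> W x)"
      using c by (subst wint_cmult) (auto simp: epow_ennreal)
    also have "\<dots> \<le> ennreal (?c powr p) * (ennreal (2 powr p) * (ennreal (convC * (1 / (\<alpha> * (1 - \<alpha>))) powr p) * ?f +
        ennreal (farC * (1 / \<alpha>) powr p) * ?W))"
      by (intro mult_left_mono order_trans[OF wint_add_le] add_mono wint_near_part[OF W a] wint_far_part a) auto
    also have "\<dots> = ennreal (2 powr p) * (ennreal (convC * (?c powr p * (1 / (\<alpha> * (1 - \<alpha>))) powr p)) * ?f +
        ennreal (farC * (?c powr p * (1 / \<alpha>) powr p)) * ?W)"
      using a convC_pos farC_pos
      by (simp add: ennreal_mult_collapse distrib_left) (simp add: mult_ac)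
    also have "\<dots> \<le> ennreal (2 powr p) * (ennreal ((convC + farC) * G powr p) * ?f + ennreal ((convC + farC) * G powr p) * ?W)"
      using c1 c2 convC_pos farC_pos
      by (intro mult_left_mono add_mono mult_right_mono ennreal_leI mult_mono) auto
    also have "\<dots> = ennreal (2 powr p * ((convC + farC) * G powr p)) * (?W + ?f)"
    proof -
      have "ennreal (2 powr p) * (ennreal B * ?f + ennreal B * ?W) = ennreal (2 powr p * B) * (?W + ?f)"
        if "0 \<le> B" for B
        using that by (simp add: ennreal_mult_collapse distrib_left add.commute)
      then show ?thesis using convC_pos farC_pos by simp
    qed
    also have "2 powr p * ((convC + farC) * G powr p) = ?D" by (simp add: mult_ac)
    finally show ?thesis .
  qed
  moreover have "0 < ?D" using G convC_pos farC_pos by (simp add: add_pos_pos)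
  ultimately show ?thesis by blast
qed

end

section \<open>Limits of the fractional derivative almost everywhere\<close>

lemma far_part_antimono:
  assumes "0 < \<alpha>" "\<alpha> \<le> \<beta>" shows "far_part \<beta> w x \<le> far_part \<alpha> w x"
  unfolding far_part_def
proof (rule nn_integral_mono)
  fix s :: real
  show "ennreal \<bar>(w x - w (x - s)) / s powr (1 + \<beta>)\<bar> * indicator {1<..} s \<le> ennreal \<bar>(w x - w (x - s)) / s powr (1 + \<alpha>)\<bar> * indicator {1<..} s"
    using assms by (auto simp: indicator_def abs_divide intro!: ennreal_leI divide_left_mono powr_mono)
qed

lemma near_part_mono:
  assumes "0 < \<alpha>" "\<alpha> \<le> \<beta>" shows "near_part \<alpha> w x \<le> near_part \<beta> w x"
  unfolding near_part_def
proof (rule nn_integral_mono)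
  fix s :: real
  show "ennreal \<bar>(w x - w (x - s)) / s powr (1 + \<alpha>)\<bar> * indicator {0<..1} s \<le> ennreal \<bar>(w x - w (x - s)) / s powr (1 + \<beta>)\<bar> * indicator {0<..1} s"
    using assms by (auto simp: indicator_def abs_divide intro!: ennreal_leI divide_left_mono powr_mono')
qed

lemma frac_const_tendsto_0_at_1: "(frac_const \<longlongrightarrow> 0) (at_left 1)"
proof -
  have "((\<lambda>\<alpha>. frac_const \<alpha> / (1 - \<alpha>) * (1 - \<alpha>)) \<longlongrightarrow> 1 * (1 - 1)) (at_left (1::real))"
    by (intro tendsto_intros frac_const_tendsto_1)
  moreover have "\<forall>\<^sub>F \<alpha> in at_left (1::real). frac_const \<alpha> / (1 - \<alpha>) * (1 - \<alpha>) = frac_const \<alpha>"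
    by (auto simp: eventually_at_filter)
  ultimately show ?thesis by (auto intro: Lim_transform_eventually)
qed

lemma eventually_at_left_1: "\<forall>\<^sub>F \<alpha> in at_left (1::real). 1/2 \<le> \<alpha> \<and> \<alpha> < 1"
  using eventually_at_left_real[of "1/2" 1] by (auto elim: eventually_mono)

lemma eventually_at_right_0: "\<forall>\<^sub>F \<alpha> in at_right (0::real). 0 < \<alpha> \<and> \<alpha> \<le> 1/2"
  using eventually_at_right_real[of 0 "1/2"] by (auto elim: eventually_mono)

lemma tendsto_of_ennreal_abs_diff:
  fixes f :: "'a \<Rightarrow> real"
  assumes "((\<lambda>\<alpha>. ennreal \<bar>f \<alpha> - d\<bar>) \<longlongrightarrow> 0) F" shows "(f \<longlongrightarrow> d) F"
proof -
  have "((\<lambda>\<alpha>. \<bar>f \<alpha> - d\<bar>) \<longlongrightarrow> 0) F" using tendsto_ennreal_iff[of "\<lambda>\<alpha>. \<bar>f \<alpha> - d\<bar>" F 0] assms by simp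
  then show ?thesis by (simp add: tendsto_rabs_zero_iff LIM_zero_iff)
qed

text \<open>Stated for continuous functions and their left derivative at one point, in order to cover both antiderivatives at
Lebesgue points and reflected test functions at every point.\<close>
theorem frac_deriv_tendsto_deriv:
  assumes c: "continuous_on UNIV w" and q: "((\<lambda>s. (w x - w (x - s)) / s) \<longlongrightarrow> d) (at_right 0)"
    and far: "far_part (1/2) w x < top"
  shows "((\<lambda>\<alpha>. frac_deriv \<alpha> w x) \<longlongrightarrow> d) (at_left 1)"
proof (rule tendsto_of_ennreal_abs_diff)
  have [measurable]: "w \<in> borel_measurable borel" using c by (rule borel_measurable_continuous_onI)
  let ?q = "\<lambda>s. ennreal \<bar>(w x - w (x - s)) / s - d\<bar>"
  let ?N = "\<lambda>\<alpha>. ennreal (1 - \<alpha>) * (\<integral>\<^sup>+s\<in>{0<..1}. ennreal (s powr - \<alpha>) * ?q s \<partial>lborel)"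
  have N: "(?N \<longlongrightarrow> 0) (at_left 1)"
  proof (rule powr_concentration)
    have "((\<lambda>s. \<bar>(w x - w (x - s)) / s - d\<bar>) \<longlongrightarrow> \<bar>d - d\<bar>) (at_right 0)"
      by (intro tendsto_intros q)
    from tendsto_ennrealI[OF this] show "(?q \<longlongrightarrow> 0) (at_right 0)" by simp
    fix \<delta> :: real assume d: "0 < \<delta>"
    have "continuous_on {\<delta>..1} (\<lambda>s. \<bar>(w x - w (x - s)) / s - d\<bar>)"
      using d by (auto intro!: continuous_intros continuous_on_compose2[OF c])
    then have "bounded ((\<lambda>s. \<bar>(w x - w (x - s)) / s - d\<bar>) ` {\<delta>..1})"
      by (intro compact_imp_bounded compact_continuous_image compact_Icc)
    then obtain B where B: "\<forall>s\<in>{\<delta>..1}. \<bar>(w x - w (x - s)) / s - d\<bar> \<le> B"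
      unfolding bounded_iff by auto
    have "(\<integral>\<^sup>+s\<in>{\<delta>..1}. ?q s \<partial>lborel) \<le> (\<integral>\<^sup>+s. ennreal B * indicator {\<delta>..1} s \<partial>lborel)"
      using B by (intro nn_integral_mono) (auto simp: indicator_def intro!: ennreal_leI)
    also have "\<dots> < top" by (simp add: nn_integral_cmult_indicator ennreal_mult_less_top emeasure_lborel_Icc_eq)
    finally show "(\<integral>\<^sup>+s\<in>{\<delta>..1}. ?q s \<partial>lborel) < top" .
  qed measurable
  let ?b = "\<lambda>\<alpha>. ennreal \<bar>(frac_const \<alpha> / (1 - \<alpha>) - 1) * d\<bar> + (2 * ?N \<alpha> + far_part (1/2) w x * ennreal (frac_const \<alpha>))"
  have b: "(?b \<longlongrightarrow> ennreal \<bar>(1 - 1) * d\<bar> + (2 * 0 + far_part (1/2) w x * ennreal 0)) (at_left 1)"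
    using far by (intro tendsto_add tendsto_ennrealI ennreal_tendsto_cmult tendsto_intros
         frac_const_tendsto_1 frac_const_tendsto_0_at_1 N) auto
  have "\<forall>\<^sub>F \<alpha> in at_left 1. frac_const \<alpha> / (1 - \<alpha>) < 2"
    by (rule order_tendstoD(2)[OF frac_const_tendsto_1]) simp
  with eventually_at_left_1
  have "\<forall>\<^sub>F \<alpha> in at_left 1. ennreal \<bar>frac_deriv \<alpha> w x - d\<bar> \<le> ?b \<alpha>"
  proof eventually_elim
    case (elim \<alpha>)
    then have a: "0 < \<alpha>" "\<alpha> < 1" by auto
    have c0: "0 < frac_const \<alpha>" by (rule frac_const_pos[OF a])
    let ?I = "\<integral>\<^sup>+s\<in>{0<..1}. ennreal (s powr - \<alpha>) * ?q s \<partial>lborel"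
    have "ennreal \<bar>frac_deriv \<alpha> w x - d\<bar> \<le> ennreal \<bar>(frac_const \<alpha> / (1 - \<alpha>) - 1) * d\<bar> + ennreal (frac_const \<alpha>) * (?I + far_part \<alpha> w x)"
      by (rule frac_deriv_near_deriv[OF a]) measurable
    also have "ennreal (frac_const \<alpha>) * (?I + far_part \<alpha> w x) \<le> 2 * ?N \<alpha> + far_part (1/2) w x * ennreal (frac_const \<alpha>)"
    proof -
      have "ennreal (frac_const \<alpha>) * ?I = ennreal (frac_const \<alpha> / (1 - \<alpha>)) * ?N \<alpha>"
        using a c0 by (simp add: ennreal_mult_collapse)
      also have "\<dots> \<le> ennreal 2 * ?N \<alpha>" using elim by (intro mult_right_mono ennreal_leI) auto
      finally have "ennreal (frac_const \<alpha>) * ?I \<le> 2 * ?N \<alpha>" by simp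
      moreover have "ennreal (frac_const \<alpha>) * far_part \<alpha> w x \<le> far_part (1/2) w x * ennreal (frac_const \<alpha>)"
        using elim by (subst mult.commute) (intro mult_right_mono far_part_antimono, auto)
      ultimately show ?thesis by (simp add: distrib_left add_mono)
    qed
    finally show ?case by (simp add: add_left_mono)
  qed
  then show "((\<lambda>\<alpha>. ennreal \<bar>frac_deriv \<alpha> w x - d\<bar>) \<longlongrightarrow> 0) (at_left 1)"
    by (rule tendsto_sandwich[OF always_eventually _ tendsto_const, rotated]) (use b in auto)
qed

text \<open>The hypothesis on the tail says that \<open>\<alpha> s\<^sup>-\<^sup>1\<^sup>-\<^sup>\<alpha> ds\<close> sees only the behaviour of \<open>w\<close> near minus infinity: the
contribution of any bounded range of \<open>s\<close> is multiplied by \<open>c\<^sub>\<alpha>\<close>, which tends to \<open>0\<close>.\<close>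
theorem frac_deriv_tendsto_id:
  assumes c: "continuous_on UNIV w" and near: "near_part (1/2) w x < top"
    and tail: "\<And>e. 0 < e \<Longrightarrow> \<exists>N\<ge>1. \<forall>\<alpha>>0. (\<integral>\<^sup>+s\<in>{N<..}. ennreal \<bar>w (x - s) * s powr - (1 + \<alpha>)\<bar> \<partial>lborel) \<le> ennreal (e * (1 + 1 / \<alpha>))"
  shows "((\<lambda>\<alpha>. frac_deriv \<alpha> w x) \<longlongrightarrow> w x) (at_right 0)"
proof (rule tendsto_of_ennreal_abs_diff, rule tendsto_zero_ennreal)
  fix r :: real assume r: "0 < r"
  have [measurable]: "w \<in> borel_measurable borel" using c by (rule borel_measurable_continuous_onI)
  obtain N where N: "1 \<le> N" "\<And>\<alpha>. 0 < \<alpha> \<Longrightarrow> (\<integral>\<^sup>+s\<in>{N<..}. ennreal \<bar>w (x - s) * s powr - (1 + \<alpha>)\<bar> \<partial>lborel) \<le> ennreal (r / 8 * (1 + 1 / \<alpha>))"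
    using tail[of "r / 8"] r by auto
  define A where "A = near_part (1/2) w x + (\<integral>\<^sup>+s\<in>{0..N}. ennreal \<bar>w (x - s)\<bar> \<partial>lborel)"
  have A: "A < top"
  proof -
    have "(\<integral>\<^sup>+s\<in>{0..N}. ennreal \<bar>w (x - s)\<bar> \<partial>lborel) < top"
    proof -
      have "bounded ((\<lambda>s. \<bar>w (x - s)\<bar>) ` {0..N})"
        by (intro compact_imp_bounded compact_continuous_image compact_Icc)
           (auto intro!: continuous_intros continuous_on_compose2[OF c])
      then obtain B where B: "\<forall>s\<in>{0..N}. \<bar>w (x - s)\<bar> \<le> B" unfolding bounded_iff by auto
      have "(\<integral>\<^sup>+s\<in>{0..N}. ennreal \<bar>w (x - s)\<bar> \<partial>lborel) \<le> (\<integral>\<^sup>+s. ennreal B * indicator {0..N} s \<partial>lborel)"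
        using B by (intro nn_integral_mono) (auto simp: indicator_def intro!: ennreal_leI)
      also have "\<dots> < top" by (simp add: nn_integral_cmult_indicator ennreal_mult_less_top emeasure_lborel_Icc_eq)
      finally show ?thesis .
    qed
    then show ?thesis using near by (simp add: A_def)
  qed
  have fc0: "((\<lambda>\<alpha>. frac_const \<alpha> / \<alpha> * \<alpha>) \<longlongrightarrow> 1 * 0) (at_right 0)"
    by (intro tendsto_intros frac_const_tendsto_0)
  have "((\<lambda>\<alpha>. A * ennreal (frac_const \<alpha> / \<alpha> * \<alpha>)) \<longlongrightarrow> A * ennreal (1 * 0)) (at_right 0)"
    by (intro ennreal_tendsto_cmult tendsto_ennrealI fc0 A)
  then have e1: "\<forall>\<^sub>F \<alpha> in at_right 0. A * ennreal (frac_const \<alpha> / \<alpha> * \<alpha>) < ennreal (r / 4)"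
    by (rule order_tendstoD(2)) (use r in simp)
  have "((\<lambda>\<alpha>. \<bar>(frac_const \<alpha> / \<alpha> - 1) * w x\<bar>) \<longlongrightarrow> \<bar>(1 - 1) * w x\<bar>) (at_right 0)"
    by (intro tendsto_intros frac_const_tendsto_0)
  then have e2: "\<forall>\<^sub>F \<alpha> in at_right 0. \<bar>(frac_const \<alpha> / \<alpha> - 1) * w x\<bar> < r / 4"
    by (rule order_tendstoD(2)) (use r in simp)
  have "((\<lambda>\<alpha>. frac_const \<alpha> / \<alpha> * \<alpha> + frac_const \<alpha> / \<alpha>) \<longlongrightarrow> 1 * 0 + 1) (at_right 0)"
    by (intro tendsto_add fc0 frac_const_tendsto_0)
  then have e3: "\<forall>\<^sub>F \<alpha> in at_right 0. frac_const \<alpha> / \<alpha> * \<alpha> + frac_const \<alpha> / \<alpha> < 2"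
    by (rule order_tendstoD(2)) simp
  from eventually_at_right_0 e1 e2 e3
  show "\<forall>\<^sub>F \<alpha> in at_right 0. ennreal \<bar>frac_deriv \<alpha> w x - w x\<bar> < ennreal r"
  proof eventually_elim
    case (elim \<alpha>)
    then have a: "0 < \<alpha>" "\<alpha> < 1" by auto
    have c0: "0 < frac_const \<alpha>" by (rule frac_const_pos[OF a])
    let ?T = "\<integral>\<^sup>+s\<in>{N<..}. ennreal \<bar>w (x - s) * s powr - (1 + \<alpha>)\<bar> \<partial>lborel"
    have "(\<integral>\<^sup>+s\<in>{1<..}. ennreal \<bar>w (x - s) * s powr - (1 + \<alpha>)\<bar> \<partial>lborel) \<le>
       (\<integral>\<^sup>+s. ennreal \<bar>w (x - s)\<bar> * indicator {0..N} s + ennreal \<bar>w (x - s) * s powr - (1 + \<alpha>)\<bar> * indicator {N<..} s \<partial>lborel)"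
    proof (rule nn_integral_mono)
      fix s :: real
      have "\<bar>w (x - s) * s powr - (1 + \<alpha>)\<bar> \<le> \<bar>w (x - s)\<bar>" if "1 < s"
      proof -
        have "s powr - (1 + \<alpha>) \<le> 1 powr - (1 + \<alpha>)" using that a by (intro powr_mono2') auto
        then show ?thesis by (simp add: abs_mult mult_left_le del: minus_add_distrib)
      qed
      then show "ennreal \<bar>w (x - s) * s powr - (1 + \<alpha>)\<bar> * indicator {1<..} s \<le>
        ennreal \<bar>w (x - s)\<bar> * indicator {0..N} s + ennreal \<bar>w (x - s) * s powr - (1 + \<alpha>)\<bar> * indicator {N<..} s"
        using N(1) by (auto simp: indicator_def intro!: ennreal_leI)
    qed
    also have "\<dots> = (\<integral>\<^sup>+s\<in>{0..N}. ennreal \<bar>w (x - s)\<bar> \<partial>lborel) + ?T"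
      by (intro nn_integral_add) measurable
    finally have F: "(\<integral>\<^sup>+s\<in>{1<..}. ennreal \<bar>w (x - s) * s powr - (1 + \<alpha>)\<bar> \<partial>lborel) \<le> \<dots>" .
    have nm: "near_part \<alpha> w x \<le> near_part (1/2) w x" using elim by (intro near_part_mono) auto
    have "ennreal \<bar>frac_deriv \<alpha> w x - w x\<bar> \<le> ennreal \<bar>(frac_const \<alpha> / \<alpha> - 1) * w x\<bar> + ennreal (frac_const \<alpha>) *
       ((\<integral>\<^sup>+s\<in>{1<..}. ennreal \<bar>w (x - s) * s powr - (1 + \<alpha>)\<bar> \<partial>lborel) + near_part \<alpha> w x)"
      by (rule frac_deriv_near_id[OF a]) measurable
    also have "\<dots> \<le> ennreal \<bar>(frac_const \<alpha> / \<alpha> - 1) * w x\<bar> + ennreal (frac_const \<alpha>) *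
       (((\<integral>\<^sup>+s\<in>{0..N}. ennreal \<bar>w (x - s)\<bar> \<partial>lborel) + ?T) + near_part (1/2) w x)"
      by (intro add_mono order_refl mult_left_mono nm F) auto
    also have "\<dots> = ennreal \<bar>(frac_const \<alpha> / \<alpha> - 1) * w x\<bar> + (A * ennreal (frac_const \<alpha> / \<alpha> * \<alpha>) + ennreal (frac_const \<alpha>) * ?T)"
      using a by (simp add: A_def distrib_left distrib_right mult.commute add_ac)
    also have "\<dots> \<le> ennreal (r / 4) + (ennreal (r / 4) + ennreal (r / 4))"
    proof (intro add_mono)
      show "ennreal \<bar>(frac_const \<alpha> / \<alpha> - 1) * w x\<bar> \<le> ennreal (r / 4)"
        using elim by (intro ennreal_leI) auto
      show "A * ennreal (frac_const \<alpha> / \<alpha> * \<alpha>) \<le> ennreal (r / 4)" using elim by auto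
      have "ennreal (frac_const \<alpha>) * ?T \<le> ennreal (frac_const \<alpha>) * ennreal (r / 8 * (1 + 1 / \<alpha>))"
        using N(2)[OF a(1)] by (intro mult_left_mono) auto
      also have "\<dots> = ennreal (r / 8 * (frac_const \<alpha> / \<alpha> * \<alpha> + frac_const \<alpha> / \<alpha>))"
        using a c0 r by (simp flip: ennreal_mult) (simp add: field_simps)
      also have "\<dots> \<le> ennreal (r / 4)"
        using elim mult_left_mono[of "frac_const \<alpha> / \<alpha> * \<alpha> + frac_const \<alpha> / \<alpha>" 2 "r / 8"] r
        by (intro ennreal_leI) auto
      finally show "ennreal (frac_const \<alpha>) * ?T \<le> ennreal (r / 4)" .
    qed
    also have "\<dots> = ennreal (3 * r / 4)" using r by (simp flip: ennreal_plus)
    also have "\<dots> < ennreal r" using r by (intro ennreal_lessI) auto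
    finally show ?case .
  qed
qed

context one_sided_weight begin

lemma mass_right_pos:
  assumes "0 < h" shows "0 < (\<integral>\<^sup>+y\<in>{x..x + h}. ennreal (\<omega> y) \<partial>lborel)"
proof (rule ccontr)
  assume "\<not> ?thesis"
  then have "AE y in lborel. ennreal (\<omega> y) * indicator {x..x + h} y = 0"
    by (subst nn_integral_0_iff_AE[symmetric]) (auto simp: not_less)
  with pos_w have "AE y in lborel. y \<notin> {x..x + h}"
    by eventually_elim (auto simp: indicator_def split: if_splits)
  then have "emeasure lborel {x..x + h} = 0"
    by (subst (asm) AE_iff_measurable[of "{x..x + h}"]) auto
  then show False using assms by simp
qed

text \<open>The one-sided bound at the fixed point \<open>x\<close>, where the mass of the weight on \<open>[x, x + r]\<close> is bounded below by its
mass on \<open>[x, x + 1]\<close>. It controls averages over long intervals to the left of \<open>x\<close> by the norm alone.\<close>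
lemma left_average_le:
  "\<exists>c>0. \<forall>g V r. g \<in> borel_measurable borel \<longrightarrow> wint g \<le> ennreal V \<longrightarrow> 0 \<le> V \<longrightarrow> 1 \<le> r \<longrightarrow>
     (\<integral>\<^sup>+y\<in>{x - r..x}. g y \<partial>lborel) \<le> ennreal (r * (c * V) powr (1 / p))"
proof -
  obtain j where j: "(\<integral>\<^sup>+y\<in>{x..x + 1}. ennreal (\<omega> y) \<partial>lborel) = ennreal j" "0 < j"
    using mass_right_pos[of 1 x] loc_w[of x "x + 1"]
    by (cases "\<integral>\<^sup>+y\<in>{x..x + 1}. ennreal (\<omega> y) \<partial>lborel") auto
  have "(\<integral>\<^sup>+y\<in>{x - r..x}. g y \<partial>lborel) \<le> ennreal (r * (K / j * V) powr (1 / p))"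
    if [measurable]: "g \<in> borel_measurable borel" and V: "wint g \<le> ennreal V" "0 \<le> V" and r: "1 \<le> r" for g V r
  proof -
    let ?X = "\<integral>\<^sup>+y\<in>{x - r..x}. g y \<partial>lborel"
    have "epow p ?X * ennreal j \<le> epow p ?X * (\<integral>\<^sup>+y\<in>{x..x + r}. ennreal (\<omega> y) \<partial>lborel)"
      unfolding j(1)[symmetric] using r by (intro mult_left_mono nn_integral_mono) (auto simp: indicator_def)
    also have "\<dots> \<le> ennreal (K * r powr p) * (\<integral>\<^sup>+y\<in>{x - r..x}. epow p (g y) * ennreal (\<omega> y) \<partial>lborel)"
      using r by (intro one_sided_bound_le) auto
    also have "\<dots> \<le> ennreal (K * r powr p) * wint g"
      unfolding wint_def by (intro mult_left_mono nn_integral_mono) (auto simp: indicator_def)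
    also have "\<dots> \<le> ennreal (K * r powr p) * ennreal V" by (intro mult_left_mono V) auto
    finally have *: "epow p ?X * ennreal j \<le> ennreal (K * r powr p * V)" using K V by (simp add: ennreal_mult)
    show ?thesis
    proof (cases ?X)
      case (real t)
      have "t powr p * j \<le> K * r powr p * V"
        using * real j K V by (simp add: epow_ennreal flip: ennreal_mult)
      then have "t powr p \<le> r powr p * (K / j * V)" using j by (simp add: field_simps)
      then have "(t powr p) powr (1 / p) \<le> (r powr p * (K / j * V)) powr (1 / p)"
        using p by (intro powr_mono2) auto
      then have "t \<le> r * (K / j * V) powr (1 / p)"
        using real r p by (subst (asm) powr_mult) (auto simp: powr_powr)
      then show ?thesis using real by (simp add: ennreal_leI)
    next
      case top
      then show ?thesis using * j by (simp add: ennreal_top_mult top_unique)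
    qed
  qed
  moreover have "0 < K / j" using K j by simp
  ultimately show ?thesis by blast
qed

lemma wint_imp_locally_integrable:
  assumes [measurable]: "f \<in> borel_measurable borel" and fin: "wint (\<lambda>x. ennreal \<bar>f x\<bar>) < top"
  shows "locally_integrable f"
  unfolding locally_integrable_def
proof (intro allI)
  fix a b :: real
  obtain V where V: "wint (\<lambda>x. ennreal \<bar>f x\<bar>) = ennreal V" "0 \<le> V" using fin by (cases "wint (\<lambda>x. ennreal \<bar>f x\<bar>)") auto
  obtain c where c: "\<And>g V r. g \<in> borel_measurable borel \<Longrightarrow> wint g \<le> ennreal V \<Longrightarrow> 0 \<le> V \<Longrightarrow> 1 \<le> r \<Longrightarrow>
     (\<integral>\<^sup>+y\<in>{b - r..b}. g y \<partial>lborel) \<le> ennreal (r * (c * V) powr (1 / p))"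
    using left_average_le[of b] by blast
  let ?r = "max 1 (b - a)"
  have "(\<integral>\<^sup>+y\<in>{a..b}. ennreal \<bar>f y\<bar> \<partial>lborel) \<le> (\<integral>\<^sup>+y\<in>{b - ?r..b}. ennreal \<bar>f y\<bar> \<partial>lborel)"
    by (intro nn_integral_mono) (auto simp: indicator_def max_def)
  also have "\<dots> \<le> ennreal (?r * (c * V) powr (1 / p))" using V by (intro c) auto
  also have "\<dots> < top" by simp
  finally show "set_integrable lborel {a..b} f" by (intro set_integrableI_nn) auto
qed

text \<open>As \<open>g\<close> vanishes close to \<open>x\<close>, the averages over \<open>[x - 2 t, x - t]\<close> with \<open>t < 1 / 2\<close> are zero, and the long
ones are bounded by hypothesis.\<close>
lemma tail_kernel_bound:
  assumes [measurable]: "g \<in> borel_measurable borel" and a: "0 < \<alpha>" and d: "0 \<le> \<delta>"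
    and avg: "\<And>r. 1 \<le> r \<Longrightarrow> (\<integral>\<^sup>+y\<in>{x - r..x}. g y \<partial>lborel) \<le> ennreal (r * \<delta>)"
    and vanish: "\<And>y. x - 1 < y \<Longrightarrow> g y = 0"
  shows "(\<integral>\<^sup>+s\<in>{0<..}. tail_kernel \<alpha> s * g (x - s) \<partial>lborel) \<le> ennreal (4 * \<delta> * (1 + 1 / \<alpha>))"
proof -
  have A: "ennreal (1 / t) * (\<integral>\<^sup>+y\<in>{x - 2 * t..x - t}. g y \<partial>lborel) \<le> ennreal (2 * \<delta>)" if t: "0 < t" for t
  proof (cases "t < 1/2")
    case True
    then have z: "g y * indicator {x - 2 * t..x - t} y = 0" for y
      using vanish[of y] by (cases "x - 1 < y") auto
    show ?thesis unfolding z by simp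
  next
    case False
    have "(\<integral>\<^sup>+y\<in>{x - 2 * t..x - t}. g y \<partial>lborel) \<le> (\<integral>\<^sup>+y\<in>{x - 2 * t..x}. g y \<partial>lborel)"
      using t by (intro nn_integral_mono) (auto simp: indicator_def)
    also have "\<dots> \<le> ennreal (2 * t * \<delta>)" using False by (intro avg) auto
    finally have "ennreal (1 / t) * (\<integral>\<^sup>+y\<in>{x - 2 * t..x - t}. g y \<partial>lborel) \<le> ennreal (1 / t) * ennreal (2 * t * \<delta>)"
      by (intro mult_left_mono) auto
    also have "\<dots> = ennreal (2 * \<delta>)" using t d by (simp flip: ennreal_mult)
    finally show ?thesis .
  qed
  have "(\<integral>\<^sup>+s\<in>{0<..}. tail_kernel \<alpha> s * g (x - s) \<partial>lborel) \<le>
     2 * (\<integral>\<^sup>+t\<in>{0<..}. tail_kernel \<alpha> t * (ennreal (1 / t) * (\<integral>\<^sup>+y\<in>{x - 2 * t..x - t}. g y \<partial>lborel)) \<partial>lborel)"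
    by (intro antitone_kernel_le_averages tail_kernel_antitone a) auto
  also have "\<dots> \<le> 2 * (\<integral>\<^sup>+t. ennreal (2 * \<delta>) * (tail_kernel \<alpha> t * indicator {0<..} t) \<partial>lborel)"
  proof (intro mult_left_mono nn_integral_mono)
    fix t :: real
    show "tail_kernel \<alpha> t * (ennreal (1 / t) * (\<integral>\<^sup>+y\<in>{x - 2 * t..x - t}. g y \<partial>lborel)) * indicator {0<..} t \<le>
        ennreal (2 * \<delta>) * (tail_kernel \<alpha> t * indicator {0<..} t)"
      using mult_left_mono[OF A[of t], of "tail_kernel \<alpha> t"] by (cases "0 < t") (auto simp: mult.commute)
  qed auto
  also have "\<dots> = 2 * (ennreal (2 * \<delta>) * (\<integral>\<^sup>+t\<in>{0<..}. tail_kernel \<alpha> t \<partial>lborel))"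
    by (subst nn_integral_cmult) auto
  also have "\<dots> \<le> 2 * (ennreal (2 * \<delta>) * ennreal (1 + 1 / \<alpha>))"
    by (intro mult_left_mono tail_kernel_mass a) auto
  also have "\<dots> = ennreal (4 * \<delta> * (1 + 1 / \<alpha>))"
    using a d ennreal_mult_collapse[of 2 "2 * \<delta>" "ennreal (1 + 1 / \<alpha>)"]
    by (simp add: ennreal_mult del: ennreal_plus)
  finally show ?thesis .
qed

text \<open>The mass of the weight on \<open>[x, \<infinity>)\<close> may be finite, as for \<open>exp(- x)\<close>, so long averages are not small because of the
mass on the right. They are small because the part of \<open>w\<close> far to the left has small norm.\<close>
lemma tail_small:
  assumes [measurable]: "w \<in> borel_measurable borel" and fin: "wint (\<lambda>x. ennreal \<bar>w x\<bar>) < top" and e: "0 < e"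
  shows "\<exists>N\<ge>1. \<forall>\<alpha>>0. (\<integral>\<^sup>+s\<in>{N<..}. ennreal \<bar>w (x - s) * s powr - (1 + \<alpha>)\<bar> \<partial>lborel) \<le> ennreal (e * (1 + 1 / \<alpha>))"
proof -
  obtain c where c: "0 < c" "\<And>g V r. g \<in> borel_measurable borel \<Longrightarrow> wint g \<le> ennreal V \<Longrightarrow> 0 \<le> V \<Longrightarrow> 1 \<le> r \<Longrightarrow>
     (\<integral>\<^sup>+y\<in>{x - r..x}. g y \<partial>lborel) \<le> ennreal (r * (c * V) powr (1 / p))"
    using left_average_le[of x] by blast
  \<comment> \<open>the \<open>p\<close>-th power of the norm at which the bound on long averages becomes \<open>e / 4\<close>\<close>
  define V where "V = (e / 4) powr p / c"
  have V: "0 < V" "(c * V) powr (1 / p) = e / 4" using c e p by (auto simp: V_def powr_powr)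
  define g where "g n y = ennreal \<bar>w y\<bar> * indicator {..x - real n} y" for n y
  have [measurable]: "g n \<in> borel_measurable borel" for n unfolding g_def by measurable
  have "(\<lambda>n. wint (g n)) \<longlonglongrightarrow> (\<integral>\<^sup>+x. 0 \<partial>(lborel :: real measure))"
    unfolding wint_def
  proof (rule nn_integral_dominated_convergence)
    show "(\<integral>\<^sup>+y. epow p (ennreal \<bar>w y\<bar>) * ennreal (\<omega> y) \<partial>lborel) < \<infinity>" using fin by (simp add: wint_def)
    show "AE y in lborel. epow p (g n y) * ennreal (\<omega> y) \<le> epow p (ennreal \<bar>w y\<bar>) * ennreal (\<omega> y)" for n
      by (rule AE_I2) (auto simp: g_def indicator_def)
    show "AE y in lborel. (\<lambda>n. epow p (g n y) * ennreal (\<omega> y)) \<longlonglongrightarrow> 0"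
    proof (rule AE_I2, rule tendsto_eventually)
      fix y
      obtain m where m: "x - y < real m" using reals_Archimedean2 by blast
      show "\<forall>\<^sub>F n in sequentially. epow p (g n y) * ennreal (\<omega> y) = 0"
        using eventually_ge_at_top[of m]
      proof eventually_elim
        case (elim n)
        then have "real m \<le> real n" by simp
        with m have "\<not> y \<le> x - real n" by linarith
        then show ?case by (simp add: g_def)
      qed
    qed
  qed measurable
  then have "\<forall>\<^sub>F n in sequentially. wint (g n) < ennreal V"
    by (rule order_tendstoD(2)) (use V in simp)
  then obtain n0 where n0: "\<And>n. n \<ge> n0 \<Longrightarrow> wint (g n) < ennreal V" by (auto simp: eventually_sequentially)
  define n where "n = max 1 n0"
  have n: "wint (g n) \<le> ennreal V" "1 \<le> n" using n0[of n] by (auto simp: n_def less_imp_le)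
  have "(\<integral>\<^sup>+s\<in>{real n<..}. ennreal \<bar>w (x - s) * s powr - (1 + \<alpha>)\<bar> \<partial>lborel) \<le> ennreal (e * (1 + 1 / \<alpha>))"
    if a: "0 < \<alpha>" for \<alpha>
  proof -
    have "(\<integral>\<^sup>+s\<in>{real n<..}. ennreal \<bar>w (x - s) * s powr - (1 + \<alpha>)\<bar> \<partial>lborel) \<le> (\<integral>\<^sup>+s\<in>{0<..}. tail_kernel \<alpha> s * g n (x - s) \<partial>lborel)"
    proof (rule nn_integral_mono)
      fix s :: real
      show "ennreal \<bar>w (x - s) * s powr - (1 + \<alpha>)\<bar> * indicator {real n<..} s \<le> tail_kernel \<alpha> s * g n (x - s) * indicator {0<..} s"
      proof (cases "real n < s")
        case True
        then have s: "1 < s" using n(2) by linarith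
        have "s powr - (1 + \<alpha>) \<le> 1 powr - (1 + \<alpha>)" using s a by (intro powr_mono2') auto
        then have k: "tail_kernel \<alpha> s = ennreal (s powr - (1 + \<alpha>))" by (simp add: tail_kernel_def min_def)
        have "ennreal \<bar>w (x - s) * s powr - (1 + \<alpha>)\<bar> = ennreal (s powr - (1 + \<alpha>)) * ennreal \<bar>w (x - s)\<bar>"
          by (simp add: abs_mult mult.commute ennreal_mult del: minus_add_distrib)
        then show ?thesis using True s by (simp add: g_def k)
      qed simp
    qed
    also have "\<dots> \<le> ennreal (4 * (e / 4) * (1 + 1 / \<alpha>))"
    proof (rule tail_kernel_bound)
      show "(\<integral>\<^sup>+y\<in>{x - r..x}. g n y \<partial>lborel) \<le> ennreal (r * (e / 4))" if "1 \<le> r" for r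
        using c(2)[OF _ n(1) _ that] V by simp
      show "g n y = 0" if "x - 1 < y" for y using that n(2) by (auto simp: g_def indicator_def)
    qed (use a e in auto)
    finally show ?thesis by simp
  qed
  moreover have "1 \<le> real n" using n(2) by simp
  ultimately show ?thesis by blast
qed

lemma tail_convolution_finite:
  assumes [measurable]: "w \<in> borel_measurable borel" and fin: "wint (\<lambda>x. ennreal \<bar>w x\<bar>) < top" and a: "0 < \<alpha>"
  shows "(\<integral>\<^sup>+s\<in>{0<..}. tail_kernel \<alpha> s * ennreal \<bar>w (x - s)\<bar> \<partial>lborel) < top"
proof -
  obtain N where N: "1 \<le> N" "(\<integral>\<^sup>+s\<in>{N<..}. ennreal \<bar>w (x - s) * s powr - (1 + \<alpha>)\<bar> \<partial>lborel) \<le> ennreal (1 * (1 + 1 / \<alpha>))"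
    using tail_small[OF assms(1) fin, of 1 x] a by auto
  have "set_integrable lborel {x - N..x} w"
    using wint_imp_locally_integrable[OF assms(1) fin] by (simp add: locally_integrable_def)
  then have "(\<integral>\<^sup>+y\<in>{x - N..x - 0}. ennreal \<bar>w y\<bar> \<partial>lborel) < top"
    using set_nn_integral_eq_LBINT[of "{x - N..x}" "\<lambda>y. \<bar>w y\<bar>"] set_integrable_abs[of lborel "{x - N..x}" w] by simp
  then have L: "(\<integral>\<^sup>+s\<in>{0..N}. ennreal \<bar>w (x - s)\<bar> \<partial>lborel) < top"
    by (subst (asm) nn_integral_interval_reflect) auto
  have "(\<integral>\<^sup>+s\<in>{0<..}. tail_kernel \<alpha> s * ennreal \<bar>w (x - s)\<bar> \<partial>lborel) \<le>
    (\<integral>\<^sup>+s. ennreal \<bar>w (x - s)\<bar> * indicator {0..N} s + ennreal \<bar>w (x - s) * s powr - (1 + \<alpha>)\<bar> * indicator {N<..} s \<partial>lborel)"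
  proof (rule nn_integral_mono)
    fix s :: real
    have 1: "tail_kernel \<alpha> s * ennreal \<bar>w (x - s)\<bar> \<le> 1 * ennreal \<bar>w (x - s)\<bar>"
      by (intro mult_right_mono) (auto simp: tail_kernel_def)
    have "tail_kernel \<alpha> s * ennreal \<bar>w (x - s)\<bar> \<le> ennreal (s powr - (1 + \<alpha>)) * ennreal \<bar>w (x - s)\<bar>"
      by (intro mult_right_mono) (auto simp: tail_kernel_def intro!: ennreal_leI)
    also have "\<dots> = ennreal \<bar>w (x - s) * s powr - (1 + \<alpha>)\<bar>"
      by (simp add: abs_mult mult.commute ennreal_mult del: minus_add_distrib)
    finally show "tail_kernel \<alpha> s * ennreal \<bar>w (x - s)\<bar> * indicator {0<..} s \<le>
      ennreal \<bar>w (x - s)\<bar> * indicator {0..N} s + ennreal \<bar>w (x - s) * s powr - (1 + \<alpha>)\<bar> * indicator {N<..} s"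
      using 1 by (auto simp: indicator_def)
  qed
  also have "\<dots> = (\<integral>\<^sup>+s\<in>{0..N}. ennreal \<bar>w (x - s)\<bar> \<partial>lborel) + (\<integral>\<^sup>+s\<in>{N<..}. ennreal \<bar>w (x - s) * s powr - (1 + \<alpha>)\<bar> \<partial>lborel)"
    by (intro nn_integral_add) measurable
  also have "\<dots> < top" using L le_less_trans[OF N(2)] by simp
  finally show ?thesis .
qed

lemma far_part_finite:
  assumes [measurable]: "w \<in> borel_measurable borel" and fin: "wint (\<lambda>x. ennreal \<bar>w x\<bar>) < top" and a: "0 < \<alpha>"
  shows "far_part \<alpha> w x < top"
proof -
  have "ennreal (1 / \<alpha>) * ennreal \<bar>w x\<bar> < top" by (simp add: ennreal_mult_less_top)
  with tail_convolution_finite[OF assms, of x] show ?thesis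
    by (intro le_less_trans[OF far_part_le[OF assms(1) a]]) simp
qed

lemma near_part_finite_AE:
  assumes W: "antiderivative W f" and fin: "wint (\<lambda>x. ennreal \<bar>f x\<bar>) < top" and a: "0 < \<alpha>" "\<alpha> < 1"
  shows "AE x in lborel. near_part \<alpha> W x < top"
proof (rule finite_AE_of_wint)
  note [measurable] = antiderivative_borel[OF W]
  show "near_part \<alpha> W \<in> borel_measurable borel"
    by (rule near_part_measurable(1)[OF antiderivative_borel(1)[OF W]])
  have "wint (near_part \<alpha> W) \<le> ennreal (convC * (1 / (\<alpha> * (1 - \<alpha>))) powr p) * wint (\<lambda>x. ennreal \<bar>f x\<bar>)"
    by (rule wint_near_part[OF W a])
  also have "\<dots> < top" using fin by (simp add: ennreal_mult_less_top)
  finally show "wint (near_part \<alpha> W) < top" .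
qed

theorem frac_deriv_AE_limits:
  assumes W: "antiderivative W f" and fW: "wint (\<lambda>x. ennreal \<bar>W x\<bar>) < top" and ff: "wint (\<lambda>x. ennreal \<bar>f x\<bar>) < top"
  shows "AE x in lborel. ((\<lambda>\<alpha>. frac_deriv \<alpha> W x) \<longlongrightarrow> f x) (at_left 1)"
    and "AE x in lborel. ((\<lambda>\<alpha>. frac_deriv \<alpha> W x) \<longlongrightarrow> W x) (at_right 0)"
proof -
  note [measurable] = antiderivative_borel[OF W]
  have c: "continuous_on UNIV W" by (rule antiderivative_continuous[OF W])
  have f: "locally_integrable f" using W by (simp add: antiderivative_def)
  from lebesgue_differentiation_left[OF f]
  show "AE x in lborel. ((\<lambda>\<alpha>. frac_deriv \<alpha> W x) \<longlongrightarrow> f x) (at_left 1)"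
  proof eventually_elim
    case (elim x)
    have "\<forall>\<^sub>F s in at_right 0. (LBINT y:{x - s..x}. f y) / s = (W x - W (x - s)) / s"
    proof (rule eventually_mono[OF eventually_at_right_less])
      fix s :: real assume "0 < s"
      then have "W x - W (x - s) = (LBINT y:{x - s..x}. f y)"
        using W unfolding antiderivative_def by simp
      then show "(LBINT y:{x - s..x}. f y) / s = (W x - W (x - s)) / s" by simp
    qed
    with elim have "((\<lambda>s. (W x - W (x - s)) / s) \<longlongrightarrow> f x) (at_right 0)"
      by (rule Lim_transform_eventually)
    then show ?case
      by (rule frac_deriv_tendsto_deriv[OF c _ far_part_finite[OF antiderivative_borel(1)[OF W] fW]]) simp
  qed
  from near_part_finite_AE[OF W ff, of "1/2"]
  have "AE x in lborel. near_part (1/2) W x < top" by simp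
  then show "AE x in lborel. ((\<lambda>\<alpha>. frac_deriv \<alpha> W x) \<longlongrightarrow> W x) (at_right 0)"
  proof eventually_elim
    case (elim x)
    show ?case
      by (rule frac_deriv_tendsto_id[OF c elim]) (rule tail_small[OF antiderivative_borel(1)[OF W] fW])
  qed
qed

end

section \<open>Convergence in the weighted norm\<close>

lemma average_kernel_mass:
  assumes "0 < s" shows "(\<integral>\<^sup>+r\<in>{0<..}. ennreal (1 / s) * indicator {..s} r \<partial>lborel) \<le> ennreal 1"
proof -
  have "(\<integral>\<^sup>+r\<in>{0<..}. ennreal (1 / s) * indicator {..s} r \<partial>lborel) \<le> (\<integral>\<^sup>+r. ennreal (1 / s) * indicator {0..s} r \<partial>lborel)"
    by (intro nn_integral_mono) (auto simp: indicator_def)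
  also have "\<dots> = ennreal 1"
    using assms by (subst nn_integral_cmult_indicator) (auto simp flip: ennreal_mult)
  finally show ?thesis .
qed

lemma antiderivative_diff:
  assumes "antiderivative V f" "antiderivative W g" shows "antiderivative (\<lambda>x. V x - W x) (\<lambda>x. f x - g x)"
  unfolding antiderivative_def
proof (intro conjI allI impI)
  have f: "locally_integrable f" "locally_integrable g" using assms by (auto simp: antiderivative_def)
  then show "locally_integrable (\<lambda>x. f x - g x)" by (rule locally_integrable_diff)
  fix x y :: real assume xy: "x \<le> y"
  have "(LBINT t:{x..y}. f t - g t) = (LBINT t:{x..y}. f t) - (LBINT t:{x..y}. g t)"
    using f by (intro set_integral_diff) (auto simp: locally_integrable_def)
  moreover have "V y - V x = (LBINT t:{x..y}. f t)" "W y - W x = (LBINT t:{x..y}. g t)"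
    using assms xy unfolding antiderivative_def by blast+
  ultimately show "V y - W y - (V x - W x) = (LBINT t:{x..y}. f t - g t)" by linarith
qed

context one_sided_weight begin

text \<open>The difference quotient is dominated by convolution with the kernel \<open>1 / s\<close> on \<open>(0, s]\<close>.\<close>
lemma wint_difference_quotient:
  assumes V: "antiderivative V h" and s: "0 < s"
  shows "wabs (\<lambda>x. (V x - V (x - s)) / s) \<le> ennreal convC * wabs h"
proof -
  note [measurable] = antiderivative_borel[OF V]
  let ?k = "\<lambda>r. ennreal (1 / s) * indicator {..s} r"
  have "wabs (\<lambda>x. (V x - V (x - s)) / s) \<le> wint (\<lambda>x. \<integral>\<^sup>+r\<in>{0<..}. ?k r * ennreal \<bar>h (x - r)\<bar> \<partial>lborel)"
  proof (rule wint_mono)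
    fix x
    have "AE r in lborel. r \<noteq> (0::real)" by (rule AE_lborel_singleton)
    then have *: "(\<integral>\<^sup>+r\<in>{0..s}. ennreal \<bar>h (x - r)\<bar> \<partial>lborel) = (\<integral>\<^sup>+r. ennreal \<bar>h (x - r)\<bar> * indicator {0<..s} r \<partial>lborel)"
      by (intro nn_integral_cong_AE) (auto simp: indicator_def elim!: eventually_mono)
    have "ennreal \<bar>(V x - V (x - s)) / s\<bar> = ennreal (1 / s) * ennreal \<bar>V x - V (x - s)\<bar>"
      using s by (simp add: abs_divide flip: ennreal_mult)
    also have "\<dots> \<le> ennreal (1 / s) * (\<integral>\<^sup>+r. ennreal \<bar>h (x - r)\<bar> * indicator {0<..s} r \<partial>lborel)"
      using s antiderivative_increment_le[OF V, of s x] unfolding * by (intro mult_left_mono) auto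
    also have "\<dots> = (\<integral>\<^sup>+r\<in>{0<..}. ?k r * ennreal \<bar>h (x - r)\<bar> \<partial>lborel)"
      by (subst nn_integral_cmult[symmetric], measurable) (auto intro!: nn_integral_cong simp: indicator_def)
    finally show "ennreal \<bar>(V x - V (x - s)) / s\<bar> \<le> \<dots>" .
  qed
  also have "\<dots> \<le> ennreal (convC * 1 powr p) * wabs h"
    by (intro wint_antitone_convolution average_kernel_mass s) (auto simp: indicator_def)
  finally show ?thesis by simp
qed

text \<open>Lebesgue differentiation and dominated convergence: the difference quotients are bounded by \<open>B\<close> and live on an
interval of fixed length, on which the weight is integrable.\<close>
lemma difference_quotient_tendsto_bounded:
  assumes V: "antiderivative V h" and B: "\<And>x. \<bar>h x\<bar> \<le> B" and R: "\<And>x. x \<notin> {-R..R} \<Longrightarrow> h x = 0"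
  shows "((\<lambda>s. wabs (\<lambda>x. (V x - V (x - s)) / s - h x)) \<longlongrightarrow> 0) (at_right 0)"
proof (rule tendsto_at_right_sequentially[of 0 1])
  fix S :: "nat \<Rightarrow> real" assume S: "\<And>n. 0 < S n" "\<And>n. S n < 1" and lim: "S \<longlonglongrightarrow> 0"
  note [measurable] = antiderivative_borel[OF V]
  have h: "locally_integrable h" using V by (simp add: antiderivative_def)
  have B0: "0 \<le> B" using B[of 0] by linarith
  have q: "(V x - V (x - s)) / s = (LBINT y:{x - s..x}. h y) / s" if "0 < s" for s x
    using V that by (simp add: antiderivative_def)
  have qB: "\<bar>(V x - V (x - s)) / s\<bar> \<le> B" if s: "0 < s" for s x
  proof -
    have "ennreal \<bar>V x - V (x - s)\<bar> \<le> (\<integral>\<^sup>+r\<in>{0..s}. ennreal \<bar>h (x - r)\<bar> \<partial>lborel)"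
      using s by (intro antiderivative_increment_le[OF V]) auto
    also have "\<dots> \<le> (\<integral>\<^sup>+r. ennreal B * indicator {0..s} r \<partial>lborel)"
      by (intro nn_integral_mono) (auto simp: indicator_def intro!: ennreal_leI B)
    also have "\<dots> = ennreal (B * s)" using s B0 by (subst nn_integral_cmult_indicator) (auto simp: ennreal_mult)
    finally have "\<bar>V x - V (x - s)\<bar> \<le> B * s" using s B0 by simp
    then show ?thesis using s by (simp add: abs_divide divide_le_eq)
  qed
  have q0: "(V x - V (x - s)) / s = 0" if "x \<notin> {-R..R + 1}" "0 < s" "s < 1" for s x
  proof -
    have "(LBINT y:{x - s..x}. h y) = (LBINT y:{x - s..x}. 0)"
      using that by (intro set_lebesgue_integral_cong) (auto intro!: R)
    then show ?thesis by (simp add: q[OF that(2)])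
  qed
  let ?D = "\<lambda>x. ennreal (2 * B) * indicator {-R..R + 1} x"
  have "(\<lambda>n. wabs (\<lambda>x. (V x - V (x - S n)) / S n - h x)) \<longlonglongrightarrow> (\<integral>\<^sup>+x. 0 \<partial>(lborel :: real measure))"
    unfolding wint_def
  proof (rule nn_integral_dominated_convergence)
    show "(\<integral>\<^sup>+x. ennreal ((2 * B) powr p) * (ennreal (\<omega> x) * indicator {-R..R + 1} x) \<partial>lborel) < \<infinity>"
      using loc_w[of "-R" "R + 1"] by (simp add: nn_integral_cmult ennreal_mult_less_top)
    show "AE x in lborel. epow p (ennreal \<bar>(V x - V (x - S n)) / S n - h x\<bar>) * ennreal (\<omega> x)
      \<le> ennreal ((2 * B) powr p) * (ennreal (\<omega> x) * indicator {-R..R + 1} x)" for n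
    proof (rule AE_I2)
      fix x
      show "epow p (ennreal \<bar>(V x - V (x - S n)) / S n - h x\<bar>) * ennreal (\<omega> x)
        \<le> ennreal ((2 * B) powr p) * (ennreal (\<omega> x) * indicator {-R..R + 1} x)"
      proof (cases "x \<in> {-R..R + 1}")
        case True
        have "\<bar>(V x - V (x - S n)) / S n - h x\<bar> \<le> 2 * B" using qB[OF S(1), of x n] B[of x] by linarith
        then have "epow p (ennreal \<bar>(V x - V (x - S n)) / S n - h x\<bar>) \<le> epow p (ennreal (2 * B))"
          using p by (intro epow_mono ennreal_leI) auto
        also have "\<dots> = ennreal ((2 * B) powr p)" using B0 by (simp add: epow_ennreal)
        finally show ?thesis using True by (simp add: mult_right_mono)
      next
        case False
        then have "h x = 0" by (intro R) auto
        then show ?thesis by (simp only: q0[OF False S(1) S(2)]) simp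
      qed
    qed
    show "AE x in lborel. (\<lambda>n. epow p (ennreal \<bar>(V x - V (x - S n)) / S n - h x\<bar>) * ennreal (\<omega> x)) \<longlonglongrightarrow> 0"
      using lebesgue_differentiation_left[OF h]
    proof eventually_elim
      case (elim x)
      have "filterlim S (at_right 0) sequentially"
        unfolding filterlim_at using lim S(1) less_imp_neq[OF S(1)] by (auto intro!: always_eventually)
      from filterlim_compose[OF elim this]
      have "(\<lambda>n. (V x - V (x - S n)) / S n) \<longlonglongrightarrow> h x" by (simp add: q S)
      then have "(\<lambda>n. \<bar>(V x - V (x - S n)) / S n - h x\<bar>) \<longlonglongrightarrow> \<bar>h x - h x\<bar>" by (intro tendsto_intros)
      then have "(\<lambda>n. \<bar>(V x - V (x - S n)) / S n - h x\<bar> powr p) \<longlonglongrightarrow> 0"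
        using p by (intro tendsto_zero_powrI[where b = p]) auto
      from ennreal_tendsto_cmult[OF _ tendsto_ennrealI[OF this], of "ennreal (\<omega> x)"]
      show ?case by (simp add: epow_ennreal mult.commute)
    qed
  qed measurable
  then show "(\<lambda>n. wabs (\<lambda>x. (V x - V (x - S n)) / S n - h x)) \<longlonglongrightarrow> 0" by simp
qed simp

lemma bounded_truncation_dense:
  assumes [measurable]: "f \<in> borel_measurable borel" and fin: "wabs f < top" and e: "0 < (e::ennreal)"
  shows "\<exists>h B R. h \<in> borel_measurable borel \<and> (\<forall>x. \<bar>h x\<bar> \<le> B) \<and> (\<forall>x. x \<notin> {-R..R} \<longrightarrow> h x = 0) \<and>
    (\<forall>x. \<bar>h x\<bar> \<le> \<bar>f x\<bar>) \<and> wabs (\<lambda>x. f x - h x) < e"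
proof -
  define h where "h n x = (if \<bar>x\<bar> \<le> real n \<and> \<bar>f x\<bar> \<le> real n then f x else 0)" for n x
  have [measurable]: "h n \<in> borel_measurable borel" for n unfolding h_def by measurable
  have "(\<lambda>n. wabs (\<lambda>x. f x - h n x)) \<longlonglongrightarrow> (\<integral>\<^sup>+x. 0 \<partial>(lborel :: real measure))"
    unfolding wint_def
  proof (rule nn_integral_dominated_convergence)
    show "(\<integral>\<^sup>+y. epow p (ennreal \<bar>f y\<bar>) * ennreal (\<omega> y) \<partial>lborel) < \<infinity>" using fin by (simp add: wint_def)
    show "AE y in lborel. epow p (ennreal \<bar>f y - h n y\<bar>) * ennreal (\<omega> y) \<le> epow p (ennreal \<bar>f y\<bar>) * ennreal (\<omega> y)" for n
      using p by (intro AE_I2 mult_right_mono epow_mono ennreal_leI) (auto simp: h_def)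
    show "AE y in lborel. (\<lambda>n. epow p (ennreal \<bar>f y - h n y\<bar>) * ennreal (\<omega> y)) \<longlonglongrightarrow> 0"
    proof (rule AE_I2, rule tendsto_eventually)
      fix y
      obtain m where m: "max \<bar>y\<bar> \<bar>f y\<bar> < real m" using reals_Archimedean2 by blast
      show "\<forall>\<^sub>F n in sequentially. epow p (ennreal \<bar>f y - h n y\<bar>) * ennreal (\<omega> y) = 0"
        using eventually_ge_at_top[of m]
      proof eventually_elim
        case (elim n)
        then have "real m \<le> real n" by simp
        with m show ?case by (simp add: h_def)
      qed
    qed
  qed measurable
  then have "\<forall>\<^sub>F n in sequentially. wabs (\<lambda>x. f x - h n x) < e"
    by (rule order_tendstoD(2)) (use e in simp)
  then obtain n where "wabs (\<lambda>x. f x - h n x) < e" by (auto simp: eventually_sequentially)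
  moreover have "\<bar>h n x\<bar> \<le> real n" "\<bar>h n x\<bar> \<le> \<bar>f x\<bar>" for x by (auto simp: h_def)
  moreover have "h n x = 0" if "x \<notin> {-real n..real n}" for x using that by (auto simp: h_def)
  ultimately show ?thesis by (intro exI[of _ "h n"] exI[of _ "real n"]) auto
qed

text \<open>The difference quotients are uniformly bounded operators, so it suffices to know the limit on a dense class.\<close>
theorem difference_quotient_tendsto:
  assumes W: "antiderivative W f" and fin: "wabs f < top"
  shows "((\<lambda>s. wabs (\<lambda>x. (W x - W (x - s)) / s - f x)) \<longlongrightarrow> 0) (at_right 0)"
proof (rule tendsto_zero_ennreal)
  fix r :: real assume r: "0 < r"
  note [measurable] = antiderivative_borel[OF W]
  \<comment> \<open>the total factor with which the distance of \<open>f\<close> to its truncation enters below\<close>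
  define A where "A = 2 powr p * (convC + 2 powr p)"
  have A: "0 < A" using convC_pos by (simp add: A_def add_pos_pos)
  have "0 < ennreal (r / (4 * A))" using r A by simp
  from bounded_truncation_dense[OF _ fin this] obtain h B R
    where [measurable]: "h \<in> borel_measurable borel"
      and h: "\<And>x. \<bar>h x\<bar> \<le> B" "\<And>x. x \<notin> {-R..R} \<Longrightarrow> h x = 0" "\<And>x. \<bar>h x\<bar> \<le> \<bar>f x\<bar>"
      and small: "wabs (\<lambda>x. f x - h x) < ennreal (r / (4 * A))"
    by auto
  have "wabs h \<le> wabs f" using h by (intro wint_mono ennreal_leI) auto
  then have "locally_integrable h" using fin by (intro wint_imp_locally_integrable) auto
  then obtain V where V: "antiderivative V h" using antiderivative_exists by blast
  note [measurable] = antiderivative_borel[OF V]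
  have "0 < r / (4 * 4 powr p)" using r by simp
  then have r4: "0 < ennreal (r / (4 * 4 powr p))" by (rule ennreal_less_zero_iff[THEN iffD2])
  have "\<forall>\<^sub>F s in at_right 0. wabs (\<lambda>x. (V x - V (x - s)) / s - h x) < ennreal (r / (4 * 4 powr p))"
    by (rule order_tendstoD(2)[OF difference_quotient_tendsto_bounded[where R = R, OF V h(1) h(2)] r4])
  with eventually_at_right_less
  show "\<forall>\<^sub>F s in at_right 0. wabs (\<lambda>x. (W x - W (x - s)) / s - f x) < ennreal r"
  proof eventually_elim
    case (elim s)
    let ?a = "\<lambda>x. ((W x - V x) - (W (x - s) - V (x - s))) / s" and ?b = "\<lambda>x. f x - h x"
      and ?c = "\<lambda>x. (V x - V (x - s)) / s - h x"
    have a: "wabs ?a \<le> ennreal convC * wabs ?b"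
      using wint_difference_quotient[OF antiderivative_diff[OF W V] elim(1)] .
    have "wabs (\<lambda>x. (W x - W (x - s)) / s - f x) \<le> wint (\<lambda>x. ennreal \<bar>?a x\<bar> + (ennreal \<bar>?b x\<bar> + ennreal \<bar>?c x\<bar>))"
    proof (rule wint_mono)
      fix x
      have "(W x - W (x - s)) / s - f x = ?a x - ?b x + ?c x" by (simp add: diff_divide_distrib)
      then have "\<bar>(W x - W (x - s)) / s - f x\<bar> \<le> \<bar>?a x\<bar> + (\<bar>?b x\<bar> + \<bar>?c x\<bar>)" by linarith
      then have "ennreal \<bar>(W x - W (x - s)) / s - f x\<bar> \<le> ennreal (\<bar>?a x\<bar> + (\<bar>?b x\<bar> + \<bar>?c x\<bar>))" by (rule ennreal_leI)
      then show "ennreal \<bar>(W x - W (x - s)) / s - f x\<bar> \<le> ennreal \<bar>?a x\<bar> + (ennreal \<bar>?b x\<bar> + ennreal \<bar>?c x\<bar>)" by simp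
    qed
    also have "\<dots> \<le> ennreal (2 powr p) * (wabs ?a + ennreal (2 powr p) * (wabs ?b + wabs ?c))"
      by (intro order_trans[OF wint_add_le] mult_left_mono add_left_mono wint_add_le) auto
    also have "\<dots> \<le> ennreal (2 powr p) * (ennreal convC * ennreal (r / (4 * A)) + ennreal (2 powr p) * (ennreal (r / (4 * A)) + ennreal (r / (4 * 4 powr p))))"
      using small elim(2)
      by (intro mult_left_mono add_mono order_trans[OF a]) (auto intro: less_imp_le)
    also have "\<dots> = ennreal (2 powr p * (convC * (r / (4 * A)) + 2 powr p * (r / (4 * A) + r / (4 * 4 powr p))))"
      using r A convC_pos by (simp flip: ennreal_mult ennreal_plus)
    also have "2 powr p * (convC * (r / (4 * A)) + 2 powr p * (r / (4 * A) + r / (4 * 4 powr p))) =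
       A * (r / (4 * A)) + (2 powr p * 2 powr p) * (r / (4 * 4 powr p))"
    proof -
      have "2 powr p * (convC * y + 2 powr p * (y + z)) = A * y + (2 powr p * 2 powr p) * z" for y z
        unfolding A_def by (simp add: algebra_simps)
      then show ?thesis .
    qed
    also have "\<dots> = r / 4 + r / 4" using A by (simp flip: powr_mult)
    also have "ennreal \<dots> < ennreal r" using r by (intro ennreal_lessI) auto
    finally show ?case .
  qed
qed

text \<open>Jensen's inequality for the measure \<open>s\<^sup>-\<^sup>\<alpha> ds\<close> on \<open>(0, 1]\<close>, which has mass \<open>1 / (1 - \<alpha>)\<close>.\<close>
lemma wint_near_average:
  fixes q :: "real \<Rightarrow> real \<Rightarrow> ennreal"
  assumes a: "\<alpha> < 1" and q[measurable]: "(\<lambda>(s, x). q s x) \<in> borel_measurable (borel \<Otimes>\<^sub>M borel)"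
  shows "wint (\<lambda>x. \<integral>\<^sup>+s\<in>{0<..1}. ennreal (s powr - \<alpha>) * q s x \<partial>lborel) \<le>
    ennreal ((1 / (1 - \<alpha>)) powr (p - 1)) * (\<integral>\<^sup>+s\<in>{0<..1}. ennreal (s powr - \<alpha>) * wint (q s) \<partial>lborel)"
proof -
  let ?k = "\<lambda>s. ennreal (s powr - \<alpha>) * indicator {0<..1} s"
  let ?M = "density lborel ?k"
  have 1: "epow p (\<integral>\<^sup>+s\<in>{0<..1}. ennreal (s powr - \<alpha>) * q s x \<partial>lborel) \<le>
      ennreal ((1 / (1 - \<alpha>)) powr (p - 1)) * (\<integral>\<^sup>+s. ?k s * epow p (q s x) \<partial>lborel)" for x
  proof -
    have "(\<integral>\<^sup>+s\<in>{0<..1}. ennreal (s powr - \<alpha>) * q s x \<partial>lborel) = (\<integral>\<^sup>+s. q s x \<partial>?M)"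
      by (subst nn_integral_density, measurable) (auto intro!: nn_integral_cong simp: mult_ac)
    moreover have "(\<integral>\<^sup>+s. ?k s * epow p (q s x) \<partial>lborel) = (\<integral>\<^sup>+s. epow p (q s x) \<partial>?M)"
      by (subst nn_integral_density, measurable)
    moreover have "epow p (\<integral>\<^sup>+s. q s x \<partial>?M) \<le> ennreal ((1 / (1 - \<alpha>)) powr (p - 1)) * (\<integral>\<^sup>+s. epow p (q s x) \<partial>?M)"
    proof (rule jensen_epow[OF p])
      show "emeasure ?M (space ?M) \<le> ennreal (1 / (1 - \<alpha>))"
        using nn_integral_powr_from_0[OF a] by (subst emeasure_density) auto
      show "(\<lambda>s. q s x) \<in> borel_measurable ?M" by measurable
    qed (use a in auto)
    ultimately show ?thesis by simp
  qed
  have "wint (\<lambda>x. \<integral>\<^sup>+s\<in>{0<..1}. ennreal (s powr - \<alpha>) * q s x \<partial>lborel) \<le>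
     (\<integral>\<^sup>+x. ennreal ((1 / (1 - \<alpha>)) powr (p - 1)) * ((\<integral>\<^sup>+s. ?k s * epow p (q s x) \<partial>lborel) * ennreal (\<omega> x)) \<partial>lborel)"
    unfolding wint_def mult.assoc[symmetric] using 1 by (intro nn_integral_mono mult_right_mono) (auto simp: mult.assoc)
  also have "\<dots> = ennreal ((1 / (1 - \<alpha>)) powr (p - 1)) * (\<integral>\<^sup>+x. (\<integral>\<^sup>+s. ?k s * epow p (q s x) \<partial>lborel) * ennreal (\<omega> x) \<partial>lborel)"
    by (intro nn_integral_cmult) measurable
  also have "(\<integral>\<^sup>+x. (\<integral>\<^sup>+s. ?k s * epow p (q s x) \<partial>lborel) * ennreal (\<omega> x) \<partial>lborel) =
    (\<integral>\<^sup>+x. (\<integral>\<^sup>+s. ?k s * (epow p (q s x) * ennreal (\<omega> x)) \<partial>lborel) \<partial>lborel)"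
    by (intro nn_integral_cong, subst nn_integral_multc[symmetric], measurable) (simp add: mult.assoc)
  also have "\<dots> = (\<integral>\<^sup>+s. (\<integral>\<^sup>+x. ?k s * (epow p (q s x) * ennreal (\<omega> x)) \<partial>lborel) \<partial>lborel)"
    by (subst lborel_pair.Fubini') auto
  also have "\<dots> = (\<integral>\<^sup>+s\<in>{0<..1}. ennreal (s powr - \<alpha>) * wint (q s) \<partial>lborel)"
    unfolding wint_def by (intro nn_integral_cong, subst nn_integral_cmult, measurable) (simp add: mult_ac)
  finally show ?thesis .
qed

theorem frac_deriv_tendsto_deriv_wint:
  assumes W: "antiderivative W f" and fW: "wabs W < top" and ff: "wabs f < top"
  shows "((\<lambda>\<alpha>. wabs (\<lambda>x. frac_deriv \<alpha> W x - f x)) \<longlongrightarrow> 0) (at_left 1)"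
proof -
  note [measurable] = antiderivative_borel[OF W]
  define q where "q s x = ennreal \<bar>(W x - W (x - s)) / s - f x\<bar>" for s x
  have qm[measurable]: "(\<lambda>(s, x). q s x) \<in> borel_measurable (borel \<Otimes>\<^sub>M borel)" unfolding q_def by measurable
  define N where "N s = wint (q s)" for s
  have [measurable]: "N \<in> borel_measurable borel" unfolding N_def wint_def by measurable
  let ?I = "\<lambda>\<alpha>. \<integral>\<^sup>+s\<in>{0<..1}. ennreal (s powr - \<alpha>) * N s \<partial>lborel"
  have "((\<lambda>\<alpha>. ennreal (1 - \<alpha>) * ?I \<alpha>) \<longlongrightarrow> 0) (at_left 1)"
  proof (rule powr_concentration)
    show "(N \<longlongrightarrow> 0) (at_right 0)" unfolding N_def q_def by (rule difference_quotient_tendsto[OF W ff])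
    fix \<delta> :: real assume d: "0 < \<delta>"
    let ?B = "ennreal (2 powr p) * (ennreal convC * wabs f + wabs f)"
    have "N s \<le> ?B" if s: "0 < s" for s
    proof -
      have "N s \<le> wint (\<lambda>x. ennreal \<bar>(W x - W (x - s)) / s\<bar> + ennreal \<bar>f x\<bar>)"
        unfolding N_def q_def
        by (intro wint_mono) (simp flip: ennreal_plus, rule order_trans[OF abs_triangle_ineq4], simp add: abs_divide)
      also have "\<dots> \<le> ennreal (2 powr p) * (wabs (\<lambda>x. (W x - W (x - s)) / s) + wabs f)"
        by (intro wint_add_le) measurable
      also have "\<dots> \<le> ?B" by (intro mult_left_mono add_mono wint_difference_quotient[OF W s]) auto
      finally show ?thesis .
    qed
    then have "(\<integral>\<^sup>+s\<in>{\<delta>..1}. N s \<partial>lborel) \<le> (\<integral>\<^sup>+s. ?B * indicator {\<delta>..1} s \<partial>lborel)"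
      using d by (intro nn_integral_mono) (auto simp: indicator_def)
    also have "\<dots> < top" using ff
      by (simp add: nn_integral_cmult_indicator ennreal_mult_less_top emeasure_lborel_Icc_eq)
    finally show "(\<integral>\<^sup>+s\<in>{\<delta>..1}. N s \<partial>lborel) < top" .
  qed measurable
  then have I: "((\<lambda>\<alpha>. ennreal (2 powr p) * (ennreal (1 - \<alpha>) * ?I \<alpha>)) \<longlongrightarrow> ennreal (2 powr p) * 0) (at_left 1)"
    by (intro ennreal_tendsto_cmult) auto
  have c0: "((\<lambda>\<alpha>. frac_const \<alpha> powr p) \<longlongrightarrow> 0) (at_left 1)"
    using p eventually_at_left_1
    by (intro tendsto_zero_powrI[where b = p] frac_const_tendsto_0_at_1) (auto elim!: eventually_mono intro!: less_imp_le[OF frac_const_pos])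
  have F: "((\<lambda>\<alpha>. (ennreal (farC * 2 powr p) * wabs W) * ennreal (frac_const \<alpha> powr p)) \<longlongrightarrow>
      (ennreal (farC * 2 powr p) * wabs W) * ennreal 0) (at_left 1)"
    using fW by (intro ennreal_tendsto_cmult tendsto_ennrealI c0) (auto simp: ennreal_mult_less_top)
  have "((\<lambda>\<alpha>. \<bar>frac_const \<alpha> / (1 - \<alpha>) - 1\<bar>) \<longlongrightarrow> \<bar>1 - 1\<bar>) (at_left 1)"
    by (intro tendsto_intros frac_const_tendsto_1)
  then have "((\<lambda>\<alpha>. \<bar>frac_const \<alpha> / (1 - \<alpha>) - 1\<bar> powr p) \<longlongrightarrow> 0) (at_left 1)"
    using p by (intro tendsto_zero_powrI[where b = p]) auto
  then have E: "((\<lambda>\<alpha>. wabs f * ennreal (\<bar>frac_const \<alpha> / (1 - \<alpha>) - 1\<bar> powr p)) \<longlongrightarrow> wabs f * ennreal 0) (at_left 1)"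
    by (intro ennreal_tendsto_cmult tendsto_ennrealI ff)
  let ?b = "\<lambda>\<alpha>. ennreal (2 powr p) * (wabs f * ennreal (\<bar>frac_const \<alpha> / (1 - \<alpha>) - 1\<bar> powr p) +
      ennreal (2 powr p) * (ennreal (2 powr p) * (ennreal (1 - \<alpha>) * ?I \<alpha>) +
        (ennreal (farC * 2 powr p) * wabs W) * ennreal (frac_const \<alpha> powr p)))"
  have b: "(?b \<longlongrightarrow> ennreal (2 powr p) * (wabs f * ennreal 0 + ennreal (2 powr p) * (ennreal (2 powr p) * 0 +
      (ennreal (farC * 2 powr p) * wabs W) * ennreal 0))) (at_left 1)"
    by (intro ennreal_tendsto_cmult tendsto_add E I F) auto
  have "\<forall>\<^sub>F \<alpha> in at_left 1. frac_const \<alpha> / (1 - \<alpha>) < 2"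
    by (rule order_tendstoD(2)[OF frac_const_tendsto_1]) simp
  with eventually_at_left_1
  have "\<forall>\<^sub>F \<alpha> in at_left 1. wabs (\<lambda>x. frac_deriv \<alpha> W x - f x) \<le> ?b \<alpha>"
  proof eventually_elim
    case (elim \<alpha>)
    then have a: "0 < \<alpha>" "\<alpha> < 1" by auto
    let ?c = "frac_const \<alpha>"
    have c: "0 < ?c" by (rule frac_const_pos[OF a])
    let ?J = "\<lambda>x. \<integral>\<^sup>+s\<in>{0<..1}. ennreal (s powr - \<alpha>) * q s x \<partial>lborel"
    have "wabs (\<lambda>x. frac_deriv \<alpha> W x - f x) \<le> wint (\<lambda>x. ennreal \<bar>?c / (1 - \<alpha>) - 1\<bar> * ennreal \<bar>f x\<bar> +
        (ennreal ?c * ?J x + ennreal ?c * far_part \<alpha> W x))"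
    proof (rule wint_mono)
      fix x
      show "ennreal \<bar>frac_deriv \<alpha> W x - f x\<bar> \<le> ennreal \<bar>?c / (1 - \<alpha>) - 1\<bar> * ennreal \<bar>f x\<bar> +
        (ennreal ?c * ?J x + ennreal ?c * far_part \<alpha> W x)"
        using frac_deriv_near_deriv[OF a antiderivative_borel(1)[OF W], of x "f x"]
        unfolding q_def by (simp add: distrib_left abs_mult ennreal_mult)
    qed
    also have "\<dots> \<le> ennreal (2 powr p) * (wint (\<lambda>x. ennreal \<bar>?c / (1 - \<alpha>) - 1\<bar> * ennreal \<bar>f x\<bar>) + ennreal (2 powr p) *
        (wint (\<lambda>x. ennreal ?c * ?J x) + wint (\<lambda>x. ennreal ?c * far_part \<alpha> W x)))"
      by (intro order_trans[OF wint_add_le] mult_left_mono add_left_mono wint_add_le) auto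
    also have "wint (\<lambda>x. ennreal \<bar>?c / (1 - \<alpha>) - 1\<bar> * ennreal \<bar>f x\<bar>) = wabs f * ennreal (\<bar>?c / (1 - \<alpha>) - 1\<bar> powr p)"
      by (subst wint_cmult) (auto simp: epow_ennreal mult.commute)
    also have "ennreal (2 powr p) * (\<dots> + ennreal (2 powr p) *
        (wint (\<lambda>x. ennreal ?c * ?J x) + wint (\<lambda>x. ennreal ?c * far_part \<alpha> W x))) \<le> ?b \<alpha>"
    proof (intro mult_left_mono add_mono order_refl)
      have "wint (\<lambda>x. ennreal ?c * ?J x) = ennreal (?c powr p) * wint ?J"
        using c by (subst wint_cmult) (auto simp: epow_ennreal)
      also have "\<dots> \<le> ennreal (?c powr p) * (ennreal ((1 / (1 - \<alpha>)) powr (p - 1)) * ?I \<alpha>)"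
        unfolding N_def by (intro mult_left_mono wint_near_average a qm) auto
      also have "\<dots> = ennreal ((?c / (1 - \<alpha>)) powr p) * (ennreal (1 - \<alpha>) * ?I \<alpha>)"
        using a c by (simp add: ennreal_mult_collapse powr_divide powr_diff)
      also have "\<dots> \<le> ennreal (2 powr p) * (ennreal (1 - \<alpha>) * ?I \<alpha>)"
        using elim a c p by (intro mult_right_mono ennreal_leI powr_mono2) auto
      finally show "wint (\<lambda>x. ennreal ?c * ?J x) \<le> ennreal (2 powr p) * (ennreal (1 - \<alpha>) * ?I \<alpha>)" .
      have "wint (\<lambda>x. ennreal ?c * far_part \<alpha> W x) = ennreal (?c powr p) * wint (far_part \<alpha> W)"
        using c by (subst wint_cmult) (auto simp: epow_ennreal)
      also have "\<dots> \<le> ennreal (?c powr p) * (ennreal (farC * (1 / \<alpha>) powr p) * wabs W)"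
        using a by (intro mult_left_mono wint_far_part) auto
      also have "\<dots> \<le> ennreal (?c powr p) * (ennreal (farC * 2 powr p) * wabs W)"
        using elim farC_pos p a
        by (intro mult_left_mono mult_right_mono ennreal_leI powr_mono2) (auto simp: divide_le_eq)
      finally show "wint (\<lambda>x. ennreal ?c * far_part \<alpha> W x) \<le> (ennreal (farC * 2 powr p) * wabs W) * ennreal (?c powr p)"
        by (simp add: mult.commute)
    qed auto
    finally show ?case .
  qed
  then show ?thesis
    by (rule tendsto_sandwich[OF always_eventually _ tendsto_const, rotated]) (use b in auto)
qed

end

section \<open>Duality with one-sided Schwartz functions\<close>

text \<open>The decay of the right fractional derivative of a Schwartz function supported in \<open>(- \<infinity>, A]\<close>. The kernel decays
like \<open>t\<^sup>-\<^sup>1\<^sup>-\<^sup>\<alpha>\<close> at infinity, and no faster decay of the derivative can be expected.\<close>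
definition left_decay :: "real \<Rightarrow> real \<Rightarrow> real \<Rightarrow> real" where
  "left_decay A \<alpha> x = (if x \<le> A then (1 + A - x) powr - (1 + \<alpha>) else 0)"

lemma left_decay_nonneg: "0 \<le> left_decay A \<alpha> x"
  by (simp add: left_decay_def)

lemma left_decay_measurable [measurable]: "left_decay A \<alpha> \<in> borel_measurable borel"
  unfolding left_decay_def by measurable

lemma left_decay_antimono: "\<alpha> \<le> \<beta> \<Longrightarrow> left_decay A \<beta> x \<le> left_decay A \<alpha> x"
  unfolding left_decay_def by (auto intro!: powr_mono)

lemma weighted_bound_of_schwartz:
  fixes f :: "real \<Rightarrow> real"
  assumes "\<And>k. bounded (range (\<lambda>x. x ^ k * f x))"
  shows "\<exists>C>0. \<forall>x\<le>A. \<bar>f x\<bar> * (1 + A - x) ^ k \<le> C"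
proof -
  obtain B0 where B0: "\<And>x. \<bar>x ^ 0 * f x\<bar> \<le> B0" using assms[of 0] unfolding bounded_iff by auto
  obtain Bk where Bk: "\<And>x. \<bar>x ^ k * f x\<bar> \<le> Bk" using assms[of k] unfolding bounded_iff by auto
  let ?C = "2 ^ k * ((1 + \<bar>A\<bar>) ^ k * B0 + Bk) + 1"
  have "\<bar>f x\<bar> * (1 + A - x) ^ k \<le> ?C" if "x \<le> A" for x
  proof -
    have "1 + A - x \<le> 2 * max (1 + \<bar>A\<bar>) \<bar>x\<bar>" by (auto simp: max_def)
    then have "(1 + A - x) ^ k \<le> (2 * max (1 + \<bar>A\<bar>) \<bar>x\<bar>) ^ k" using that by (intro power_mono) auto
    also have "\<dots> \<le> 2 ^ k * ((1 + \<bar>A\<bar>) ^ k + \<bar>x\<bar> ^ k)" by (simp add: power_mult_distrib max_def)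
    finally have "\<bar>f x\<bar> * (1 + A - x) ^ k \<le> \<bar>f x\<bar> * (2 ^ k * ((1 + \<bar>A\<bar>) ^ k + \<bar>x\<bar> ^ k))"
      by (intro mult_left_mono) auto
    also have "\<dots> = 2 ^ k * ((1 + \<bar>A\<bar>) ^ k * \<bar>x ^ 0 * f x\<bar> + \<bar>x ^ k * f x\<bar>)"
      by (simp add: algebra_simps abs_mult power_abs)
    also have "\<dots> \<le> 2 ^ k * ((1 + \<bar>A\<bar>) ^ k * B0 + Bk)"
      by (intro mult_left_mono add_mono B0 Bk) auto
    finally show ?thesis by simp
  qed
  moreover have "0 \<le> B0" "0 \<le> Bk" using B0[of 0] Bk[of 0] by linarith+
  then have "0 < ?C" by (intro add_nonneg_pos mult_nonneg_nonneg add_nonneg_nonneg) auto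
  ultimately show ?thesis by blast
qed

lemma schwartz_minus_decay:
  assumes "\<phi> \<in> schwartz_minus"
  obtains A C where "smooth \<phi>" "0 < C" "\<forall>x>A. \<phi> x = 0 \<and> deriv \<phi> x = 0"
    "\<forall>x\<le>A. \<bar>\<phi> x\<bar> * (1 + A - x) ^ 4 \<le> C \<and> \<bar>deriv \<phi> x\<bar> * (1 + A - x) ^ 2 \<le> C"
proof -
  from assms obtain A where sch: "schwartz \<phi>" and A: "supp \<phi> \<subseteq> {..A}" by (auto simp: schwartz_minus_def)
  then have sm: "smooth \<phi>" and bd: "\<And>k n. bounded (range (\<lambda>x. x ^ k * (deriv ^^ n) \<phi> x))"
    by (auto simp: schwartz_def)
  have z: "\<phi> x = 0" if "A < x" for x
  proof (rule ccontr)
    assume "\<phi> x \<noteq> 0"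
    then have "x \<in> supp \<phi>" using closure_subset[of "support_on UNIV \<phi>"] by (auto simp: supp_def support_on_def)
    with A that show False by auto
  qed
  have z': "deriv \<phi> x = 0" if "A < x" for x
  proof -
    have "\<forall>\<^sub>F y in nhds x. \<phi> y = 0"
      using eventually_nhds_in_open[of "{A<..}" x] that by (auto elim!: eventually_mono intro: z)
    then have "deriv \<phi> x = deriv (\<lambda>_. 0) x" by (rule deriv_cong_ev) simp
    then show ?thesis by simp
  qed
  obtain C0 where C0: "0 < C0" "\<And>x. x \<le> A \<Longrightarrow> \<bar>\<phi> x\<bar> * (1 + A - x) ^ 4 \<le> C0"
    using weighted_bound_of_schwartz[of \<phi> A 4] bd[of _ 0] by auto
  obtain C1 where C1: "\<And>x. x \<le> A \<Longrightarrow> \<bar>deriv \<phi> x\<bar> * (1 + A - x) ^ 2 \<le> C1"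
    using weighted_bound_of_schwartz[of "deriv \<phi>" A 2] bd[of _ 1] by auto
  show ?thesis
  proof (rule that[of "max C0 C1" A])
    show "0 < max C0 C1" using C0 by auto
    show "\<forall>x\<le>A. \<bar>\<phi> x\<bar> * (1 + A - x) ^ 4 \<le> max C0 C1 \<and> \<bar>deriv \<phi> x\<bar> * (1 + A - x) ^ 2 \<le> max C0 C1"
      using C0(2) C1 by (auto intro: max.coboundedI1 max.coboundedI2)
  qed (use sm z z' in auto)
qed

lemma frac_right_reflect: "frac_right \<alpha> \<phi> x = frac_deriv \<alpha> (\<lambda>y. \<phi> (- y)) (- x)"
proof -
  have "(LBINT t:{x<..}. (\<phi> x - \<phi> t) / (t - x) powr (1 + \<alpha>)) = (LBINT s:{0<..}. (\<phi> x - \<phi> (x + s)) / s powr (1 + \<alpha>))"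
    unfolding set_lebesgue_integral_def
    by (subst lborel_integral_real_affine[where c = 1 and t = x])
       (auto intro!: Bochner_Integration.integral_cong simp: indicator_def)
  then show ?thesis by (simp add: frac_right_def frac_deriv_def add.commute)
qed

text \<open>With \<open>y = 1 + A - x\<close>: increments over a length at most \<open>1\<close> are bounded by the derivative, which is of order
\<open>y\<^sup>-\<^sup>2\<close>. For longer increments the term with \<open>\<phi>(x)\<close> decays rapidly, and the one with \<open>\<phi>(x + s)\<close> is estimated through
\<open>y \<le> 2 s v\<close> with \<open>v = 1 + A - (x + s)\<close>, which trades powers of \<open>s\<close> for powers of \<open>y\<close> at the cost of powers
of \<open>v\<close>; the decay of \<open>\<phi>\<close> in \<open>v\<close> leaves an integrable function.\<close>
lemma frac_right_integrand_decay:
  assumes D: "\<And>x. (\<phi> has_real_derivative \<phi>' x) (at x)"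
    and C: "0 < C" and z: "\<And>x. A < x \<Longrightarrow> \<phi> x = 0" "\<And>x. A < x \<Longrightarrow> \<phi>' x = 0"
    and d: "\<And>x. x \<le> A \<Longrightarrow> \<bar>\<phi> x\<bar> * (1 + A - x) ^ 4 \<le> C" "\<And>x. x \<le> A \<Longrightarrow> \<bar>\<phi>' x\<bar> * (1 + A - x) ^ 2 \<le> C"
    and a: "0 < \<alpha>" "\<alpha> < 1"
  shows "near_part \<alpha> (\<lambda>y. \<phi> (- y)) (- x) + far_part \<alpha> (\<lambda>y. \<phi> (- y)) (- x) \<le>
     ennreal (4 * C * (1 / (1 - \<alpha>) + 1 / \<alpha> + 1)) * ennreal (left_decay A \<alpha> x)"
proof (cases "x \<le> A")
  case False
  then have "near_part \<alpha> (\<lambda>y. \<phi> (- y)) (- x) = (\<integral>\<^sup>+s. 0 \<partial>(lborel :: real measure))"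
    "far_part \<alpha> (\<lambda>y. \<phi> (- y)) (- x) = (\<integral>\<^sup>+s. 0 \<partial>(lborel :: real measure))"
    unfolding near_part_def far_part_def by (intro nn_integral_cong; auto simp: z indicator_def)+
  then show ?thesis by simp
next
  case True
  define y where "y = 1 + A - x"
  have y: "1 \<le> y" using True by (simp add: y_def)
  define \<rho> where "\<rho> = left_decay A \<alpha> x"
  have rho: "\<rho> = y powr - (1 + \<alpha>)" using True by (simp add: \<rho>_def left_decay_def y_def)
  have r0: "0 \<le> \<rho>" by (simp add: rho)
  have c: "continuous_on UNIV \<phi>" using D by (meson DERIV_isCont continuous_at_imp_continuous_on)
  have [measurable]: "\<phi> \<in> borel_measurable borel" using c by (rule borel_measurable_continuous_onI)
  have y2: "1 / y ^ 2 \<le> \<rho>"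
  proof -
    have "1 / y ^ 2 = y powr - 2" using y by (simp add: powr_minus_divide powr_numeral)
    also have "\<dots> \<le> \<rho>" unfolding rho using y a by (intro powr_mono) auto
    finally show ?thesis .
  qed
  have y4: "1 / y ^ 4 \<le> \<rho>"
  proof -
    have "1 / y ^ 4 \<le> 1 / y ^ 2" using y by (intro divide_left_mono power_increasing) auto
    with y2 show ?thesis by linarith
  qed
  have lip: "\<bar>\<phi> x - \<phi> (x + s)\<bar> \<le> s * (4 * C * \<rho>)" if s: "0 < s" "s \<le> 1" for s
  proof -
    obtain \<xi> where xi: "x < \<xi>" "\<xi> < x + s" "\<phi> (x + s) - \<phi> x = (x + s - x) * \<phi>' \<xi>"
      using MVT2[of x "x + s" \<phi> \<phi>'] s D by auto
    have "\<bar>\<phi>' \<xi>\<bar> \<le> 4 * C * (1 / y ^ 2)"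
    proof (cases "\<xi> \<le> A")
      case True
      have "y / 2 \<le> 1 + A - \<xi>" using xi s True y by (simp add: y_def field_simps)
      then have "(y / 2) ^ 2 \<le> (1 + A - \<xi>) ^ 2" using y by (intro power_mono) auto
      then have "\<bar>\<phi>' \<xi>\<bar> * (y / 2) ^ 2 \<le> \<bar>\<phi>' \<xi>\<bar> * (1 + A - \<xi>) ^ 2" by (intro mult_left_mono) auto
      also have "\<dots> \<le> C" by (rule d(2)[OF True])
      finally show ?thesis using y by (simp add: field_simps)
    next
      case False
      then show ?thesis using z(2)[of \<xi>] C y by simp
    qed
    also have "\<dots> \<le> 4 * C * \<rho>" using C y2 by (intro mult_left_mono) auto
    finally have "s * \<bar>\<phi>' \<xi>\<bar> \<le> s * (4 * C * \<rho>)" using s by (intro mult_left_mono) auto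
    moreover have "\<bar>\<phi> x - \<phi> (x + s)\<bar> = s * \<bar>\<phi>' \<xi>\<bar>"
      using s by (subst abs_minus_commute) (simp add: xi(3) abs_mult)
    ultimately show ?thesis by simp
  qed
  have near: "near_part \<alpha> (\<lambda>y. \<phi> (- y)) (- x) \<le> ennreal (4 * C * \<rho>) * ennreal (1 / (1 - \<alpha>))"
  proof -
    have "near_part \<alpha> (\<lambda>y. \<phi> (- y)) (- x) \<le> (\<integral>\<^sup>+s. ennreal (4 * C * \<rho>) * (ennreal (s powr - \<alpha>) * indicator {0<..1} s) \<partial>lborel)"
      unfolding near_part_def
    proof (rule nn_integral_mono)
      fix s :: real
      show "ennreal \<bar>(\<phi> (- (- x)) - \<phi> (- (- x - s))) / s powr (1 + \<alpha>)\<bar> * indicator {0<..1} s \<le>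
         ennreal (4 * C * \<rho>) * (ennreal (s powr - \<alpha>) * indicator {0<..1} s)"
      proof (cases "s \<in> {0<..1}")
        case s: True
        have "\<bar>\<phi> x - \<phi> (x + s)\<bar> / s powr (1 + \<alpha>) \<le> s * (4 * C * \<rho>) / s powr (1 + \<alpha>)"
          using lip[of s] s by (intro divide_right_mono) auto
        also have "\<dots> = 4 * C * \<rho> * s powr - \<alpha>" using s by (simp add: powr_add powr_minus field_simps)
        finally have "ennreal (\<bar>\<phi> x - \<phi> (x + s)\<bar> / s powr (1 + \<alpha>)) \<le> ennreal (4 * C * \<rho>) * ennreal (s powr - \<alpha>)"
          using C r0 by (simp add: ennreal_leI flip: ennreal_mult)
        then show ?thesis using s by (simp add: add.commute abs_divide)
      qed simp
    qed
    also have "\<dots> = ennreal (4 * C * \<rho>) * ennreal (1 / (1 - \<alpha>))"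
      using nn_integral_powr_from_0[OF a(2)] by (subst nn_integral_cmult) auto
    finally show ?thesis .
  qed
  have far: "far_part \<alpha> (\<lambda>y. \<phi> (- y)) (- x) \<le> ennreal (C * \<rho>) * ennreal (1 / \<alpha>) + ennreal (4 * C * \<rho>) * ennreal 1"
  proof -
    let ?F = "\<lambda>u. ennreal (u powr - (1 + 1)) * indicator {1..} u"
    have "far_part \<alpha> (\<lambda>y. \<phi> (- y)) (- x) \<le> (\<integral>\<^sup>+s. ennreal (C * \<rho>) * (ennreal (s powr - (1 + \<alpha>)) * indicator {1..} s) +
       ennreal (4 * C * \<rho>) * ?F (y - s) \<partial>lborel)"
      unfolding far_part_def
    proof (rule nn_integral_mono)
      fix s :: real
      show "ennreal \<bar>(\<phi> (- (- x)) - \<phi> (- (- x - s))) / s powr (1 + \<alpha>)\<bar> * indicator {1<..} s \<le>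
         ennreal (C * \<rho>) * (ennreal (s powr - (1 + \<alpha>)) * indicator {1..} s) + ennreal (4 * C * \<rho>) * ?F (y - s)"
      proof (cases "1 < s")
        case s: True
        have i: "1 / s powr (1 + \<alpha>) = s powr - (1 + \<alpha>)" by (subst powr_minus_divide) simp
        have 1: "\<bar>\<phi> x\<bar> / s powr (1 + \<alpha>) \<le> C * \<rho> * s powr - (1 + \<alpha>)"
        proof -
          have "\<bar>\<phi> x\<bar> \<le> C * (1 / y ^ 4)" using d(1)[OF True] y by (simp add: y_def field_simps)
          also have "\<dots> \<le> C * \<rho>" using C y4 by (intro mult_left_mono) auto
          finally show ?thesis unfolding i[symmetric] by (simp add: divide_right_mono)
        qed
        have 2: "\<bar>\<phi> (x + s)\<bar> / s powr (1 + \<alpha>) \<le> 4 * C * \<rho> * ((y - s) powr - (1 + 1) * indicator {1..} (y - s))"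
        proof (cases "x + s \<le> A")
          case t: True
          define v where "v = y - s"
          have v: "1 \<le> v" using t by (simp add: v_def y_def)
          have "y \<le> 2 * (s * v)"
          proof -
            have "0 \<le> (s - 1) * (v - 1)" using s v by (intro mult_nonneg_nonneg) auto
            then have "s + v \<le> s * v + 1" by (simp add: algebra_simps)
            moreover have "1 \<le> s * v" using s v mult_mono[of 1 s 1 v] by auto
            ultimately show ?thesis by (simp add: v_def)
          qed
          then have "y powr (1 + \<alpha>) \<le> (2 * (s * v)) powr (1 + \<alpha>)" using y a by (intro powr_mono2) auto
          also have "\<dots> = 2 powr (1 + \<alpha>) * (s powr (1 + \<alpha>) * v powr (1 + \<alpha>))" using s v by (simp add: powr_mult)
          also have "\<dots> \<le> 2 powr 2 * (s powr (1 + \<alpha>) * v powr 2)"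
            using a s v by (intro mult_mono powr_mono) auto
          also have "\<dots> = 4 * v ^ 2 * s powr (1 + \<alpha>)" using v by (simp add: powr_numeral)
          finally have "1 \<le> 4 * v ^ 2 * s powr (1 + \<alpha>) / y powr (1 + \<alpha>)" using y by simp
          then have k: "1 / s powr (1 + \<alpha>) \<le> 4 * v ^ 2 * \<rho>"
            using s y by (simp add: rho powr_minus_divide[of y "1 + \<alpha>"] divide_le_eq mult_ac del: minus_add_distrib)
          have "\<bar>\<phi> (x + s)\<bar> * v ^ 4 \<le> C" using d(1)[OF t] by (simp add: v_def y_def algebra_simps)
          then have "\<bar>\<phi> (x + s)\<bar> \<le> C / v ^ 4" using v by (simp add: pos_le_divide_eq)
          then have "\<bar>\<phi> (x + s)\<bar> * (1 / s powr (1 + \<alpha>)) \<le> C / v ^ 4 * (4 * v ^ 2 * \<rho>)"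
            using k C v by (intro mult_mono) auto
          also have "\<dots> = 4 * C * \<rho> * (1 / v ^ 2)" using v by (simp add: power2_eq_square power4_eq_xxxx)
          also have "1 / v ^ 2 = v powr - (1 + 1)" using v by (simp add: powr_minus_divide powr_numeral)
          finally show ?thesis using v by (simp add: v_def)
        next
          case False
          then show ?thesis using z(1)[of "x + s"] C r0 by simp
        qed
        have "\<bar>(\<phi> x - \<phi> (x + s)) / s powr (1 + \<alpha>)\<bar> \<le> \<bar>\<phi> x\<bar> / s powr (1 + \<alpha>) + \<bar>\<phi> (x + s)\<bar> / s powr (1 + \<alpha>)"
          by (simp add: abs_divide add_divide_distrib[symmetric] divide_right_mono)
        also have "\<dots> \<le> C * \<rho> * s powr - (1 + \<alpha>) + 4 * C * \<rho> * ((y - s) powr - (1 + 1) * indicator {1..} (y - s))"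
          using 1 2 by (rule add_mono)
        finally have "ennreal \<bar>(\<phi> x - \<phi> (x + s)) / s powr (1 + \<alpha>)\<bar> \<le> ennreal \<dots>" by (rule ennreal_leI)
        also have "\<dots> = ennreal (C * \<rho>) * ennreal (s powr - (1 + \<alpha>)) + ennreal (4 * C * \<rho>) * ?F (y - s)"
          using C r0 by (subst ennreal_plus) (auto simp: ennreal_mult indicator_def simp del: minus_add_distrib)
        finally show ?thesis using s by (simp add: add.commute)
      qed simp
    qed
    also have "\<dots> = ennreal (C * \<rho>) * ennreal (1 / \<alpha>) + ennreal (4 * C * \<rho>) * (\<integral>\<^sup>+s. ?F (y - s) \<partial>lborel)"
      using nn_integral_powr_to_infinity[OF a(1), of 1]
      by (subst nn_integral_add) (auto simp: nn_integral_cmult)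
    also have "(\<integral>\<^sup>+s. ?F (y - s) \<partial>lborel) = (\<integral>\<^sup>+u. ?F u \<partial>lborel)"
      by (rule nn_integral_reflect[symmetric]) measurable
    also have "\<dots> = ennreal 1" using nn_integral_powr_to_infinity[of 1 1] by simp
    finally show ?thesis .
  qed
  have "near_part \<alpha> (\<lambda>y. \<phi> (- y)) (- x) + far_part \<alpha> (\<lambda>y. \<phi> (- y)) (- x) \<le>
     ennreal (4 * C * \<rho>) * ennreal (1 / (1 - \<alpha>)) + (ennreal (C * \<rho>) * ennreal (1 / \<alpha>) + ennreal (4 * C * \<rho>) * ennreal 1)"
    by (intro add_mono near far)
  also have "\<dots> = ennreal (4 * C * \<rho> * (1 / (1 - \<alpha>)) + (C * \<rho> * (1 / \<alpha>) + 4 * C * \<rho> * 1))"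
    using a C r0 by (simp flip: ennreal_mult ennreal_plus)
  also have "\<dots> \<le> ennreal (4 * C * (1 / (1 - \<alpha>) + 1 / \<alpha> + 1) * \<rho>)"
  proof (rule ennreal_leI)
    have "0 \<le> C * \<rho> * (1 / \<alpha>)" using C r0 a by simp
    then have "C * \<rho> * (1 / \<alpha>) \<le> 4 * (C * \<rho> * (1 / \<alpha>))" by linarith
    then show "4 * C * \<rho> * (1 / (1 - \<alpha>)) + (C * \<rho> * (1 / \<alpha>) + 4 * C * \<rho> * 1) \<le> 4 * C * (1 / (1 - \<alpha>) + 1 / \<alpha> + 1) * \<rho>"
      by (simp add: algebra_simps)
  qed
  also have "\<dots> = ennreal (4 * C * (1 / (1 - \<alpha>) + 1 / \<alpha> + 1)) * ennreal \<rho>"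
    using C a r0 by (intro ennreal_mult) auto
  finally show ?thesis by (simp add: \<rho>_def)
qed

text \<open>The constants \<open>A\<close> and \<open>M\<close> serve all \<open>\<alpha>\<close> at once. This uniformity provides the common bound for the limit
at \<open>\<alpha> = 1\<close> of the pairings.\<close>
definition left_decay_bounds :: "(real \<Rightarrow> real) \<Rightarrow> real \<Rightarrow> real \<Rightarrow> bool" where
  "left_decay_bounds \<phi> A M \<longleftrightarrow> (\<forall>x \<alpha>. 0 < \<alpha> \<longrightarrow> \<alpha> < 1 \<longrightarrow> \<bar>\<phi> x\<bar> \<le> M * left_decay A \<alpha> x \<and>
     ennreal (frac_const \<alpha>) * (near_part \<alpha> (\<lambda>y. \<phi> (- y)) (- x) + far_part \<alpha> (\<lambda>y. \<phi> (- y)) (- x))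
       \<le> ennreal (M * left_decay A \<alpha> x))"

lemma schwartz_minus_bounds:
  assumes "\<phi> \<in> schwartz_minus"
  obtains A M where "smooth \<phi>" "0 < M" "left_decay_bounds \<phi> A M"
proof -
  obtain A C where sm: "smooth \<phi>" and C: "0 < C" and zz: "\<forall>x>A. \<phi> x = 0 \<and> deriv \<phi> x = 0"
    and dd: "\<forall>x\<le>A. \<bar>\<phi> x\<bar> * (1 + A - x) ^ 4 \<le> C \<and> \<bar>deriv \<phi> x\<bar> * (1 + A - x) ^ 2 \<le> C"
    by (rule schwartz_minus_decay[OF assms])
  have z: "\<phi> x = 0" "deriv \<phi> x = 0" if "A < x" for x using zz that by auto
  have d: "\<bar>\<phi> x\<bar> * (1 + A - x) ^ 4 \<le> C" "\<bar>deriv \<phi> x\<bar> * (1 + A - x) ^ 2 \<le> C" if "x \<le> A" for x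
    using dd that by auto
  obtain G where G: "0 < G" "\<And>\<alpha>. 0 < \<alpha> \<Longrightarrow> \<alpha> < 1 \<Longrightarrow> frac_const \<alpha> \<le> G * (\<alpha> * (1 - \<alpha>))"
    using frac_const_bound by blast
  define M where "M = max C (8 * C * G)"
  show ?thesis
  proof (rule that[of M A])
    show "smooth \<phi>" by (rule sm)
    show "0 < M" using C by (auto simp: M_def)
    show "left_decay_bounds \<phi> A M"
      unfolding left_decay_bounds_def
    proof (intro allI impI conjI)
      fix x \<alpha> :: real assume a: "0 < \<alpha>" "\<alpha> < 1"
      show "\<bar>\<phi> x\<bar> \<le> M * left_decay A \<alpha> x"
      proof (cases "x \<le> A")
        case True
        define y where "y = 1 + A - x"
        have y: "1 \<le> y" using True by (simp add: y_def)
        have "y powr (1 + \<alpha>) \<le> y powr 4" using y a by (intro powr_mono) auto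
        then have "\<bar>\<phi> x\<bar> * y powr (1 + \<alpha>) \<le> \<bar>\<phi> x\<bar> * y powr 4" by (intro mult_left_mono) auto
        also have "\<dots> \<le> C" using d(1)[OF True] y by (simp add: y_def powr_numeral)
        also have "\<dots> \<le> M" by (simp add: M_def)
        finally have "\<bar>\<phi> x\<bar> \<le> M / y powr (1 + \<alpha>)" using y by (simp add: pos_le_divide_eq)
        then show ?thesis using True by (simp add: left_decay_def y_def powr_minus_divide[of _ "1 + \<alpha>"] del: minus_add_distrib)
      qed (simp add: z left_decay_def)
      have c: "0 < frac_const \<alpha>" by (rule frac_const_pos[OF a])
      have "ennreal (frac_const \<alpha>) * (near_part \<alpha> (\<lambda>y. \<phi> (- y)) (- x) + far_part \<alpha> (\<lambda>y. \<phi> (- y)) (- x)) \<le>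
        ennreal (frac_const \<alpha>) * (ennreal (4 * C * (1 / (1 - \<alpha>) + 1 / \<alpha> + 1)) * ennreal (left_decay A \<alpha> x))"
        by (intro mult_left_mono frac_right_integrand_decay[OF smooth_DERIV[OF sm] C z d a]) auto
      also have "\<dots> = ennreal (frac_const \<alpha> * (4 * C * (1 / (1 - \<alpha>) + 1 / \<alpha> + 1)) * left_decay A \<alpha> x)"
        using c C a left_decay_nonneg by (simp add: ennreal_mult mult.assoc del: ennreal_plus)
      also have "\<dots> \<le> ennreal (M * left_decay A \<alpha> x)"
      proof (intro ennreal_leI mult_right_mono left_decay_nonneg)
        have "frac_const \<alpha> * (4 * C * (1 / (1 - \<alpha>) + 1 / \<alpha> + 1)) \<le> G * (\<alpha> * (1 - \<alpha>)) * (4 * C * (1 / (1 - \<alpha>) + 1 / \<alpha> + 1))"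
          using G(2)[OF a] C a by (intro mult_right_mono) auto
        also have "\<dots> = 4 * C * G * (\<alpha> + (1 - \<alpha>) + \<alpha> * (1 - \<alpha>))"
          using a by (simp add: field_simps)
        also have "\<dots> \<le> 4 * C * G * 2"
          using C G(1) a by (intro mult_left_mono) (auto simp: mult_le_one)
        also have "\<dots> \<le> M" by (simp add: M_def)
        finally show "frac_const \<alpha> * (4 * C * (1 / (1 - \<alpha>) + 1 / \<alpha> + 1)) \<le> M" .
      qed
      finally show "ennreal (frac_const \<alpha>) * (near_part \<alpha> (\<lambda>y. \<phi> (- y)) (- x) + far_part \<alpha> (\<lambda>y. \<phi> (- y)) (- x)) \<le>
        ennreal (M * left_decay A \<alpha> x)" .
    qed
  qed
qed

lemma test_function_schwartz_minus:
  assumes "\<phi> \<in> test_functions" shows "\<phi> \<in> schwartz_minus"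
proof -
  from test_functionE[OF assms] obtain R where sm: "smooth \<phi>" and R: "0 < R" "\<And>x. x \<notin> {-R..R} \<Longrightarrow> \<phi> x = 0" by blast
  have sn: "smooth ((deriv ^^ n) \<phi>) \<and> (\<forall>x. x \<notin> {-R..R} \<longrightarrow> (deriv ^^ n) \<phi> x = 0)" for n
  proof (induction n)
    case (Suc n)
    then show ?case using deriv_zero_outside[of "(deriv ^^ n) \<phi>" R] smooth_deriv by auto
  qed (use sm R in auto)
  have "bounded (range (\<lambda>x. x ^ k * (deriv ^^ n) \<phi> x))" for k n
  proof -
    have "bounded ((\<lambda>x. x ^ k * (deriv ^^ n) \<phi> x) ` {-R..R})"
      using sn[of n] by (intro compact_imp_bounded compact_continuous_image compact_Icc continuous_intros smooth_continuous) auto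
    moreover have "range (\<lambda>x. x ^ k * (deriv ^^ n) \<phi> x) \<subseteq> insert 0 ((\<lambda>x. x ^ k * (deriv ^^ n) \<phi> x) ` {-R..R})"
    proof
      fix v assume "v \<in> range (\<lambda>x. x ^ k * (deriv ^^ n) \<phi> x)"
      then obtain x where v: "v = x ^ k * (deriv ^^ n) \<phi> x" by blast
      show "v \<in> insert 0 ((\<lambda>x. x ^ k * (deriv ^^ n) \<phi> x) ` {-R..R})"
        using sn[of n] v by (cases "x \<in> {-R..R}") auto
    qed
    ultimately show ?thesis by (meson bounded_insert bounded_subset)
  qed
  moreover have "supp \<phi> \<subseteq> {..R}"
    unfolding supp_def by (rule closure_minimal) (use R in \<open>force simp: support_on_def\<close>)+
  ultimately show ?thesis using sm by (auto simp: schwartz_minus_def schwartz_def)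
qed

context one_sided_weight begin

text \<open>The pairing is at most the convolution of \<open>\<bar>w\<bar>\<close> with the tail kernel at the point \<open>A\<close>.\<close>
lemma left_decay_pairing_finite:
  assumes [measurable]: "w \<in> borel_measurable borel" and fin: "wabs w < top" and a: "0 < \<alpha>"
  shows "(\<integral>\<^sup>+x. ennreal \<bar>w x\<bar> * ennreal (left_decay A \<alpha> x) \<partial>lborel) < top"
proof -
  have "(\<integral>\<^sup>+x. ennreal \<bar>w x\<bar> * ennreal (left_decay A \<alpha> x) \<partial>lborel) =
      (\<integral>\<^sup>+s. ennreal \<bar>w (A - s)\<bar> * ennreal (left_decay A \<alpha> (A - s)) \<partial>lborel)"
    by (rule nn_integral_reflect) measurable
  also have "\<dots> \<le> (\<integral>\<^sup>+s\<in>{0<..}. tail_kernel \<alpha> s * ennreal \<bar>w (A - s)\<bar> \<partial>lborel)"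
  proof (rule nn_integral_mono_AE)
    have "AE s in lborel. s \<noteq> (0::real)" by (rule AE_lborel_singleton)
    then show "AE s in lborel. ennreal \<bar>w (A - s)\<bar> * ennreal (left_decay A \<alpha> (A - s)) \<le>
        tail_kernel \<alpha> s * ennreal \<bar>w (A - s)\<bar> * indicator {0<..} s"
    proof eventually_elim
      case (elim s)
      show ?case
      proof (cases "0 < s")
        case True
        have "(1 + s) powr - (1 + \<alpha>) \<le> 1 powr - (1 + \<alpha>)" "(1 + s) powr - (1 + \<alpha>) \<le> s powr - (1 + \<alpha>)"
          using True a by (intro powr_mono2'; simp)+
        then have "left_decay A \<alpha> (A - s) \<le> min 1 (s powr - (1 + \<alpha>))" using True by (simp add: left_decay_def)
        then have "ennreal (left_decay A \<alpha> (A - s)) \<le> tail_kernel \<alpha> s"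
          unfolding tail_kernel_def by (rule ennreal_leI)
        then show ?thesis using True by (subst mult.commute) (simp add: mult_right_mono)
      next
        case False
        then show ?thesis using elim by (simp add: left_decay_def)
      qed
    qed
  qed
  also have "\<dots> < top" by (rule tail_convolution_finite[OF assms])
  finally show ?thesis .
qed

lemma schwartz_pairing_integrable:
  assumes [measurable]: "w \<in> borel_measurable borel" and fin: "wabs w < top" and "\<phi> \<in> schwartz_minus"
  shows "integrable lborel (\<lambda>x. w x * \<phi> x)"
proof -
  obtain A M where sm: "smooth \<phi>" and M: "0 < M" and lb: "left_decay_bounds \<phi> A M"
    by (rule schwartz_minus_bounds[OF assms(3)])
  have b: "\<bar>\<phi> x\<bar> \<le> M * left_decay A \<alpha> x" if "0 < \<alpha>" "\<alpha> < 1" for x \<alpha>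
    using lb that by (simp add: left_decay_bounds_def)
  have [measurable]: "\<phi> \<in> borel_measurable borel" by (rule smooth_borel[OF sm])
  show ?thesis
  proof (rule integrableI_bounded)
    have "(\<integral>\<^sup>+x. ennreal (norm (w x * \<phi> x)) \<partial>lborel) \<le> (\<integral>\<^sup>+x. ennreal M * (ennreal \<bar>w x\<bar> * ennreal (left_decay A (1/2) x)) \<partial>lborel)"
    proof (rule nn_integral_mono)
      fix x
      have "\<bar>w x * \<phi> x\<bar> \<le> M * (\<bar>w x\<bar> * left_decay A (1/2) x)"
        using mult_left_mono[OF b[of "1/2" x], of "\<bar>w x\<bar>"] by (simp add: abs_mult mult_ac)
      then have "ennreal (norm (w x * \<phi> x)) \<le> ennreal (M * (\<bar>w x\<bar> * left_decay A (1/2) x))" by (simp add: ennreal_leI)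
      also have "\<dots> = ennreal M * (ennreal \<bar>w x\<bar> * ennreal (left_decay A (1/2) x))"
        using M left_decay_nonneg[of A "1/2" x] by (simp add: ennreal_mult)
      finally show "ennreal (norm (w x * \<phi> x)) \<le> \<dots>" .
    qed
    also have "\<dots> < \<infinity>"
      using left_decay_pairing_finite[OF assms(1) fin, of "1/2" A] by (simp add: nn_integral_cmult ennreal_mult_less_top)
    finally show "(\<integral>\<^sup>+x. ennreal (norm (w x * \<phi> x)) \<partial>lborel) < \<infinity>" .
  qed measurable
qed

text \<open>Fubini's theorem for the two double integrals with the increments kept together. Separately, the terms
\<open>W(x) \<phi>(x) s\<^sup>-\<^sup>1\<^sup>-\<^sup>\<alpha>\<close> and \<open>W(x) \<phi>(x + s) s\<^sup>-\<^sup>1\<^sup>-\<^sup>\<alpha>\<close> are not integrable at \<open>s = 0\<close>; they are separated only for fixed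
\<open>s\<close>, where a translation shows that the inner integrals agree.\<close>
theorem frac_deriv_duality:
  assumes W: "antiderivative W f" and fW: "wabs W < top" and ff: "wabs f < top"
    and a: "0 < \<alpha>" "\<alpha> < 1" and phi: "\<phi> \<in> schwartz_minus"
  shows "(\<integral>x. W x * frac_right \<alpha> \<phi> x \<partial>lborel) = (\<integral>x. frac_deriv \<alpha> W x * \<phi> x \<partial>lborel)"
proof -
  note [measurable] = antiderivative_borel[OF W]
  obtain A M where sm: "smooth \<phi>" and M: "0 < M" and lb: "left_decay_bounds \<phi> A M"
    by (rule schwartz_minus_bounds[OF phi])
  have b: "\<bar>\<phi> x\<bar> \<le> M * left_decay A \<alpha> x"
    and fb: "ennreal (frac_const \<alpha>) * (near_part \<alpha> (\<lambda>y. \<phi> (- y)) (- x) + far_part \<alpha> (\<lambda>y. \<phi> (- y)) (- x))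
      \<le> ennreal (M * left_decay A \<alpha> x)" for x
    using lb a unfolding left_decay_bounds_def by blast+
  have [measurable]: "\<phi> \<in> borel_measurable borel" by (rule smooth_borel[OF sm])
  let ?c = "frac_const \<alpha>"
  have c: "0 < ?c" by (rule frac_const_pos[OF a])
  have norm_eq: "ennreal (norm (indicator {0<..} s * (?c * (u * d)))) =
      ennreal \<bar>u\<bar> * (ennreal ?c * (ennreal \<bar>d\<bar> * indicator {0<..} s))" for u d s :: real
    using c by (cases "0 < s") (auto simp: abs_mult ennreal_mult mult_ac)
  let ?H = "\<lambda>x s. indicator {0<..} s * (?c * (W x * ((\<phi> x - \<phi> (x + s)) / s powr (1 + \<alpha>))))"
  let ?K = "\<lambda>x s. indicator {0<..} s * (?c * (\<phi> x * ((W x - W (x - s)) / s powr (1 + \<alpha>))))"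
  have Hint: "integrable (lborel \<Otimes>\<^sub>M lborel) (\<lambda>(x, s). ?H x s)"
  proof (rule integrableI_bounded)
    have "(\<integral>\<^sup>+z. ennreal (norm (case z of (x, s) \<Rightarrow> ?H x s)) \<partial>(lborel \<Otimes>\<^sub>M lborel)) =
        (\<integral>\<^sup>+x. (\<integral>\<^sup>+s. ennreal (norm (?H x s)) \<partial>lborel) \<partial>lborel)"
      by (subst lborel.nn_integral_fst[symmetric]) auto
    also have "\<dots> \<le> (\<integral>\<^sup>+x. ennreal M * (ennreal \<bar>W x\<bar> * ennreal (left_decay A \<alpha> x)) \<partial>lborel)"
    proof (rule nn_integral_mono)
      fix x
      have "(\<integral>\<^sup>+s. ennreal (norm (?H x s)) \<partial>lborel) =
        (\<integral>\<^sup>+s. ennreal \<bar>W x\<bar> * (ennreal ?c * (ennreal \<bar>(\<phi> (- (- x)) - \<phi> (- (- x - s))) / s powr (1 + \<alpha>)\<bar> * indicator {0<..} s)) \<partial>lborel)"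
        unfolding norm_eq by (simp add: add.commute)
      also have "\<dots> = ennreal \<bar>W x\<bar> * (ennreal ?c * (near_part \<alpha> (\<lambda>y. \<phi> (- y)) (- x) + far_part \<alpha> (\<lambda>y. \<phi> (- y)) (- x)))"
        by (subst near_far_split[symmetric], measurable) (simp add: nn_integral_cmult)
      also have "\<dots> \<le> ennreal \<bar>W x\<bar> * ennreal (M * left_decay A \<alpha> x)" by (intro mult_left_mono fb) auto
      also have "\<dots> = ennreal M * (ennreal \<bar>W x\<bar> * ennreal (left_decay A \<alpha> x))"
        using M left_decay_nonneg by (simp add: ennreal_mult mult_ac)
      finally show "(\<integral>\<^sup>+s. ennreal (norm (?H x s)) \<partial>lborel) \<le> \<dots>" .
    qed
    also have "\<dots> < \<infinity>"
      using left_decay_pairing_finite[OF _ fW a(1), of A] by (simp add: nn_integral_cmult ennreal_mult_less_top)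
    finally show "(\<integral>\<^sup>+z. ennreal (norm (case z of (x, s) \<Rightarrow> ?H x s)) \<partial>(lborel \<Otimes>\<^sub>M lborel)) < \<infinity>" .
  qed measurable
  \<comment> \<open>this dominates \<open>frac_deriv\<close>; being in the weighted space, it is integrable against the decay of \<open>\<phi>\<close>\<close>
  let ?g = "\<lambda>x. ennreal ?c * (near_part \<alpha> W x + far_part \<alpha> W x)"
  have gfin: "wint ?g < top"
  proof -
    obtain D where "wint ?g \<le> ennreal D * (wabs W + wabs f)"
      using wint_frac_deriv_uniform W a by blast
    also have "\<dots> < top" using fW ff by (simp add: ennreal_mult_less_top)
    finally show ?thesis .
  qed
  have gAE: "AE x in lborel. ?g x = ennreal \<bar>enn2real (?g x)\<bar>"
    using finite_AE_of_wint[OF _ gfin] by (auto elim!: eventually_mono)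
  have Kint: "integrable (lborel \<Otimes>\<^sub>M lborel) (\<lambda>(x, s). ?K x s)"
  proof (rule integrableI_bounded)
    have "(\<integral>\<^sup>+z. ennreal (norm (case z of (x, s) \<Rightarrow> ?K x s)) \<partial>(lborel \<Otimes>\<^sub>M lborel)) =
        (\<integral>\<^sup>+x. (\<integral>\<^sup>+s. ennreal (norm (?K x s)) \<partial>lborel) \<partial>lborel)"
      by (subst lborel.nn_integral_fst[symmetric]) auto
    also have "\<dots> = (\<integral>\<^sup>+x. ennreal \<bar>\<phi> x\<bar> * ?g x \<partial>lborel)"
    proof (rule nn_integral_cong)
      fix x
      have "(\<integral>\<^sup>+s. ennreal (norm (?K x s)) \<partial>lborel) =
        (\<integral>\<^sup>+s. ennreal \<bar>\<phi> x\<bar> * (ennreal ?c * (ennreal \<bar>(W x - W (x - s)) / s powr (1 + \<alpha>)\<bar> * indicator {0<..} s)) \<partial>lborel)"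
        unfolding norm_eq ..
      also have "\<dots> = ennreal \<bar>\<phi> x\<bar> * ?g x"
        by (subst near_far_split[symmetric], measurable) (simp add: nn_integral_cmult)
      finally show "(\<integral>\<^sup>+s. ennreal (norm (?K x s)) \<partial>lborel) = ennreal \<bar>\<phi> x\<bar> * ?g x" .
    qed
    also have "\<dots> \<le> (\<integral>\<^sup>+x. ennreal M * (ennreal \<bar>enn2real (?g x)\<bar> * ennreal (left_decay A \<alpha> x)) \<partial>lborel)"
    proof (rule nn_integral_mono_AE)
      show "AE x in lborel. ennreal \<bar>\<phi> x\<bar> * ?g x \<le> ennreal M * (ennreal \<bar>enn2real (?g x)\<bar> * ennreal (left_decay A \<alpha> x))"
        using gAE
      proof eventually_elim
        case (elim x)
        have "ennreal \<bar>\<phi> x\<bar> * ?g x \<le> ennreal (M * left_decay A \<alpha> x) * ?g x"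
          by (intro mult_right_mono ennreal_leI b) auto
        also have "\<dots> = ennreal M * (?g x * ennreal (left_decay A \<alpha> x))"
          using M left_decay_nonneg by (simp add: ennreal_mult mult_ac)
        finally show ?case using elim by simp
      qed
    qed
    also have "\<dots> < \<infinity>"
    proof -
      have "wabs (\<lambda>x. enn2real (?g x)) \<le> wint ?g"
        by (rule wint_mono_AE) (use gAE in \<open>auto elim!: eventually_mono\<close>)
      with gfin have "wabs (\<lambda>x. enn2real (?g x)) < top" by (rule le_less_trans[rotated])
      then show ?thesis
        using left_decay_pairing_finite[of "\<lambda>x. enn2real (?g x)" \<alpha> A] a
        by (simp add: nn_integral_cmult ennreal_mult_less_top)
    qed
    finally show "(\<integral>\<^sup>+z. ennreal (norm (case z of (x, s) \<Rightarrow> ?K x s)) \<partial>(lborel \<Otimes>\<^sub>M lborel)) < \<infinity>" .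
  qed measurable
  have Wphi: "integrable lborel (\<lambda>x. W x * \<phi> x)" by (intro schwartz_pairing_integrable fW phi) auto
  have inner: "AE s in lborel. (\<integral>x. ?H x s \<partial>lborel) = (\<integral>x. ?K x s \<partial>lborel)"
    using lborel_pair.AE_integrable_snd[OF Hint]
  proof eventually_elim
    case (elim s)
    show ?case
    proof (cases "0 < s")
      case True
      let ?k = "s powr (1 + \<alpha>)"
      have k: "0 < ?k" using True by simp
      have Hs: "integrable lborel (\<lambda>x. ?H x s)" using elim by (simp only: prod.case)
      \<comment> \<open>integrability of the translated product follows from that of the increment, for almost every \<open>s\<close>\<close>
      have "integrable lborel (\<lambda>x. W x * \<phi> x - ?k / ?c * ?H x s)"
        by (rule Bochner_Integration.integrable_diff[OF Wphi integrable_mult_right[OF Hs]])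
      moreover have "(\<lambda>x. W x * \<phi> x - ?k / ?c * ?H x s) = (\<lambda>x. W x * \<phi> (x + s))"
        using True k c by (auto simp: field_simps)
      ultimately have sh: "integrable lborel (\<lambda>x. W x * \<phi> (x + s))" by simp
      have sh': "integrable lborel (\<lambda>x. W (x - s) * \<phi> x)"
        using lborel_integrable_real_affine[OF sh, of 1 "- s"] by simp
      have eq: "(\<integral>x. W x * \<phi> (x + s) \<partial>lborel) = (\<integral>x. W (x - s) * \<phi> x \<partial>lborel)"
        by (subst lborel_integral_real_affine[where c = 1 and t = "- s"]) auto
      have "(\<integral>x. ?H x s \<partial>lborel) = (\<integral>x. ?c / ?k * (W x * \<phi> x - W x * \<phi> (x + s)) \<partial>lborel)"
        using True by (intro Bochner_Integration.integral_cong) (auto simp: field_simps)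
      also have "\<dots> = ?c / ?k * ((\<integral>x. W x * \<phi> x \<partial>lborel) - (\<integral>x. W (x - s) * \<phi> x \<partial>lborel))"
        using Wphi sh eq by simp
      also have "\<dots> = (\<integral>x. ?c / ?k * (W x * \<phi> x - W (x - s) * \<phi> x) \<partial>lborel)"
        using Wphi sh' by simp
      also have "\<dots> = (\<integral>x. ?K x s \<partial>lborel)"
        using True by (intro Bochner_Integration.integral_cong) (auto simp: field_simps)
      finally show ?thesis .
    qed simp
  qed
  have "(\<integral>x. W x * frac_right \<alpha> \<phi> x \<partial>lborel) = (\<integral>x. (\<integral>s. ?H x s \<partial>lborel) \<partial>lborel)"
  proof (intro Bochner_Integration.integral_cong refl)
    fix x
    have "(\<integral>s. ?H x s \<partial>lborel) = (\<integral>s. (?c * W x) * (indicator {0<..} s *\<^sub>R ((\<phi> x - \<phi> (x + s)) / s powr (1 + \<alpha>))) \<partial>lborel)"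
      by (intro Bochner_Integration.integral_cong) auto
    also have "\<dots> = W x * frac_right \<alpha> \<phi> x"
      unfolding frac_right_reflect frac_deriv_def set_lebesgue_integral_def integral_mult_right_zero
      by (simp add: add.commute)
    finally show "W x * frac_right \<alpha> \<phi> x = (\<integral>s. ?H x s \<partial>lborel)" by simp
  qed
  also have "\<dots> = (\<integral>s. (\<integral>x. ?H x s \<partial>lborel) \<partial>lborel)" by (rule lborel_pair.Fubini_integral[symmetric, OF Hint])
  also have "\<dots> = (\<integral>s. (\<integral>x. ?K x s \<partial>lborel) \<partial>lborel)" by (intro integral_cong_AE inner) measurable
  also have "\<dots> = (\<integral>x. (\<integral>s. ?K x s \<partial>lborel) \<partial>lborel)" by (rule lborel_pair.Fubini_integral[OF Kint])
  also have "\<dots> = (\<integral>x. frac_deriv \<alpha> W x * \<phi> x \<partial>lborel)"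
  proof (intro Bochner_Integration.integral_cong refl)
    fix x
    have "(\<integral>s. ?K x s \<partial>lborel) = (\<integral>s. (?c * \<phi> x) * (indicator {0<..} s *\<^sub>R ((W x - W (x - s)) / s powr (1 + \<alpha>))) \<partial>lborel)"
      by (intro Bochner_Integration.integral_cong) auto
    also have "\<dots> = frac_deriv \<alpha> W x * \<phi> x"
      unfolding frac_deriv_def set_lebesgue_integral_def integral_mult_right_zero by (simp add: mult_ac)
    finally show "(\<integral>s. ?K x s \<partial>lborel) = frac_deriv \<alpha> W x * \<phi> x" .
  qed
  finally show ?thesis .
qed

lemma schwartz_pairing_determines:
  assumes [measurable]: "g \<in> borel_measurable borel" "h \<in> borel_measurable borel"
    and fin: "wabs g < top" "wabs h < top"
    and eq: "\<And>\<phi>. \<phi> \<in> schwartz_minus \<Longrightarrow> (\<integral>x. g x * \<phi> x \<partial>lborel) = (\<integral>x. h x * \<phi> x \<partial>lborel)"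
  shows "AE x in lborel. g x = h x"
proof -
  have "AE x in lborel. g x - h x = 0"
  proof (rule fundamental_lemma)
    show "locally_integrable (\<lambda>x. g x - h x)"
      by (intro locally_integrable_diff wint_imp_locally_integrable fin) auto
    fix \<phi> assume "\<phi> \<in> test_functions"
    then have phi: "\<phi> \<in> schwartz_minus" by (rule test_function_schwartz_minus)
    show "(\<integral>x. (g x - h x) * \<phi> x \<partial>lborel) = 0"
      using schwartz_pairing_integrable[OF _ fin(1) phi] schwartz_pairing_integrable[OF _ fin(2) phi] eq[OF phi]
      by (simp add: left_diff_distrib)
  qed
  then show ?thesis by simp
qed

text \<open>The right fractional derivative of \<open>\<phi>\<close> is the left one of the reflected function, whose derivative is \<open>- \<phi>'\<close>.\<close>
lemma frac_right_pairing_tendsto: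
  assumes [measurable]: "w \<in> borel_measurable borel" and fin: "wabs w < top" and phi: "\<phi> \<in> schwartz_minus"
    and S: "\<And>n. 1/2 \<le> S n" "\<And>n. S n < 1" "S \<longlonglongrightarrow> 1"
  shows "(\<lambda>n. \<integral>x. w x * frac_right (S n) \<phi> x \<partial>lborel) \<longlonglongrightarrow> - (\<integral>x. w x * deriv \<phi> x \<partial>lborel)"
proof -
  obtain A M where sm: "smooth \<phi>" and M: "0 < M" and lb: "left_decay_bounds \<phi> A M"
    by (rule schwartz_minus_bounds[OF phi])
  have fb: "ennreal (frac_const \<alpha>) * (near_part \<alpha> (\<lambda>y. \<phi> (- y)) (- x) + far_part \<alpha> (\<lambda>y. \<phi> (- y)) (- x))
      \<le> ennreal (M * left_decay A \<alpha> x)" if "0 < \<alpha>" "\<alpha> < 1" for x \<alpha>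
    using lb that unfolding left_decay_bounds_def by blast
  have c: "continuous_on UNIV \<phi>" and [measurable]: "\<phi> \<in> borel_measurable borel" "deriv \<phi> \<in> borel_measurable borel"
    using sm by (auto intro: smooth_continuous smooth_borel smooth_deriv)
  have cr: "continuous_on UNIV (\<lambda>y. \<phi> (- y))"
    by (intro continuous_on_compose2[OF c]) (auto intro!: continuous_intros)
  have [measurable]: "(\<lambda>x. frac_right \<alpha> \<phi> x) \<in> borel_measurable borel" for \<alpha>
    unfolding frac_right_reflect frac_deriv_def set_lebesgue_integral_def by measurable
  have "(\<lambda>n. \<integral>x. w x * frac_right (S n) \<phi> x \<partial>lborel) \<longlonglongrightarrow> (\<integral>x. w x * (- deriv \<phi> x) \<partial>lborel)"
  proof (rule integral_dominated_convergence)
    show "integrable lborel (\<lambda>x. M * (\<bar>w x\<bar> * left_decay A (1/2) x))"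
    proof (intro integrable_mult_right integrableI_bounded)
      have "(\<integral>\<^sup>+x. ennreal (norm (\<bar>w x\<bar> * left_decay A (1/2) x)) \<partial>lborel) =
          (\<integral>\<^sup>+x. ennreal \<bar>w x\<bar> * ennreal (left_decay A (1/2) x) \<partial>lborel)"
        using left_decay_nonneg by (intro nn_integral_cong) (simp add: abs_mult ennreal_mult)
      also have "\<dots> < \<infinity>" using left_decay_pairing_finite[OF assms(1) fin, of "1/2" A] by simp
      finally show "(\<integral>\<^sup>+x. ennreal (norm (\<bar>w x\<bar> * left_decay A (1/2) x)) \<partial>lborel) < \<infinity>" .
    qed measurable
    show "AE x in lborel. norm (w x * frac_right (S n) \<phi> x) \<le> M * (\<bar>w x\<bar> * left_decay A (1/2) x)" for n
    proof (rule AE_I2)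
      fix x
      have Sn: "0 < S n" "S n < 1" using S(1)[of n] S(2)[of n] by auto
      have "ennreal \<bar>frac_right (S n) \<phi> x\<bar> \<le> ennreal (M * left_decay A (S n) x)"
        unfolding frac_right_reflect by (rule order_trans[OF abs_frac_deriv_le fb]) (use Sn in auto)
      then have "\<bar>frac_right (S n) \<phi> x\<bar> \<le> M * left_decay A (S n) x" using M left_decay_nonneg by simp
      also have "\<dots> \<le> M * left_decay A (1/2) x" using M S(1) by (intro mult_left_mono left_decay_antimono) auto
      finally have "\<bar>frac_right (S n) \<phi> x\<bar> \<le> M * left_decay A (1/2) x" .
      from mult_left_mono[OF this, of "\<bar>w x\<bar>"]
      show "norm (w x * frac_right (S n) \<phi> x) \<le> M * (\<bar>w x\<bar> * left_decay A (1/2) x)"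
        by (simp add: abs_mult mult.left_commute)
    qed
    show "AE x in lborel. (\<lambda>n. w x * frac_right (S n) \<phi> x) \<longlonglongrightarrow> w x * (- deriv \<phi> x)"
    proof (rule AE_I2)
      fix x
      have "((\<lambda>\<alpha>. frac_deriv \<alpha> (\<lambda>y. \<phi> (- y)) (- x)) \<longlongrightarrow> - deriv \<phi> x) (at_left 1)"
      proof (rule frac_deriv_tendsto_deriv[OF cr])
        have "((\<lambda>s. (\<phi> (x + s) - \<phi> x) / s) \<longlongrightarrow> deriv \<phi> x) (at 0)"
          using smooth_DERIV[OF sm, of x] by (simp add: DERIV_def)
        then have "((\<lambda>s. (\<phi> (x + s) - \<phi> x) / s) \<longlongrightarrow> deriv \<phi> x) (at_right 0)"
          by (rule filterlim_mono) (auto intro: at_le)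
        from tendsto_minus[OF this]
        show "((\<lambda>s. (\<phi> (- (- x)) - \<phi> (- (- x - s))) / s) \<longlongrightarrow> - deriv \<phi> x) (at_right 0)"
          by (simp add: add.commute minus_divide_left)
        have c12: "0 < frac_const (1/2)" by (rule frac_const_pos) auto
        have "ennreal (frac_const (1/2)) * far_part (1/2) (\<lambda>y. \<phi> (- y)) (- x) \<le> ennreal (M * left_decay A (1/2) x)"
          by (rule order_trans[OF mult_left_mono fb[of "1/2" x]]) auto
        also have "\<dots> < top" by simp
        finally show "far_part (1/2) (\<lambda>y. \<phi> (- y)) (- x) < top"
          using c12 by (auto simp: ennreal_mult_less_top)
      qed
      moreover have "filterlim S (at_left 1) sequentially"
        unfolding filterlim_at using S(3) less_imp_neq[OF S(2)] S(2) by (auto intro!: always_eventually)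
      ultimately have "(\<lambda>n. frac_deriv (S n) (\<lambda>y. \<phi> (- y)) (- x)) \<longlonglongrightarrow> - deriv \<phi> x"
        by (rule filterlim_compose)
      then show "(\<lambda>n. w x * frac_right (S n) \<phi> x) \<longlonglongrightarrow> w x * (- deriv \<phi> x)"
        unfolding frac_right_reflect by (intro tendsto_intros)
    qed
  qed measurable
  then show ?thesis by simp
qed

end

section \<open>The fractional powers of the twisted derivative\<close>

lemma LBINT_left_half_line:
  fixes F :: "real \<Rightarrow> real"
  shows "(LBINT t:{..<x}. F t) = (LBINT s:{0<..}. F (x - s))"
  unfolding set_lebesgue_integral_def
  by (subst lborel_integral_real_affine[where c = "-1" and t = x])
     (auto intro!: Bochner_Integration.integral_cong simp: indicator_def)

lemma set_integrable_left_half_line: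
  fixes F :: "real \<Rightarrow> real"
  assumes "set_integrable lborel {0<..} (\<lambda>s. F (x - s))" shows "set_integrable lborel {..<x} F"
proof -
  have "integrable lborel (\<lambda>s. indicator {0<..} s *\<^sub>R F (x - s))" using assms by (simp add: set_integrable_def)
  from lborel_integrable_real_affine[OF this, of "-1" x]
  show ?thesis unfolding set_integrable_def
    by (rule Bochner_Integration.integrable_cong[THEN iffD1, rotated 2]) (auto simp: indicator_def)
qed

lemma frac_deriv_measurable [measurable]:
  assumes [measurable]: "w \<in> borel_measurable borel" shows "frac_deriv \<alpha> w \<in> borel_measurable borel"
  unfolding frac_deriv_def set_lebesgue_integral_def by measurable

text \<open>The exceptional set in the variable \<open>s = x - t\<close> is a reflection of a null set. At the point \<open>x\<close> itself the values
have to agree, because \<open>w x\<close> enters for every \<open>s\<close>.\<close>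
lemma frac_deriv_cong_AE:
  assumes [measurable]: "w \<in> borel_measurable borel" "W \<in> borel_measurable borel"
    and eq: "AE y in lborel. w y = W y" and x: "w x = W x"
  shows "frac_deriv \<alpha> w x = frac_deriv \<alpha> W x"
proof -
  have "AE s in lborel. w (x - s) = W (x - s)" by (rule AE_lborel_reflect[OF eq])
  then have "(LBINT s:{0<..}. (w x - w (x - s)) / s powr (1 + \<alpha>)) = (LBINT s:{0<..}. (W x - W (x - s)) / s powr (1 + \<alpha>))"
    unfolding set_lebesgue_integral_def by (intro integral_cong_AE) (auto simp: x elim!: eventually_mono)
  then show ?thesis by (simp add: frac_deriv_def)
qed

text \<open>Dividing by the positive \<open>C\<^sup>1\<close> function \<open>E\<close> carries every notion of the theorem to its counterpart with \<open>a = 0\<close>,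
in the space \<open>L\<^sup>p(\<omega>)\<close>.\<close>
locale twisted_weight = one_sided_weight +
  fixes a :: "real \<Rightarrow> real" and x0 :: real
  assumes cont_a: "continuous_on UNIV a"
begin

abbreviation E :: "real \<Rightarrow> real" where "E \<equiv> exp_factor a x0"
abbreviation Mw :: "real measure" where "Mw \<equiv> weighted_measure p a x0 \<omega>"
abbreviation untwist :: "(real \<Rightarrow> real) \<Rightarrow> real \<Rightarrow> real" where "untwist u \<equiv> (\<lambda>x. inverse (E x) * u x)"

lemma E_pos: "0 < E x" by (simp add: exp_factor_def)

lemma E_DERIV: "(E has_real_derivative - a x * E x) (at x)"
proof -
  let ?I = "{min x x0 - 1..max x x0 + 1}"
  have "((\<lambda>u. LBINT y=ereal x0..ereal u. a y) has_vector_derivative a x) (at x within ?I)"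
    by (rule interval_integral_FTC2) (auto intro: continuous_on_subset[OF cont_a])
  then have "((\<lambda>u. LBINT y=ereal x0..ereal u. a y) has_vector_derivative a x) (at x)"
    by (subst (asm) at_within_interior) auto
  then have "((\<lambda>u. LBINT y=ereal x0..ereal u. a y) has_real_derivative a x) (at x)"
    by (simp add: has_real_derivative_iff_has_vector_derivative)
  then show ?thesis unfolding exp_factor_def[abs_def]
    by (auto intro!: derivative_eq_intros)
qed

lemma inverse_E_DERIV: "((\<lambda>x. inverse (E x)) has_real_derivative a x * inverse (E x)) (at x)"
  using E_pos[of x] by (auto intro!: derivative_eq_intros E_DERIV simp: field_simps)

lemma E_continuous: "continuous_on UNIV E"
  by (meson DERIV_isCont continuous_at_imp_continuous_on E_DERIV)

lemma E_measurable [measurable]: "E \<in> borel_measurable borel"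
  by (intro borel_measurable_continuous_onI E_continuous)

lemma nn_integral_weighted:
  assumes [measurable]: "u \<in> borel_measurable borel"
  shows "(\<integral>\<^sup>+x. ennreal (\<bar>u x\<bar> powr p) \<partial>Mw) = wabs (untwist u)"
  unfolding weighted_measure_def wint_def
proof (subst nn_integral_density)
  show "(\<integral>\<^sup>+x. ennreal (E x powr - p * \<omega> x) * ennreal (\<bar>u x\<bar> powr p) \<partial>lborel) =
     (\<integral>\<^sup>+x. epow p (ennreal \<bar>inverse (E x) * u x\<bar>) * ennreal (\<omega> x) \<partial>lborel)"
  proof (rule nn_integral_cong)
    fix x
    have "\<bar>inverse (E x) * u x\<bar> powr p = E x powr - p * \<bar>u x\<bar> powr p"
      using E_pos[of x] by (simp add: abs_mult powr_mult powr_minus inverse_powr)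
    then show "ennreal (E x powr - p * \<omega> x) * ennreal (\<bar>u x\<bar> powr p) =
        epow p (ennreal \<bar>inverse (E x) * u x\<bar>) * ennreal (\<omega> x)"
      using nonneg_w[of x] by (simp add: epow_ennreal mult_ac flip: ennreal_mult)
  qed
qed measurable

lemma borel_measurable_Mw: "u \<in> borel_measurable Mw \<longleftrightarrow> u \<in> borel_measurable borel"
  unfolding weighted_measure_def by simp

lemma Lp_space_iff: "u \<in> Lp_space p Mw \<longleftrightarrow> u \<in> borel_measurable borel \<and> wabs (untwist u) < top"
proof (cases "u \<in> borel_measurable borel")
  case True
  note [measurable] = True
  have "integrable Mw (\<lambda>x. \<bar>u x\<bar> powr p) \<longleftrightarrow> (\<integral>\<^sup>+x. ennreal (\<bar>u x\<bar> powr p) \<partial>Mw) < \<infinity>"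
    unfolding integrable_iff_bounded using True by (auto simp: weighted_measure_def)
  then show ?thesis using True by (simp add: Lp_space_def borel_measurable_Mw nn_integral_weighted)
qed (simp add: Lp_space_def borel_measurable_Mw)

lemma Lp_norm_eq:
  assumes [measurable]: "u \<in> borel_measurable borel"
  shows "Lp_norm p Mw u = enn2real (wabs (untwist u)) powr (1 / p)"
proof -
  have "(\<integral>x. \<bar>u x\<bar> powr p \<partial>Mw) = enn2real (wabs (untwist u))"
    unfolding nn_integral_weighted[OF assms, symmetric]
    by (rule integral_eq_nn_integral) (auto simp: weighted_measure_def)
  then show ?thesis by (simp add: Lp_norm_def)
qed

text \<open>The two directions are the product rule with the factors \<open>1 / E\<close> and \<open>E\<close>.\<close>
lemma left_deriv_iff_weak_deriv:
  "has_left_deriv a u v \<longleftrightarrow> has_weak_deriv (untwist u) (untwist v)"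
proof
  assume "has_left_deriv a u v"
  then have "has_weak_deriv u (\<lambda>x. v x - a x * u x)" by (simp add: has_left_deriv_def)
  from weak_deriv_mult_C1[OF this inverse_E_DERIV]
  have "has_weak_deriv (\<lambda>x. u x * inverse (E x)) (\<lambda>x. (v x - a x * u x) * inverse (E x) + u x * (a x * inverse (E x)))"
    using E_pos by (simp add: continuous_intros cont_a E_continuous less_imp_neq[symmetric])
  moreover have "(\<lambda>x. (v x - a x * u x) * inverse (E x) + u x * (a x * inverse (E x))) = untwist v"
    by (auto simp: algebra_simps)
  ultimately show "has_weak_deriv (untwist u) (untwist v)" by (simp add: mult.commute)
next
  assume "has_weak_deriv (untwist u) (untwist v)"
  from weak_deriv_mult_C1[OF this E_DERIV]
  have "has_weak_deriv (\<lambda>x. inverse (E x) * u x * E x) (\<lambda>x. inverse (E x) * v x * E x + inverse (E x) * u x * (- a x * E x))"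
    by (simp add: continuous_intros cont_a E_continuous)
  moreover have "(\<lambda>x. inverse (E x) * u x * E x) = u"
    "(\<lambda>x. inverse (E x) * v x * E x + inverse (E x) * u x * (- a x * E x)) = (\<lambda>x. v x - a x * u x)"
    using E_pos[THEN less_imp_neq] by (auto simp: fun_eq_iff field_simps)
  ultimately show "has_left_deriv a u v" by (simp add: has_left_deriv_def)
qed

lemma frac_left_pointwise_eq: "frac_left_pointwise a x0 \<alpha> u x = E x * frac_deriv \<alpha> (untwist u) x"
  unfolding frac_left_pointwise_def LBINT_left_half_line frac_left_integrand_def frac_deriv_def by simp

text \<open>Collects what the direct part of the theorem uses about a function in the Sobolev space: the antiderivative that
represents \<open>u / E\<close>, and that \<open>left_deriv\<close> may be replaced by any weak derivative in the space.\<close>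
lemma Sobolev_untwist:
  assumes u: "u \<in> Sobolev p a x0 \<omega>"
  obtains W f where "antiderivative W f" "AE x in lborel. untwist u x = W x" "wabs W < top" "wabs f < top"
    "u \<in> borel_measurable borel" "left_deriv a u \<in> borel_measurable borel"
    "AE x in lborel. untwist (left_deriv a u) x = f x"
    "wabs W = wabs (untwist u)" "wabs f = wabs (untwist (left_deriv a u))"
proof -
  obtain v where uL: "u \<in> Lp_space p Mw" and v: "v \<in> Lp_space p Mw" "has_left_deriv a u v"
    using u by (auto simp: Sobolev_def)
  have um[measurable]: "u \<in> borel_measurable borel" and ufin: "wabs (untwist u) < top"
    and vm[measurable]: "v \<in> borel_measurable borel" and vfin: "wabs (untwist v) < top"
    using uL v by (auto simp: Lp_space_iff)
  have "left_deriv a u \<in> borel_measurable lborel \<and> has_left_deriv a u (left_deriv a u)"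
    unfolding left_deriv_def by (rule someI[of _ v]) (use v in auto)
  then have lm[measurable]: "left_deriv a u \<in> borel_measurable borel" and ld: "has_left_deriv a u (left_deriv a u)" by auto
  have wd: "has_weak_deriv (untwist u) (untwist v)" "has_weak_deriv (untwist u) (untwist (left_deriv a u))"
    using v ld by (auto simp: left_deriv_iff_weak_deriv)
  have eq: "AE x in lborel. untwist (left_deriv a u) x = untwist v x" using weak_deriv_unique[OF wd(2,1)] .
  obtain W where W: "antiderivative W (untwist v)" "AE x in lborel. untwist u x = W x"
    using weak_deriv_antiderivative[OF wd(1)] by blast
  have "wabs W = wabs (untwist u)"
    by (rule antisym; rule wint_mono_AE) (use W(2) in \<open>auto elim!: eventually_mono\<close>)
  moreover have "wabs (untwist v) = wabs (untwist (left_deriv a u))"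
    by (rule antisym; rule wint_mono_AE) (use eq in \<open>auto elim!: eventually_mono\<close>)
  ultimately show ?thesis using that[OF W] ufin vfin eq by simp
qed

lemma frac_left_of_antiderivative:
  assumes W: "antiderivative W f" and eq: "AE x in lborel. untwist u x = W x"
    and fin: "wabs W < top" "wabs f < top" and um[measurable]: "u \<in> borel_measurable borel"
    and al: "0 < \<alpha>" "\<alpha> < 1"
  shows "(\<lambda>x. E x * frac_deriv \<alpha> W x) \<in> Lp_space p Mw"
    and "has_frac_left a x0 \<alpha> u (\<lambda>x. E x * frac_deriv \<alpha> W x)"
    and "g \<in> Lp_space p Mw \<Longrightarrow> has_frac_left a x0 \<alpha> u g \<Longrightarrow> AE x in lborel. untwist g x = frac_deriv \<alpha> W x"
    and "AE x in lborel. set_integrable lborel {..<x} (frac_left_integrand a x0 \<alpha> u x)"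
proof -
  note [measurable] = antiderivative_borel[OF W]
  have E0: "E x \<noteq> 0" for x using E_pos[of x] by simp
  let ?g = "\<lambda>x. ennreal (frac_const \<alpha>) * (near_part \<alpha> W x + far_part \<alpha> W x)"
  have gfin: "wint ?g < top"
  proof -
    obtain D where "wint ?g \<le> ennreal D * (wabs W + wabs f)"
      using wint_frac_deriv_uniform W al by blast
    also have "\<dots> < top" using fin by (simp add: ennreal_mult_less_top)
    finally show ?thesis .
  qed
  have "wabs (frac_deriv \<alpha> W) \<le> wint ?g" by (intro wint_mono abs_frac_deriv_le al) auto
  also note gfin
  finally have dfin: "wabs (frac_deriv \<alpha> W) < top" .
  show "(\<lambda>x. E x * frac_deriv \<alpha> W x) \<in> Lp_space p Mw"
    using dfin E0 by (simp add: Lp_space_iff mult.assoc[symmetric])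
  have pair: "(\<integral>x. inverse (E x) * u x * frac_right \<alpha> \<phi> x \<partial>lborel) = (\<integral>x. frac_deriv \<alpha> W x * \<phi> x \<partial>lborel)"
    if phi: "\<phi> \<in> schwartz_minus" for \<phi>
  proof -
    have "\<phi> \<in> borel_measurable borel" using phi smooth_borel by (auto simp: schwartz_minus_def schwartz_def)
    then have [measurable]: "frac_right \<alpha> \<phi> \<in> borel_measurable borel"
      unfolding frac_right_reflect[abs_def] by measurable
    have "(\<integral>x. inverse (E x) * u x * frac_right \<alpha> \<phi> x \<partial>lborel) = (\<integral>x. W x * frac_right \<alpha> \<phi> x \<partial>lborel)"
      using eq by (intro integral_cong_AE) (auto elim!: eventually_mono)
    then show ?thesis using frac_deriv_duality[OF W fin al phi] by simp
  qed
  show "has_frac_left a x0 \<alpha> u (\<lambda>x. E x * frac_deriv \<alpha> W x)"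
    unfolding has_frac_left_def using pair E0 by (simp add: mult.assoc[symmetric])
  show "AE x in lborel. untwist g x = frac_deriv \<alpha> W x" if g: "g \<in> Lp_space p Mw" "has_frac_left a x0 \<alpha> u g"
  proof (rule schwartz_pairing_determines)
    show "untwist g \<in> borel_measurable borel" "wabs (untwist g) < top" using g(1) by (auto simp: Lp_space_iff)
    show "(\<integral>x. untwist g x * \<phi> x \<partial>lborel) = (\<integral>x. frac_deriv \<alpha> W x * \<phi> x \<partial>lborel)" if "\<phi> \<in> schwartz_minus" for \<phi>
      using g(2) pair[OF that] that by (simp add: has_frac_left_def)
  qed (use dfin in auto)
  have "AE x in lborel. ?g x < top" by (rule finite_AE_of_wint[OF _ gfin]) measurable
  with eq show "AE x in lborel. set_integrable lborel {..<x} (frac_left_integrand a x0 \<alpha> u x)"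
  proof eventually_elim
    case (elim x)
    have "near_part \<alpha> W x + far_part \<alpha> W x < top"
      using elim(2) frac_const_pos[OF al] by (auto simp: ennreal_mult_less_top)
    then have i: "set_integrable lborel {0<..} (\<lambda>s. (W x - W (x - s)) / s powr (1 + \<alpha>))"
      by (intro set_integrableI_nn) (simp_all only: near_far_split[OF antiderivative_borel(1)[OF W]], measurable)
    have "AE s in lborel. untwist u (x - s) = W (x - s)" by (rule AE_lborel_reflect[OF eq])
    then have "AE s in lborel. (W x - W (x - s)) / s powr (1 + \<alpha>) = frac_left_integrand a x0 \<alpha> u x (x - s)"
      by eventually_elim (simp add: frac_left_integrand_def elim)
    then have "set_integrable lborel {0<..} (\<lambda>s. frac_left_integrand a x0 \<alpha> u x (x - s))"
      using i unfolding set_integrable_def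
      by (rule_tac integrable_cong_AE_imp) (auto simp: frac_left_integrand_def elim!: eventually_mono)
    then show ?case by (rule set_integrable_left_half_line)
  qed
qed

text \<open>One exceptional set serves all \<open>\<alpha>\<close>, as limits in the continuous parameter \<open>\<alpha>\<close> require.\<close>
lemma frac_left_pointwise_AE:
  assumes W: "antiderivative W f" and eq: "AE x in lborel. untwist u x = W x" and [measurable]: "u \<in> borel_measurable borel"
  shows "AE x in lborel. \<forall>\<alpha>. frac_left_pointwise a x0 \<alpha> u x = E x * frac_deriv \<alpha> W x"
proof -
  note [measurable] = antiderivative_borel[OF W]
  from eq show ?thesis
  proof eventually_elim
    case (elim x)
    have "frac_deriv \<alpha> (untwist u) x = frac_deriv \<alpha> W x" for \<alpha>
      by (rule frac_deriv_cong_AE[OF _ _ eq elim]) measurable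
    then show ?case by (simp add: frac_left_pointwise_eq)
  qed
qed

lemma Sobolev_limits:
  assumes u: "u \<in> Sobolev p a x0 \<omega>"
  shows "frac_left_tends_to_deriv p a x0 \<omega> u"
    and "AE x in lborel. ((\<lambda>\<alpha>. frac_left_pointwise a x0 \<alpha> u x) \<longlongrightarrow> u x) (at_right 0)"
proof -
  obtain W f where W: "antiderivative W f" and eq: "AE x in lborel. untwist u x = W x"
    and fin: "wabs W < top" "wabs f < top" and um[measurable]: "u \<in> borel_measurable borel"
    and lm[measurable]: "left_deriv a u \<in> borel_measurable borel"
    and leq: "AE x in lborel. untwist (left_deriv a u) x = f x"
    by (rule Sobolev_untwist[OF u])
  note [measurable] = antiderivative_borel[OF W]
  have E0: "E x \<noteq> 0" for x using E_pos[of x] by simp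
  note pw = frac_left_pointwise_AE[OF W eq um]
  from frac_deriv_AE_limits(2)[OF W fin] pw eq
  show "AE x in lborel. ((\<lambda>\<alpha>. frac_left_pointwise a x0 \<alpha> u x) \<longlongrightarrow> u x) (at_right 0)"
  proof eventually_elim
    case (elim x)
    have "((\<lambda>\<alpha>. E x * frac_deriv \<alpha> W x) \<longlongrightarrow> E x * W x) (at_right 0)" using elim(1) by (intro tendsto_intros)
    moreover have "E x * W x = u x" using elim(3)[symmetric] E0 by simp
    ultimately show ?case using elim(2) by simp
  qed
  show "frac_left_tends_to_deriv p a x0 \<omega> u"
    unfolding frac_left_tends_to_deriv_def
  proof (intro conjI allI impI)
    from frac_deriv_AE_limits(1)[OF W fin] pw leq
    show "AE x in lborel. ((\<lambda>\<alpha>. frac_left_pointwise a x0 \<alpha> u x) \<longlongrightarrow> left_deriv a u x) (at_left 1)"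
    proof eventually_elim
      case (elim x)
      have "((\<lambda>\<alpha>. E x * frac_deriv \<alpha> W x) \<longlongrightarrow> E x * f x) (at_left 1)" using elim(1) by (intro tendsto_intros)
      moreover have "E x * f x = left_deriv a u x" using elim(3)[symmetric] E0 by simp
      ultimately show ?case using elim(2) by simp
    qed
    fix g assume g: "\<forall>\<alpha>\<in>{0<..<1}. g \<alpha> \<in> Lp_space p Mw \<and> has_frac_left a x0 \<alpha> u (g \<alpha>)"
    have "((\<lambda>\<alpha>. wabs (\<lambda>x. frac_deriv \<alpha> W x - f x)) \<longlongrightarrow> ennreal 0) (at_left 1)"
      using frac_deriv_tendsto_deriv_wint[OF W fin] by simp
    then have "((\<lambda>\<alpha>. enn2real (wabs (\<lambda>x. frac_deriv \<alpha> W x - f x))) \<longlongrightarrow> 0) (at_left 1)"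
      by (rule tendsto_enn2real) simp
    then have lim: "((\<lambda>\<alpha>. enn2real (wabs (\<lambda>x. frac_deriv \<alpha> W x - f x)) powr (1 / p)) \<longlongrightarrow> 0) (at_left 1)"
      using p by (intro tendsto_zero_powrI[where b = "1 / p"]) auto
    have "\<forall>\<^sub>F \<alpha> in at_left 1. enn2real (wabs (\<lambda>x. frac_deriv \<alpha> W x - f x)) powr (1 / p) =
        Lp_norm p Mw (\<lambda>x. g \<alpha> x - left_deriv a u x)"
      using eventually_at_left_1
    proof eventually_elim
      case (elim \<alpha>)
      then have al: "0 < \<alpha>" "\<alpha> < 1" by auto
      have gm[measurable]: "g \<alpha> \<in> borel_measurable borel" using g al by (auto simp: Lp_space_iff)
      have "AE x in lborel. untwist (g \<alpha>) x = frac_deriv \<alpha> W x"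
        using g al by (intro frac_left_of_antiderivative(3)[OF W eq fin um al]) auto
      with leq have AE: "AE x in lborel. untwist (\<lambda>x. g \<alpha> x - left_deriv a u x) x = frac_deriv \<alpha> W x - f x"
        by eventually_elim (simp add: right_diff_distrib)
      have "wabs (\<lambda>x. frac_deriv \<alpha> W x - f x) = wabs (untwist (\<lambda>x. g \<alpha> x - left_deriv a u x))"
        by (rule antisym; rule wint_mono_AE) (use AE in \<open>auto elim!: eventually_mono\<close>)
      then show ?case by (subst Lp_norm_eq) auto
    qed
    with lim show "((\<lambda>\<alpha>. Lp_norm p Mw (\<lambda>x. g \<alpha> x - left_deriv a u x)) \<longlongrightarrow> 0) (at_left 1)"
      by (rule Lim_transform_eventually)
  qed
qed

text \<open>The constant \<open>D\<close> is a parameter here because it has to be chosen before \<open>a\<close> and \<open>x0\<close>: it depends on the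
weight and the exponent only.\<close>
lemma Sobolev_norm_bound:
  assumes u: "u \<in> Sobolev p a x0 \<omega>" and al: "0 < \<alpha>" "\<alpha> < 1"
    and D: "0 < D" "\<And>W f. antiderivative W f \<Longrightarrow> wint (\<lambda>x. ennreal (frac_const \<alpha>) * (near_part \<alpha> W x + far_part \<alpha> W x)) \<le>
       ennreal D * (wabs W + wabs f)"
  shows "\<exists>g \<in> Lp_space p Mw. has_frac_left a x0 \<alpha> u g"
    and "g \<in> Lp_space p Mw \<Longrightarrow> has_frac_left a x0 \<alpha> u g \<Longrightarrow>
       (AE x in lborel. set_integrable lborel {..<x} (frac_left_integrand a x0 \<alpha> u x) \<and> g x = frac_left_pointwise a x0 \<alpha> u x) \<and>
       Lp_norm p Mw g \<le> D powr (1 / p) * Sobolev_norm p a x0 \<omega> u"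
proof -
  obtain W f where W: "antiderivative W f" and eq: "AE x in lborel. untwist u x = W x"
    and fin: "wabs W < top" "wabs f < top" and um[measurable]: "u \<in> borel_measurable borel"
    and lm[measurable]: "left_deriv a u \<in> borel_measurable borel"
    and leq: "AE x in lborel. untwist (left_deriv a u) x = f x"
    and wW: "wabs W = wabs (untwist u)" and wf: "wabs f = wabs (untwist (left_deriv a u))"
    by (rule Sobolev_untwist[OF u])
  note [measurable] = antiderivative_borel[OF W]
  have E0: "E x \<noteq> 0" for x using E_pos[of x] by simp
  note fl = frac_left_of_antiderivative[OF W eq fin um al]
  show "\<exists>g \<in> Lp_space p Mw. has_frac_left a x0 \<alpha> u g" using fl(1,2) by blast
  assume g: "g \<in> Lp_space p Mw" "has_frac_left a x0 \<alpha> u g"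
  have gm[measurable]: "g \<in> borel_measurable borel" using g by (auto simp: Lp_space_iff)
  have ge: "AE x in lborel. untwist g x = frac_deriv \<alpha> W x" by (rule fl(3)[OF g])
  show "(AE x in lborel. set_integrable lborel {..<x} (frac_left_integrand a x0 \<alpha> u x) \<and> g x = frac_left_pointwise a x0 \<alpha> u x) \<and>
       Lp_norm p Mw g \<le> D powr (1 / p) * Sobolev_norm p a x0 \<omega> u"
  proof
    from fl(4) ge frac_left_pointwise_AE[OF W eq um]
    show "AE x in lborel. set_integrable lborel {..<x} (frac_left_integrand a x0 \<alpha> u x) \<and> g x = frac_left_pointwise a x0 \<alpha> u x"
    proof eventually_elim
      case (elim x)
      have "g x = E x * untwist g x" using E0 by simp
      then show ?case using elim by simp
    qed
    define Q where "Q = enn2real (wabs W)"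
    define R where "R = enn2real (wabs f)"
    have QR: "wabs W = ennreal Q" "wabs f = ennreal R" "0 \<le> Q" "0 \<le> R" using fin by (auto simp: Q_def R_def)
    have "wabs (untwist g) \<le> wint (\<lambda>x. ennreal (frac_const \<alpha>) * (near_part \<alpha> W x + far_part \<alpha> W x))"
    proof (rule wint_mono_AE)
      show "AE x in lborel. ennreal \<bar>untwist g x\<bar> \<le> ennreal (frac_const \<alpha>) * (near_part \<alpha> W x + far_part \<alpha> W x)"
        using ge by eventually_elim (use abs_frac_deriv_le[OF antiderivative_borel(1)[OF W] al] in simp)
    qed
    also have "\<dots> \<le> ennreal D * (wabs W + wabs f)" by (rule D(2)[OF W])
    also have "\<dots> = ennreal (D * (Q + R))" using QR D by (simp add: ennreal_mult)
    finally have "enn2real (wabs (untwist g)) \<le> D * (Q + R)" using QR D by (intro enn2real_leI) auto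
    then have "Lp_norm p Mw g \<le> (D * (Q + R)) powr (1 / p)"
      using p by (subst Lp_norm_eq) (auto intro!: powr_mono2)
    also have "\<dots> = D powr (1 / p) * (Q + R) powr (1 / p)" using D QR by (simp add: powr_mult)
    also have "(Q + R) powr (1 / p) = Sobolev_norm p a x0 \<omega> u"
      using p QR(3,4) unfolding Sobolev_norm_def Lp_norm_eq[OF um] Lp_norm_eq[OF lm] wW[symmetric] wf[symmetric]
      by (simp add: powr_powr Q_def R_def)
    finally show "Lp_norm p Mw g \<le> D powr (1 / p) * Sobolev_norm p a x0 \<omega> u" .
  qed
qed

text \<open>On a bounded interval, the one-sided bound at its right end point controls the \<open>L\<^sup>1\<close> norm by the weighted norm.\<close>
lemma test_pairing_tendsto:
  assumes hm: "\<And>n::nat. h n \<in> borel_measurable borel" and zm: "z \<in> borel_measurable borel"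
    and hfin: "\<And>n. wabs (h n) < top" and zfin: "wabs z < top"
    and lim: "(\<lambda>n. wabs (\<lambda>x. h n x - z x)) \<longlonglongrightarrow> 0" and phi: "\<phi> \<in> test_functions"
  shows "(\<lambda>n. \<integral>x. h n x * \<phi> x \<partial>lborel) \<longlonglongrightarrow> (\<integral>x. z x * \<phi> x \<partial>lborel)"
proof (rule tendsto_of_ennreal_abs_diff, rule tendsto_zero_ennreal)
  fix e :: real assume e: "0 < e"
  note [measurable] = hm zm
  from test_functionE[OF phi] obtain R where sm: "smooth \<phi>" and R: "0 < R" "\<And>x. x \<notin> {-R..R} \<Longrightarrow> \<phi> x = 0" by blast
  have [measurable]: "\<phi> \<in> borel_measurable borel" by (rule smooth_borel[OF sm])
  have "bounded (\<phi> ` {-R..R})"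
    by (intro compact_imp_bounded compact_continuous_image compact_Icc smooth_continuous sm)
  then obtain B where B: "0 < B" "\<And>x. x \<in> {-R..R} \<Longrightarrow> \<bar>\<phi> x\<bar> \<le> B"
    unfolding bounded_pos by auto
  obtain c where c: "0 < c" "\<And>g V r. g \<in> borel_measurable borel \<Longrightarrow> wint g \<le> ennreal V \<Longrightarrow> 0 \<le> V \<Longrightarrow> 1 \<le> r \<Longrightarrow>
     (\<integral>\<^sup>+y\<in>{R - r..R}. g y \<partial>lborel) \<le> ennreal (r * (c * V) powr (1 / p))"
    using left_average_le[of R] by blast
  define r where "r = max 1 (2 * R)"
  have r: "1 \<le> r" "R - r \<le> - R" by (auto simp: r_def)
  \<comment> \<open>the \<open>p\<close>-th power of the weighted distance below which the pairings differ by at most \<open>e / 2\<close>\<close>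
  define V where "V = (e / (2 * B * r)) powr p / c"
  have V: "0 < V" "B * (r * (c * V) powr (1 / p)) = e / 2"
    using e B c r p by (auto simp: V_def powr_powr)
  have "\<forall>\<^sub>F n in sequentially. wabs (\<lambda>x. h n x - z x) < ennreal V"
    by (rule order_tendstoD(2)[OF lim]) (use V in simp)
  then show "\<forall>\<^sub>F n in sequentially. ennreal \<bar>(\<integral>x. h n x * \<phi> x \<partial>lborel) - (\<integral>x. z x * \<phi> x \<partial>lborel)\<bar> < ennreal e"
  proof eventually_elim
    case (elim n)
    have li: "locally_integrable (h n)" "locally_integrable z" by (intro wint_imp_locally_integrable hfin zfin; measurable)+
    have i: "integrable lborel (\<lambda>x. h n x * \<phi> x)" "integrable lborel (\<lambda>x. z x * \<phi> x)"
      by (rule integrable_locally_integrable_mult[OF li(1) smooth_continuous[OF sm] R(2)], simp)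
         (rule integrable_locally_integrable_mult[OF li(2) smooth_continuous[OF sm] R(2)], simp)
    have "ennreal \<bar>(\<integral>x. h n x * \<phi> x \<partial>lborel) - (\<integral>x. z x * \<phi> x \<partial>lborel)\<bar> = ennreal (norm (\<integral>x. h n x * \<phi> x - z x * \<phi> x \<partial>lborel))"
      using i by simp
    also have "\<dots> \<le> (\<integral>\<^sup>+x. ennreal (norm (h n x * \<phi> x - z x * \<phi> x)) \<partial>lborel)"
      using i by (intro integral_norm_bound_ennreal) auto
    also have "\<dots> \<le> (\<integral>\<^sup>+x. ennreal B * (ennreal \<bar>h n x - z x\<bar> * indicator {R - r..R} x) \<partial>lborel)"
    proof (rule nn_integral_mono)
      fix x
      show "ennreal (norm (h n x * \<phi> x - z x * \<phi> x)) \<le> ennreal B * (ennreal \<bar>h n x - z x\<bar> * indicator {R - r..R} x)"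
      proof (cases "x \<in> {-R..R}")
        case True
        have "norm (h n x * \<phi> x - z x * \<phi> x) = \<bar>\<phi> x\<bar> * \<bar>h n x - z x\<bar>"
          by (simp add: abs_mult[symmetric] algebra_simps)
        also have "\<dots> \<le> B * \<bar>h n x - z x\<bar>" using B(2)[OF True] by (intro mult_right_mono) auto
        finally have "ennreal (norm (h n x * \<phi> x - z x * \<phi> x)) \<le> ennreal B * ennreal \<bar>h n x - z x\<bar>"
          using B by (simp add: ennreal_leI flip: ennreal_mult)
        then show ?thesis using True r by (simp add: indicator_def)
      next
        case False
        then show ?thesis using R(2)[OF False] by simp
      qed
    qed
    also have "\<dots> = ennreal B * (\<integral>\<^sup>+x\<in>{R - r..R}. ennreal \<bar>h n x - z x\<bar> \<partial>lborel)"
      by (intro nn_integral_cmult) measurable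
    also have "\<dots> \<le> ennreal B * ennreal (r * (c * V) powr (1 / p))"
      using elim V r by (intro mult_left_mono c(2)) (auto intro: less_imp_le)
    also have "\<dots> = ennreal (B * (r * (c * V) powr (1 / p)))"
      using B r by (intro ennreal_mult[symmetric]) auto
    also have "\<dots> = ennreal (e / 2)" by (simp only: V(2))
    also have "\<dots> < ennreal e" using e by (intro ennreal_lessI) auto
    finally show ?case .
  qed
qed

text \<open>Pairing with a test function along a sequence \<open>\<alpha> \<rightarrow> 1\<close>: one side tends to the pairing with the limit in norm, the
other to minus the pairing of \<open>u / E\<close> with \<open>\<phi>'\<close>.\<close>
lemma Sobolev_of_convergent_frac_left:
  assumes u: "u \<in> Lp_space p Mw"
    and g: "\<And>\<alpha>. \<alpha> \<in> {0<..<1} \<Longrightarrow> g \<alpha> \<in> Lp_space p Mw" "\<And>\<alpha>. \<alpha> \<in> {0<..<1} \<Longrightarrow> has_frac_left a x0 \<alpha> u (g \<alpha>)"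
    and v: "v \<in> Lp_space p Mw" and lim: "((\<lambda>\<alpha>. Lp_norm p Mw (\<lambda>x. g \<alpha> x - v x)) \<longlongrightarrow> 0) (at_left 1)"
  shows "u \<in> Sobolev p a x0 \<omega>"
proof -
  have um[measurable]: "u \<in> borel_measurable borel" and ufin: "wabs (untwist u) < top"
    and vm[measurable]: "v \<in> borel_measurable borel" and vfin: "wabs (untwist v) < top"
    using u v by (auto simp: Lp_space_iff)
  \<comment> \<open>stays in \<open>[1/2, 1)\<close>, where the decay of the right fractional derivatives is uniform\<close>
  define S where "S n = 1 - 1 / (real n + 2)" for n
  have S: "1/2 \<le> S n" "S n < 1" for n by (auto simp: S_def field_simps)
  have S1: "S \<longlonglongrightarrow> 1"
  proof -
    have "(\<lambda>n. 1 - 1 / (real n + 2)) \<longlonglongrightarrow> 1 - 0"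
      by (intro tendsto_intros tendsto_divide_0[OF tendsto_const] filterlim_at_top_imp_at_infinity
          filterlim_tendsto_add_at_top[OF tendsto_const, of _ _ 2, simplified add.commute] filterlim_real_sequentially)
    then show ?thesis by (simp add: S_def[abs_def])
  qed
  have Sl: "filterlim S (at_left 1) sequentially"
    unfolding filterlim_at using S1 less_imp_neq[OF S(2)] S(2) by (auto intro!: always_eventually)
  define h where "h n = untwist (g (S n))" for n
  have S01: "S n \<in> {0<..<1}" for n using S(1)[of n] S(2)[of n] by auto
  have gm[measurable]: "g (S n) \<in> borel_measurable borel" and hfin: "wabs (h n) < top" for n
    using g(1)[OF S01[of n]] by (auto simp: Lp_space_iff h_def)
  have hm[measurable]: "h n \<in> borel_measurable borel" for n unfolding h_def by measurable
  have dfin: "wabs (\<lambda>x. h n x - untwist v x) < top" for n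
  proof -
    have "wabs (\<lambda>x. h n x - untwist v x) \<le> wint (\<lambda>x. ennreal \<bar>h n x\<bar> + ennreal \<bar>untwist v x\<bar>)"
      by (intro wint_mono) (simp flip: ennreal_plus)
    also have "\<dots> \<le> ennreal (2 powr p) * (wabs (h n) + wabs (untwist v))" by (intro wint_add_le) measurable
    also have "\<dots> < top" using hfin vfin by (simp add: ennreal_mult_less_top)
    finally show ?thesis .
  qed
  have "(\<lambda>n. Lp_norm p Mw (\<lambda>x. g (S n) x - v x)) \<longlonglongrightarrow> 0"
    by (rule filterlim_compose[OF lim Sl])
  then have "(\<lambda>n. Lp_norm p Mw (\<lambda>x. g (S n) x - v x) powr p) \<longlonglongrightarrow> 0"
    using p by (intro tendsto_zero_powrI[where b = p]) (auto simp: Lp_norm_def)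
  moreover have "Lp_norm p Mw (\<lambda>x. g (S n) x - v x) powr p = enn2real (wabs (\<lambda>x. h n x - untwist v x))" for n
    using p by (subst Lp_norm_eq) (auto simp: powr_powr h_def right_diff_distrib)
  ultimately have "(\<lambda>n. enn2real (wabs (\<lambda>x. h n x - untwist v x))) \<longlonglongrightarrow> 0" by simp
  from tendsto_ennrealI[OF this]
  have hlim: "(\<lambda>n. wabs (\<lambda>x. h n x - untwist v x)) \<longlonglongrightarrow> 0" using dfin by simp
  have "has_weak_deriv (untwist u) (untwist v)"
    unfolding has_weak_deriv_def
  proof (intro conjI ballI)
    show "locally_integrable (untwist u)" "locally_integrable (untwist v)"
      by (intro wint_imp_locally_integrable ufin vfin; measurable)+
    fix \<phi> assume phi: "\<phi> \<in> test_functions"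
    then have phi': "\<phi> \<in> schwartz_minus" by (rule test_function_schwartz_minus)
    have "(\<lambda>n. \<integral>x. h n x * \<phi> x \<partial>lborel) \<longlonglongrightarrow> (\<integral>x. untwist v x * \<phi> x \<partial>lborel)"
      by (rule test_pairing_tendsto[OF hm _ hfin vfin hlim phi]) measurable
    moreover have "(\<lambda>n. \<integral>x. untwist u x * frac_right (S n) \<phi> x \<partial>lborel) \<longlonglongrightarrow> - (\<integral>x. untwist u x * deriv \<phi> x \<partial>lborel)"
      by (rule frac_right_pairing_tendsto[OF _ ufin phi' S S1]) measurable
    moreover have "(\<integral>x. untwist u x * frac_right (S n) \<phi> x \<partial>lborel) = (\<integral>x. h n x * \<phi> x \<partial>lborel)" for n
      using g(2)[OF S01[of n]] phi' by (simp add: has_frac_left_def h_def)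
    ultimately have "(\<integral>x. untwist v x * \<phi> x \<partial>lborel) = - (\<integral>x. untwist u x * deriv \<phi> x \<partial>lborel)"
      using LIMSEQ_unique by auto
    then show "(\<integral>x. untwist u x * deriv \<phi> x \<partial>lborel) = - (\<integral>x. untwist v x * \<phi> x \<partial>lborel)" by simp
  qed
  then show ?thesis using u v unfolding Sobolev_def left_deriv_iff_weak_deriv[symmetric] by auto
qed

end

theorem theorem2p12:
  fixes p :: real and \<omega> :: "real \<Rightarrow> real"
  assumes "1 \<le> p" and "\<omega> \<in> Ap_minus p"
  shows "\<exists>C>0. \<forall>(a :: real \<Rightarrow> real) (x0 :: real). continuous_on UNIV a \<longrightarrow>
    (\<forall>u \<in> Sobolev p a x0 \<omega>.
       (\<forall>\<alpha>\<in>{0<..<1}.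
          (\<exists>g \<in> Lp_space p (weighted_measure p a x0 \<omega>). has_frac_left a x0 \<alpha> u g) \<and>
          (\<forall>g \<in> Lp_space p (weighted_measure p a x0 \<omega>). has_frac_left a x0 \<alpha> u g \<longrightarrow>
             (AE x in lborel.
                set_integrable lborel {..<x} (frac_left_integrand a x0 \<alpha> u x) \<and>
                g x = frac_left_pointwise a x0 \<alpha> u x) \<and>
             Lp_norm p (weighted_measure p a x0 \<omega>) g \<le> C * Sobolev_norm p a x0 \<omega> u)) \<and>
       frac_left_tends_to_deriv p a x0 \<omega> u \<and>
       (AE x in lborel. ((\<lambda>\<alpha>. frac_left_pointwise a x0 \<alpha> u x) \<longlongrightarrow> u x) (at_right 0))) \<and>
    (\<forall>u \<in> Lp_space p (weighted_measure p a x0 \<omega>). \<forall>g :: real \<Rightarrow> real \<Rightarrow> real.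
       (\<forall>\<alpha>\<in>{0<..<1}. g \<alpha> \<in> Lp_space p (weighted_measure p a x0 \<omega>) \<and>
                        has_frac_left a x0 \<alpha> u (g \<alpha>)) \<and>
       (\<exists>v \<in> Lp_space p (weighted_measure p a x0 \<omega>).
          ((\<lambda>\<alpha>. Lp_norm p (weighted_measure p a x0 \<omega>) (\<lambda>x. g \<alpha> x - v x)) \<longlongrightarrow> 0) (at_left 1))
       \<longrightarrow> u \<in> Sobolev p a x0 \<omega> \<and> frac_left_tends_to_deriv p a x0 \<omega> u)"
proof -
  obtain K where "one_sided_weight p K \<omega>" using Ap_minus_one_sided_weight[OF assms] by blast
  then interpret one_sided_weight p K \<omega> .
  obtain D where D: "0 < D" "\<And>W f \<alpha>. antiderivative W f \<Longrightarrow> 0 < \<alpha> \<Longrightarrow> \<alpha> < 1 \<Longrightarrow>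
     wint (\<lambda>x. ennreal (frac_const \<alpha>) * (near_part \<alpha> W x + far_part \<alpha> W x)) \<le> ennreal D * (wabs W + wabs f)"
    using wint_frac_deriv_uniform by blast
  show ?thesis
  proof (intro exI[of _ "D powr (1 / p)"] conjI allI impI)
    show "0 < D powr (1 / p)" using D(1) by simp
    fix a :: "real \<Rightarrow> real" and x0 :: real
    assume "continuous_on UNIV a"
    then interpret twisted_weight p K \<omega> a x0 by unfold_locales
    note B = Sobolev_norm_bound[OF _ _ _ D(1) D(2)]
    show "\<forall>u \<in> Sobolev p a x0 \<omega>.
       (\<forall>\<alpha>\<in>{0<..<1}.
          (\<exists>g \<in> Lp_space p Mw. has_frac_left a x0 \<alpha> u g) \<and>
          (\<forall>g \<in> Lp_space p Mw. has_frac_left a x0 \<alpha> u g \<longrightarrow>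
             (AE x in lborel.
                set_integrable lborel {..<x} (frac_left_integrand a x0 \<alpha> u x) \<and>
                g x = frac_left_pointwise a x0 \<alpha> u x) \<and>
             Lp_norm p Mw g \<le> D powr (1 / p) * Sobolev_norm p a x0 \<omega> u)) \<and>
       frac_left_tends_to_deriv p a x0 \<omega> u \<and>
       (AE x in lborel. ((\<lambda>\<alpha>. frac_left_pointwise a x0 \<alpha> u x) \<longlongrightarrow> u x) (at_right 0))"
    proof (intro ballI conjI impI)
      fix u \<alpha> assume u: "u \<in> Sobolev p a x0 \<omega>" and "\<alpha> \<in> {0<..<1::real}"
      then have al: "0 < \<alpha>" "\<alpha> < 1" by auto
      show "\<exists>g \<in> Lp_space p Mw. has_frac_left a x0 \<alpha> u g" by (rule B(1)[OF u al]) (use al in auto)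
      fix g assume g: "g \<in> Lp_space p Mw" "has_frac_left a x0 \<alpha> u g"
      have *: "(AE x in lborel. set_integrable lborel {..<x} (frac_left_integrand a x0 \<alpha> u x) \<and> g x = frac_left_pointwise a x0 \<alpha> u x) \<and>
         Lp_norm p Mw g \<le> D powr (1 / p) * Sobolev_norm p a x0 \<omega> u"
        by (rule B(2)[OF u al _ _ _ g]) (use al in auto)
      show "AE x in lborel. set_integrable lborel {..<x} (frac_left_integrand a x0 \<alpha> u x) \<and> g x = frac_left_pointwise a x0 \<alpha> u x"
        using * by blast
      show "Lp_norm p Mw g \<le> D powr (1 / p) * Sobolev_norm p a x0 \<omega> u" using * by blast
    qed (rule Sobolev_limits; assumption)+
    fix u :: "real \<Rightarrow> real"
    show "\<forall>u \<in> Lp_space p Mw. \<forall>g :: real \<Rightarrow> real \<Rightarrow> real.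
       (\<forall>\<alpha>\<in>{0<..<1}. g \<alpha> \<in> Lp_space p Mw \<and> has_frac_left a x0 \<alpha> u (g \<alpha>)) \<and>
       (\<exists>v \<in> Lp_space p Mw. ((\<lambda>\<alpha>. Lp_norm p Mw (\<lambda>x. g \<alpha> x - v x)) \<longlongrightarrow> 0) (at_left 1))
       \<longrightarrow> u \<in> Sobolev p a x0 \<omega> \<and> frac_left_tends_to_deriv p a x0 \<omega> u"
    proof (intro ballI allI impI)
      fix u and g :: "real \<Rightarrow> real \<Rightarrow> real"
      assume u: "u \<in> Lp_space p Mw" and g: "(\<forall>\<alpha>\<in>{0<..<1}. g \<alpha> \<in> Lp_space p Mw \<and> has_frac_left a x0 \<alpha> u (g \<alpha>)) \<and>
         (\<exists>v \<in> Lp_space p Mw. ((\<lambda>\<alpha>. Lp_norm p Mw (\<lambda>x. g \<alpha> x - v x)) \<longlongrightarrow> 0) (at_left 1))"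
      then have "u \<in> Sobolev p a x0 \<omega>" using Sobolev_of_convergent_frac_left[OF u] by blast
      then show "u \<in> Sobolev p a x0 \<omega> \<and> frac_left_tends_to_deriv p a x0 \<omega> u" using Sobolev_limits(1) by blast
    qed
  qed
qed

end
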